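(* Let $q$ be a positive integer. Automorphisms of finite order of the second kind of the loop algebras $L(\mathfrak g,\cdot)$ have even order, and for even $q$ the quasiconjugacy classes of automorphisms of order $q$ of the second kind on the various $L(\mathfrak g,\cdot)$ are in bijection with $\mathcal J^q_{-1}(\mathfrak g)=\{(\varphi_+,\varphi_-)\in(\mathrm{Aut}\,\mathfrak g)^2:\varphi_+^2=\varphi_-^2,\ \varphi_\pm^2 \text{ has order } q/2\}/\sim$, where $\sim$ is the equivalence relation generated by $(\varphi_+,\varphi_-)\sim(\varphi_-,\varphi_+)$ and $(\varphi_+,\varphi_-)\sim(\alpha\varphi_+\alpha^{-1},\beta\varphi_-\beta^{-1})$ for all $\alpha,\beta\in\mathrm{Aut}(\mathfrak g)$ with $\alpha^{-1}\beta\in\big((\mathrm{Aut}\,\mathfrak g)^{\varphi_+^2}\big)_0$. Explicitly, the class $[\varphi_+,\varphi_-]$ corresponds to the quasiconjugacy class of the automorphism $(\varphi u)(t)=\varphi_+(u(-t))$ of $L(\mathfrak g,\varphi_-^{-1}\varphi_+)$.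
   Context: $\mathfrak g$ is a simple Lie algebra over $\mathbb F\in\{\mathbb R,\mathbb C\}$, compact if $\mathbb F=\mathbb R$. $L(\mathfrak g,\sigma)=\{u:\mathbb R\to\mathfrak g\text{ smooth}:u(t+2\pi)=\sigma(u(t))\}$ for $\sigma\in\mathrm{Aut}(\mathfrak g)$, with pointwise bracket. Every automorphism of $L(\mathfrak g,\sigma)$ is of the form $(\varphi u)(t)=\varphi_t(u(\lambda(t)))$ with $\lambda:\mathbb R\to\mathbb R$ a diffeomorphism satisfying $\lambda(t+2\pi)=\lambda(t)+2\pi\epsilon$, $\epsilon\in\{\pm1\}$, and $\varphi_t\in\mathrm{Aut}(\mathfrak g)$ smooth with $\varphi_{t+2\pi}=\sigma\varphi_t\sigma^{-\epsilon}$; it is of the first kind if $\epsilon=1$, of the second kind if $\epsilon=-1$. Automorphisms $\varphi$ of $L(\mathfrak g,\sigma)$ and $\tilde\varphi$ of $L(\mathfrak g,\tilde\sigma)$ are quasiconjugate if $\tilde\varphi=\psi\varphi\psi^{-1}$ for some Lie algebra isomorphism $\psi:L(\mathfrak g,\sigma)\to L(\mathfrak g,\tilde\sigma)$. $(\mathrm{Aut}\,\mathfrak g)^{\gamma}$ denotes the centralizer of $\gamma$ in $\mathrm{Aut}(\mathfrak g)$ and $H_0$ the identity component of a Lie group $H$. *)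

theory Defs
  imports "HOL-Analysis.Analysis"
begin

text \<open>The simple Lie algebra g is modelled as a finite-dimensional real vector space
 'a::euclidean_space with bracket br.  The flag cplx selects the ground field:
 cplx = False means F = R; cplx = True means F = C, with complex structure J
 (multiplication by i), and then F-linearity means real-linearity plus commuting with J.\<close>

definition flin :: "bool \<Rightarrow> ('a::euclidean_space \<Rightarrow> 'a) \<Rightarrow> ('a \<Rightarrow> 'a) \<Rightarrow> bool" where
  "flin cplx J f \<longleftrightarrow> linear f \<and> (cplx \<longrightarrow> (\<forall>x. f (J x) = J (f x)))"

definition lie_alg :: "bool \<Rightarrow> ('a::euclidean_space \<Rightarrow> 'a) \<Rightarrow> ('a \<Rightarrow> 'a \<Rightarrow> 'a) \<Rightarrow> bool" where
  "lie_alg cplx J br \<longleftrightarrow> bilinear br \<and> (\<forall>x. br x x = 0)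
     \<and> (\<forall>x y z. br x (br y z) + br y (br z x) + br z (br x y) = 0)
     \<and> (cplx \<longrightarrow> linear J \<and> (\<forall>x. J (J x) = - x) \<and> (\<forall>x y. br (J x) y = J (br x y)))"

definition F_subspace :: "bool \<Rightarrow> ('a::euclidean_space \<Rightarrow> 'a) \<Rightarrow> 'a set \<Rightarrow> bool" where
  "F_subspace cplx J S \<longleftrightarrow> subspace S \<and> (cplx \<longrightarrow> J ` S \<subseteq> S)"

definition lie_ideal :: "bool \<Rightarrow> ('a::euclidean_space \<Rightarrow> 'a) \<Rightarrow> ('a \<Rightarrow> 'a \<Rightarrow> 'a) \<Rightarrow> 'a set \<Rightarrow> bool" where
  "lie_ideal cplx J br I \<longleftrightarrow> F_subspace cplx J I \<and> (\<forall>x y. y \<in> I \<longrightarrow> br x y \<in> I)"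

definition simple_lie :: "bool \<Rightarrow> ('a::euclidean_space \<Rightarrow> 'a) \<Rightarrow> ('a \<Rightarrow> 'a \<Rightarrow> 'a) \<Rightarrow> bool" where
  "simple_lie cplx J br \<longleftrightarrow> lie_alg cplx J br \<and> (\<exists>x y. br x y \<noteq> 0)
     \<and> (\<forall>I. lie_ideal cplx J br I \<longrightarrow> I = {0} \<or> I = UNIV)"

definition trace_op :: "('a::euclidean_space \<Rightarrow> 'a) \<Rightarrow> real" where
  "trace_op f = (\<Sum>b\<in>Basis. f b \<bullet> b)"

definition killing :: "('a::euclidean_space \<Rightarrow> 'a \<Rightarrow> 'a) \<Rightarrow> 'a \<Rightarrow> 'a \<Rightarrow> real" where
  "killing br x y = trace_op (\<lambda>z. br x (br y z))"

text \<open>A real (semi)simple Lie algebra is compact iff its Killing form is negative definite.\<close>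
definition compact_lie :: "('a::euclidean_space \<Rightarrow> 'a \<Rightarrow> 'a) \<Rightarrow> bool" where
  "compact_lie br \<longleftrightarrow> (\<forall>x. x \<noteq> 0 \<longrightarrow> killing br x x < 0)"

definition lie_aut :: "bool \<Rightarrow> ('a::euclidean_space \<Rightarrow> 'a) \<Rightarrow> ('a \<Rightarrow> 'a \<Rightarrow> 'a) \<Rightarrow> ('a \<Rightarrow> 'a) set" where
  "lie_aut cplx J br = {f. bij f \<and> flin cplx J f \<and> (\<forall>x y. f (br x y) = br (f x) (f y))}"

definition smooth :: "(real \<Rightarrow> 'b::real_normed_vector) \<Rightarrow> bool" where
  "smooth u \<longleftrightarrow> (\<forall>k t. (((\<lambda>f s. vector_derivative f (at s)) ^^ k) u) differentiable (at t))"

definition loop_alg :: "('a \<Rightarrow> 'a) \<Rightarrow> (real \<Rightarrow> 'a::euclidean_space) set" where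
  "loop_alg \<sigma> = {u. smooth u \<and> (\<forall>t. u (t + 2 * pi) = \<sigma> (u t))}"

definition loop_iso :: "bool \<Rightarrow> ('a::euclidean_space \<Rightarrow> 'a) \<Rightarrow> ('a \<Rightarrow> 'a \<Rightarrow> 'a) \<Rightarrow> ('a \<Rightarrow> 'a) \<Rightarrow> ('a \<Rightarrow> 'a)
    \<Rightarrow> ((real \<Rightarrow> 'a) \<Rightarrow> (real \<Rightarrow> 'a)) \<Rightarrow> bool" where
  "loop_iso cplx J br \<sigma> \<sigma>' \<psi> \<longleftrightarrow>
     bij_betw \<psi> (loop_alg \<sigma>) (loop_alg \<sigma>')
   \<and> (\<forall>u\<in>loop_alg \<sigma>. \<forall>v\<in>loop_alg \<sigma>. \<psi> (\<lambda>t. u t + v t) = (\<lambda>t. \<psi> u t + \<psi> v t))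
   \<and> (\<forall>c. \<forall>u\<in>loop_alg \<sigma>. \<psi> (\<lambda>t. c *\<^sub>R u t) = (\<lambda>t. c *\<^sub>R \<psi> u t))
   \<and> (cplx \<longrightarrow> (\<forall>u\<in>loop_alg \<sigma>. \<psi> (\<lambda>t. J (u t)) = (\<lambda>t. J (\<psi> u t))))
   \<and> (\<forall>u\<in>loop_alg \<sigma>. \<forall>v\<in>loop_alg \<sigma>. \<psi> (\<lambda>t. br (u t) (v t)) = (\<lambda>t. br (\<psi> u t) (\<psi> v t)))"

definition loop_aut :: "bool \<Rightarrow> ('a::euclidean_space \<Rightarrow> 'a) \<Rightarrow> ('a \<Rightarrow> 'a \<Rightarrow> 'a) \<Rightarrow> ('a \<Rightarrow> 'a)
    \<Rightarrow> ((real \<Rightarrow> 'a) \<Rightarrow> (real \<Rightarrow> 'a)) \<Rightarrow> bool" where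
  "loop_aut cplx J br \<sigma> \<Phi> \<longleftrightarrow> loop_iso cplx J br \<sigma> \<sigma> \<Phi>"

text \<open>Second kind: (Phi u)(t) = phi_t(u(lambda t)), lambda(t+2pi) = lambda(t) - 2pi,
  phi_{t+2pi} = sigma phi_t sigma^{-epsilon} = sigma phi_t sigma.\<close>
definition second_kind :: "bool \<Rightarrow> ('a::euclidean_space \<Rightarrow> 'a) \<Rightarrow> ('a \<Rightarrow> 'a \<Rightarrow> 'a) \<Rightarrow> ('a \<Rightarrow> 'a)
    \<Rightarrow> ((real \<Rightarrow> 'a) \<Rightarrow> (real \<Rightarrow> 'a)) \<Rightarrow> bool" where
  "second_kind cplx J br \<sigma> \<Phi> \<longleftrightarrow>
     (\<exists>(lam :: real \<Rightarrow> real) (\<phi> :: real \<Rightarrow> 'a \<Rightarrow> 'a).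
        smooth lam \<and> bij lam \<and> smooth (inv lam)
      \<and> (\<forall>t. lam (t + 2 * pi) = lam t - 2 * pi)
      \<and> (\<forall>t. \<phi> t \<in> lie_aut cplx J br)
      \<and> smooth (\<lambda>t. Blinfun (\<phi> t))
      \<and> (\<forall>t. \<phi> (t + 2 * pi) = \<sigma> \<circ> \<phi> t \<circ> \<sigma>)
      \<and> (\<forall>u\<in>loop_alg \<sigma>. \<Phi> u = (\<lambda>t. \<phi> t (u (lam t)))))"

definition has_order_on :: "'b set \<Rightarrow> ('b \<Rightarrow> 'b) \<Rightarrow> nat \<Rightarrow> bool" where
  "has_order_on S f n \<longleftrightarrow> 0 < n \<and> (\<forall>u\<in>S. (f ^^ n) u = u)
     \<and> (\<forall>m. 0 < m \<and> m < n \<longrightarrow> \<not> (\<forall>u\<in>S. (f ^^ m) u = u))"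

definition quasiconj :: "bool \<Rightarrow> ('a::euclidean_space \<Rightarrow> 'a) \<Rightarrow> ('a \<Rightarrow> 'a \<Rightarrow> 'a)
    \<Rightarrow> ('a \<Rightarrow> 'a) \<times> ((real \<Rightarrow> 'a) \<Rightarrow> (real \<Rightarrow> 'a))
    \<Rightarrow> ('a \<Rightarrow> 'a) \<times> ((real \<Rightarrow> 'a) \<Rightarrow> (real \<Rightarrow> 'a)) \<Rightarrow> bool" where
  "quasiconj cplx J br x y \<longleftrightarrow> (\<exists>\<psi>. loop_iso cplx J br (fst x) (fst y) \<psi>
      \<and> (\<forall>u\<in>loop_alg (fst x). snd y (\<psi> u) = \<psi> (snd x u)))"

definition aut2_ord :: "bool \<Rightarrow> ('a::euclidean_space \<Rightarrow> 'a) \<Rightarrow> ('a \<Rightarrow> 'a \<Rightarrow> 'a) \<Rightarrow> nat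
    \<Rightarrow> (('a \<Rightarrow> 'a) \<times> ((real \<Rightarrow> 'a) \<Rightarrow> (real \<Rightarrow> 'a))) set" where
  "aut2_ord cplx J br q = {(\<sigma>, \<Phi>). \<sigma> \<in> lie_aut cplx J br \<and> loop_aut cplx J br \<sigma> \<Phi>
      \<and> second_kind cplx J br \<sigma> \<Phi> \<and> has_order_on (loop_alg \<sigma>) \<Phi> q}"

definition Jpairs :: "bool \<Rightarrow> ('a::euclidean_space \<Rightarrow> 'a) \<Rightarrow> ('a \<Rightarrow> 'a \<Rightarrow> 'a) \<Rightarrow> nat
    \<Rightarrow> (('a \<Rightarrow> 'a) \<times> ('a \<Rightarrow> 'a)) set" where
  "Jpairs cplx J br q = {(a, b). a \<in> lie_aut cplx J br \<and> b \<in> lie_aut cplx J br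
      \<and> a \<circ> a = b \<circ> b \<and> has_order_on UNIV (a \<circ> a) (q div 2)}"

definition cent_id0 :: "bool \<Rightarrow> ('a::euclidean_space \<Rightarrow> 'a) \<Rightarrow> ('a \<Rightarrow> 'a \<Rightarrow> 'a) \<Rightarrow> ('a \<Rightarrow> 'a)
    \<Rightarrow> ('a \<Rightarrow> 'a) set" where
  "cent_id0 cplx J br g =
     (let H = {c \<in> lie_aut cplx J br. c \<circ> g = g \<circ> c}
      in {c \<in> H. Blinfun c \<in> connected_component_set (Blinfun ` H) (Blinfun id)})"

definition gen_step :: "bool \<Rightarrow> ('a::euclidean_space \<Rightarrow> 'a) \<Rightarrow> ('a \<Rightarrow> 'a \<Rightarrow> 'a)
    \<Rightarrow> ('a \<Rightarrow> 'a) \<times> ('a \<Rightarrow> 'a) \<Rightarrow> ('a \<Rightarrow> 'a) \<times> ('a \<Rightarrow> 'a) \<Rightarrow> bool" where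
  "gen_step cplx J br p p' \<longleftrightarrow>
     fst p \<in> lie_aut cplx J br \<and> snd p \<in> lie_aut cplx J br \<and>
     (p' = (snd p, fst p)
      \<or> (\<exists>\<alpha> \<beta>. \<alpha> \<in> lie_aut cplx J br \<and> \<beta> \<in> lie_aut cplx J br
           \<and> inv \<alpha> \<circ> \<beta> \<in> cent_id0 cplx J br (fst p \<circ> fst p)
           \<and> p' = (\<alpha> \<circ> fst p \<circ> inv \<alpha>, \<beta> \<circ> snd p \<circ> inv \<beta>)))"

definition Jsim :: "bool \<Rightarrow> ('a::euclidean_space \<Rightarrow> 'a) \<Rightarrow> ('a \<Rightarrow> 'a \<Rightarrow> 'a)
    \<Rightarrow> ('a \<Rightarrow> 'a) \<times> ('a \<Rightarrow> 'a) \<Rightarrow> ('a \<Rightarrow> 'a) \<times> ('a \<Rightarrow> 'a) \<Rightarrow> bool" where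
  "Jsim cplx J br = (\<lambda>p p'. gen_step cplx J br p p' \<or> gen_step cplx J br p' p)\<^sup>*\<^sup>*"

definition explicit_aut :: "('a \<Rightarrow> 'a) \<times> ('a \<Rightarrow> 'a)
    \<Rightarrow> ('a \<Rightarrow> 'a) \<times> ((real \<Rightarrow> 'a) \<Rightarrow> (real \<Rightarrow> 'a))" where
  "explicit_aut p = (inv (snd p) \<circ> fst p, (\<lambda>u t. fst p (u (- t))))"

end

theory Submission
  imports Defs
begin

text \<open>
  An automorphism \<open>(\<Phi> u)(t) = \<phi>\<^sub>t (u (\<lambda> t))\<close> of the second kind of finite order covers a reflection \<open>\<lambda>\<close>, which
  a change of parameter turns into \<open>t \<mapsto> - t\<close>.  Averaging the trivial connection over the finite cyclic group
  generated by \<open>\<Phi>\<close> gives a \<open>\<Phi>\<close>-invariant connection with values in the derivations; its parallel transport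
  conjugates \<open>\<Phi>\<close> to \<open>u \<mapsto> \<phi>\<^sub>+ (u (- t))\<close> with constant \<open>\<phi>\<^sub>+\<close>.

  Conversely, a point evaluation of an isomorphism \<open>\<psi>\<close> of loop algebras makes the simple algebra a module over
  the periodic functions.  By simplicity each function acts injectively or as 0, the functions acting as 0 have
  a common zero by compactness, and by finite dimension they are all functions vanishing there.  Hence
  \<open>(\<psi> u)(t) = h\<^sub>t (u (\<mu> t))\<close> with \<open>\<mu>\<close> and \<open>h\<close> continuous, and if \<open>\<psi>\<close> is a quasiconjugacy, the values of \<open>h\<close> at the
  two fixed points of the reflection conjugate one pair into the other, joined by a path in the centralizer.
  For the opposite direction such a path can be made smooth: near 1 the centralizer consists of exponentials
  of derivations, because square roots near 1 of automorphisms are automorphisms.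
\<close>


section \<open>Smooth curves\<close>

text \<open>The second entry of a pair is the same automorphism seen from the other fixed point. On
  the circle \<open>t \<mapsto> - t\<close> fixes 0 and pi, and \<open>u (- pi - t)\<close> is the
  inverse twist of \<open>u (pi - t)\<close>; hence the automorphism attached to
  \<open>(\<phi>\<^sub>+, \<phi>\<^sub>-)\<close> acts around pi through
  \<open>\<phi>\<^sub>-\<close>. Regularity is treated asymmetrically. A quasiconjugacy is an
  abstract isomorphism, so nothing about its form may be assumed; but the identity component of a
  centralizer only asks for a connected set, so continuity of the extracted \<open>h\<close>
  suffices, and the orientation of \<open>\<mu>\<close> is read from its degree instead of its
  derivative. In the opposite direction the conjugating loop has to be smooth and compatible with
  both twists and with the reflection; a path in the centralizer is therefore made stationary near
  its ends before it is extended by these symmetries. Parallel transport fits the task because its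
  symmetries follow from uniqueness alone: two solutions of one linear equation with equal initial
  values coincide.\<close>

primrec ndiff :: "nat \<Rightarrow> (real \<Rightarrow> 'b::real_normed_vector) \<Rightarrow> bool" where
  "ndiff 0 f \<longleftrightarrow> True"
| "ndiff (Suc k) f \<longleftrightarrow> (\<exists>f'. (\<forall>t. (f has_vector_derivative f' t) (at t)) \<and> ndiff k f')"

lemma ndiff_SucI:
  "(\<And>t. (f has_vector_derivative f' t) (at t)) \<Longrightarrow> ndiff k f' \<Longrightarrow> ndiff (Suc k) f"
  by auto

lemma ndiff_Suc_iff:
  "ndiff (Suc k) f \<longleftrightarrow> (\<forall>t. f differentiable (at t)) \<and> ndiff k (\<lambda>s. vector_derivative f (at s))"
proof
  assume "ndiff (Suc k) f"
  then obtain f' where f': "\<forall>t. (f has_vector_derivative f' t) (at t)" "ndiff k f'" by auto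
  then have "f' = (\<lambda>s. vector_derivative f (at s))"
    by (intro ext vector_derivative_at[symmetric]) blast
  with f' show "(\<forall>t. f differentiable (at t)) \<and> ndiff k (\<lambda>s. vector_derivative f (at s))"
    by (auto intro: differentiableI_vector)
qed (auto simp: vector_derivative_works)

lemma ndiff_mono: "ndiff (Suc k) f \<Longrightarrow> ndiff k f"
proof (induction k arbitrary: f)
  case (Suc k)
  from Suc.prems obtain f' where "\<forall>t. (f has_vector_derivative f' t) (at t)" "ndiff (Suc k) f'"
    by (auto simp only: ndiff.simps)
  with Suc.IH show ?case by auto
qed simp

text \<open>The recursion of \<open>ndiff\<close> peels off the first derivative and accepts any
  witness for it, so closure rules follow by induction on the order with the curve
  generalized.\<close>

lemma smooth_iff_ndiff: "smooth u \<longleftrightarrow> (\<forall>k. ndiff k u)"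
proof -
  let ?D = "\<lambda>f s. vector_derivative f (at s)"
  have *: "ndiff k u \<longleftrightarrow> (\<forall>j<k. \<forall>t. ((?D ^^ j) u) differentiable (at t))" for k and u :: "real \<Rightarrow> 'a"
  proof (induction k arbitrary: u)
    case (Suc k)
    have "(\<forall>j<Suc k. \<forall>t. ((?D ^^ j) u) differentiable (at t)) \<longleftrightarrow>
      (\<forall>t. u differentiable (at t)) \<and> (\<forall>j<k. \<forall>t. ((?D ^^ j) (?D u)) differentiable (at t))"
      unfolding All_less_Suc2 by (simp add: funpow_Suc_right del: funpow.simps)
    then show ?case by (simp only: ndiff_Suc_iff Suc)
  qed simp
  show ?thesis unfolding smooth_def * by blast
qed

lemma smoothE:
  assumes "smooth f"
  obtains f' where "\<And>t. (f has_vector_derivative f' t) (at t)" "smooth f'"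
proof -
  have "ndiff (Suc k) f" for k using assms by (simp only: smooth_iff_ndiff)
  then have "f differentiable (at t)" "ndiff k (\<lambda>s. vector_derivative f (at s))" for k t
    by (simp_all only: ndiff_Suc_iff)
  then show ?thesis
    by (intro that[of "\<lambda>s. vector_derivative f (at s)"])
      (simp_all only: smooth_iff_ndiff vector_derivative_works[symmetric] simp_thms)
qed

lemma smooth_derivI:
  assumes "\<And>t. (f has_vector_derivative f' t) (at t)" "smooth f'"
  shows "smooth f"
  unfolding smooth_iff_ndiff
proof
  fix k show "ndiff k f"
    using assms by (cases k) (auto simp: smooth_iff_ndiff)
qed

text \<open>For functions whose derivatives stay in an explicit family: exponentials, sine and
  cosine, and the flat functions built from \<open>exp (- 1 / x)\<close>.\<close>

lemma smooth_family:
  assumes "\<And>f. f \<in> F \<Longrightarrow> \<exists>f'\<in>F. \<forall>t. (f has_vector_derivative f' t) (at t)" "f \<in> F"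
  shows "smooth f"
proof -
  have "ndiff k f" for k
    using assms(2)
  proof (induction k arbitrary: f)
    case (Suc k)
    with assms(1)[of f] show ?case by auto
  qed simp
  then show ?thesis by (simp add: smooth_iff_ndiff)
qed

lemma smooth_continuous: "smooth f \<Longrightarrow> continuous_on S f"
  by (meson smoothE has_vector_derivative_continuous continuous_at_imp_continuous_on)

lemma smooth_isCont: "smooth f \<Longrightarrow> isCont f t"
  by (meson smoothE has_vector_derivative_continuous)

lemma smooth_const [simp]: "smooth (\<lambda>_. c)"
  by (rule smooth_family[of "range (\<lambda>c _. c)"]) (auto intro!: exI[of _ 0] rangeI)

lemma smooth_ident [simp]: "smooth (\<lambda>t. t)"
  by (rule smooth_derivI[where f' = "\<lambda>_. 1"]) (auto intro!: derivative_eq_intros)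

lemma ndiff_linear:
  assumes "bounded_linear L" "ndiff k f"
  shows "ndiff k (\<lambda>t. L (f t))"
  using assms(2)
proof (induction k arbitrary: f)
  case (Suc k)
  then obtain f' where "\<forall>t. (f has_vector_derivative f' t) (at t)" "ndiff k f'" by auto
  with Suc show ?case
    by (auto intro!: exI[of _ "\<lambda>t. L (f' t)"] bounded_linear.has_vector_derivative[OF assms(1)])
qed simp

lemma smooth_linear: "bounded_linear L \<Longrightarrow> smooth f \<Longrightarrow> smooth (\<lambda>t. L (f t))"
  by (simp add: smooth_iff_ndiff ndiff_linear)

lemma ndiff_add: "ndiff k f \<Longrightarrow> ndiff k g \<Longrightarrow> ndiff k (\<lambda>t. f t + g t)"
proof (induction k arbitrary: f g)
  case (Suc k)
  then obtain f' g' where "\<forall>t. (f has_vector_derivative f' t) (at t)" "ndiff k f'"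
    "\<forall>t. (g has_vector_derivative g' t) (at t)" "ndiff k g'" by auto
  with Suc show ?case
    by (auto intro!: exI[of _ "\<lambda>t. f' t + g' t"] has_vector_derivative_add)
qed simp

lemma smooth_add: "smooth f \<Longrightarrow> smooth g \<Longrightarrow> smooth (\<lambda>t. f t + g t)"
  by (simp add: smooth_iff_ndiff ndiff_add)

lemma smooth_minus: "smooth f \<Longrightarrow> smooth (\<lambda>t. - f t)"
  by (rule smooth_linear[OF bounded_linear_minus[OF bounded_linear_ident]])

lemma smooth_diff: "smooth f \<Longrightarrow> smooth g \<Longrightarrow> smooth (\<lambda>t. f t - g t)"
  using smooth_add[of f "\<lambda>t. - g t"] smooth_minus[of g] by simp

lemma smooth_sum: "(\<And>i. i \<in> I \<Longrightarrow> smooth (f i)) \<Longrightarrow> smooth (\<lambda>t. \<Sum>i\<in>I. f i t)"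
  by (induction I rule: infinite_finite_induct) (auto intro: smooth_add)

lemma ndiff_bilinear:
  assumes "bounded_bilinear P" "ndiff k f" "ndiff k g"
  shows "ndiff k (\<lambda>t. P (f t) (g t))"
  using assms(2,3)
proof (induction k arbitrary: f g)
  case (Suc k)
  then obtain f' g' where "\<forall>t. (f has_vector_derivative f' t) (at t)" "ndiff k f'"
    "\<forall>t. (g has_vector_derivative g' t) (at t)" "ndiff k g'" by auto
  moreover have "ndiff k f" "ndiff k g" using Suc.prems by (blast intro: ndiff_mono)+
  ultimately show ?case using Suc.IH
    by (auto intro!: exI[of _ "\<lambda>t. P (f t) (g' t) + P (f' t) (g t)"] ndiff_add
      bounded_bilinear.has_vector_derivative[OF assms(1)])
qed simp

lemma smooth_bilinear:
  "bounded_bilinear P \<Longrightarrow> smooth f \<Longrightarrow> smooth g \<Longrightarrow> smooth (\<lambda>t. P (f t) (g t))"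
  by (simp add: smooth_iff_ndiff ndiff_bilinear)

lemmas smooth_scaleR = smooth_bilinear[OF bounded_bilinear_scaleR]
lemmas smooth_mult = smooth_bilinear[OF bounded_bilinear_mult]

lemma smooth_power:
  fixes f :: "real \<Rightarrow> 'b::real_normed_algebra_1"
  shows "smooth f \<Longrightarrow> smooth (\<lambda>t. f t ^ n)"
  by (induction n) (auto intro: smooth_mult)

lemma ndiff_compose:
  assumes "ndiff k f" "ndiff k g"
  shows "ndiff k (\<lambda>t. f (g t))"
  using assms
proof (induction k arbitrary: f)
  case (Suc k)
  then obtain f' g' where f': "\<And>t. (f has_vector_derivative f' t) (at t)" "ndiff k f'"
    and g': "\<And>t. (g has_vector_derivative g' t) (at t)" "ndiff k g'" by auto
  have "((\<lambda>t. f (g t)) has_vector_derivative g' t *\<^sub>R f' (g t)) (at t)" for t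
    using vector_diff_chain_at[OF g'(1) f'(1)] by (simp add: o_def)
  moreover have "ndiff k (\<lambda>t. g' t *\<^sub>R f' (g t))"
    by (intro ndiff_bilinear[OF bounded_bilinear_scaleR] g' Suc.IH f' ndiff_mono[OF Suc.prems(2)])
  ultimately show ?case by (rule ndiff_SucI)
qed simp

lemma smooth_compose: "smooth f \<Longrightarrow> smooth g \<Longrightarrow> smooth (\<lambda>t. f (g t))"
  by (simp add: smooth_iff_ndiff ndiff_compose)

text \<open>The quotient form suits derivatives that come from an algebraic identity for
  differences, as for inverses, or from values along a sequence.\<close>

lemma has_vector_derivative_iff_tendsto:
  "(f has_vector_derivative D) (at t) \<longleftrightarrow> ((\<lambda>s. (1 / (s - t)) *\<^sub>R (f s - f t)) \<longlongrightarrow> D) (at t)"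
proof -
  have "(f has_vector_derivative D) (at t) \<longleftrightarrow>
      ((\<lambda>s. norm (f s - f t - (s - t) *\<^sub>R D) / norm (s - t)) \<longlongrightarrow> 0) (at t)"
    by (simp add: has_vector_derivative_def has_derivative_iff_norm bounded_linear_scaleR_left)
  also have "\<dots> \<longleftrightarrow> ((\<lambda>s. norm ((1 / (s - t)) *\<^sub>R (f s - f t) - D)) \<longlongrightarrow> 0) (at t)"
  proof (rule tendsto_cong)
    have "norm (f s - f t - (s - t) *\<^sub>R D) / norm (s - t) = norm ((1 / (s - t)) *\<^sub>R (f s - f t) - D)"
      if "s \<noteq> t" for s
    proof -
      have "(1 / (s - t)) *\<^sub>R (f s - f t) - D = (1 / (s - t)) *\<^sub>R (f s - f t - (s - t) *\<^sub>R D)"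
        using that by (simp add: scaleR_diff_right)
      then show ?thesis by simp
    qed
    then show "\<forall>\<^sub>F s in at t. norm (f s - f t - (s - t) *\<^sub>R D) / norm (s - t) =
      norm ((1 / (s - t)) *\<^sub>R (f s - f t) - D)"
      by (auto simp: eventually_at_filter)
  qed
  finally show ?thesis by (simp add: tendsto_norm_zero_iff Lim_null[of _ D])
qed

text \<open>The identity \<open>d s - d t = - (d s * (c s - c t) * d t)\<close> gives the derivative
  once \<open>d\<close> is continuous at \<open>t\<close>. Continuity needs \<open>d\<close> to be
  bounded near \<open>t\<close>, which the same identity yields by absorption.\<close>

lemma has_vector_derivative_left_inverse:
  fixes c d :: "real \<Rightarrow> 'b::real_normed_algebra_1"
  assumes c: "(c has_vector_derivative c') (at t)"
    and dc: "\<And>s. d s * c s = 1" and cd: "\<And>s. c s * d s = 1"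
  shows "(d has_vector_derivative - d t * c' * d t) (at t)"
proof -
  have diff: "d s - d t = - (d s * (c s - c t) * d t)" for s
  proof -
    have "d s * (c s - c t) * d t = d s * c s * d t - d s * (c t * d t)" by (simp add: algebra_simps)
    then show ?thesis by (simp add: dc cd)
  qed
  have cont: "(c \<longlongrightarrow> c t) (at t)"
    using has_vector_derivative_continuous[OF c] by (simp add: isCont_def)
  have "((\<lambda>s. norm (c s - c t) * norm (d t)) \<longlongrightarrow> norm (c t - c t) * norm (d t)) (at t)"
    by (intro tendsto_intros cont)
  then have "\<forall>\<^sub>F s in at t. norm (c s - c t) * norm (d t) < 1/2"
    by (rule order_tendstoD) simp
  \<comment> \<open>Near \<open>t\<close> the identity gives norm (d s) at most norm (d t) plus half
    of norm (d s); the last summand is absorbed on the left.\<close>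
  then have bd: "\<forall>\<^sub>F s in at t. norm (d s) \<le> 2 * norm (d t)"
  proof (eventually_elim)
    case (elim s)
    have "norm (d s) \<le> norm (d t) + norm (d s - d t)" by (rule norm_triangle_sub)
    also have "norm (d s - d t) \<le> norm (d s) * (norm (c s - c t) * norm (d t))"
    proof -
      have "norm (d s * (c s - c t) * d t) \<le> norm (d s * (c s - c t)) * norm (d t)"
        by (rule norm_mult_ineq)
      also have "\<dots> \<le> norm (d s) * norm (c s - c t) * norm (d t)"
        by (intro mult_right_mono norm_mult_ineq norm_ge_zero)
      finally show ?thesis by (simp add: diff mult.assoc)
    qed
    also have "\<dots> \<le> norm (d s) * (1/2)" using elim by (intro mult_left_mono) auto
    finally show ?case by simp
  qed
  have "(d \<longlongrightarrow> d t) (at t)"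
  proof (rule Lim_transform_eventually[of "\<lambda>s. d t + - (d s * (c s - c t) * d t)"])
    have "((\<lambda>s. d s * (c s - c t)) \<longlongrightarrow> 0) (at t)"
    proof (rule Lim_null_comparison)
      show "\<forall>\<^sub>F s in at t. norm (d s * (c s - c t)) \<le> 2 * norm (d t) * norm (c s - c t)"
        using bd
        by eventually_elim (rule order_trans[OF norm_mult_ineq mult_right_mono[OF _ norm_ge_zero]])
      have "((\<lambda>s. 2 * norm (d t) * norm (c s - c t)) \<longlongrightarrow> 2 * norm (d t) * norm (c t - c t)) (at t)"
        by (intro tendsto_intros cont)
      then show "((\<lambda>s. 2 * norm (d t) * norm (c s - c t)) \<longlongrightarrow> 0) (at t)" by simp
    qed
    from tendsto_add[OF tendsto_const tendsto_minus[OF tendsto_mult[OF this tendsto_const]], of "d t" "d t"]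
    show "((\<lambda>s. d t + - (d s * (c s - c t) * d t)) \<longlongrightarrow> d t) (at t)" by simp
  qed (auto simp: diff[symmetric])
  moreover have "((\<lambda>s. (1 / (s - t)) *\<^sub>R (c s - c t)) \<longlongrightarrow> c') (at t)"
    using c by (simp only: has_vector_derivative_iff_tendsto)
  ultimately have "((\<lambda>s. - (d s * ((1 / (s - t)) *\<^sub>R (c s - c t)) * d t)) \<longlongrightarrow> - (d t * c' * d t)) (at t)"
    by (intro tendsto_intros)
  moreover have "- (d s * ((1 / (s - t)) *\<^sub>R (c s - c t)) * d t) = (1 / (s - t)) *\<^sub>R (d s - d t)" for s
    by (simp add: diff)
  ultimately show ?thesis by (simp add: has_vector_derivative_iff_tendsto)
qed

text \<open>The derivative \<open>- d t * c' t * d t\<close> contains \<open>d\<close> itself, so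
  each order of differentiability of \<open>d\<close> is drawn from the preceding one.\<close>

lemma ndiff_left_inverse:
  fixes c d :: "real \<Rightarrow> 'b::real_normed_algebra_1"
  assumes "ndiff k c" and dc: "\<And>s. d s * c s = 1" and cd: "\<And>s. c s * d s = 1"
  shows "ndiff k d"
  using assms(1)
proof (induction k)
  case (Suc k)
  then obtain c' where c': "\<And>t. (c has_vector_derivative c' t) (at t)" "ndiff k c'" by auto
  have "(d has_vector_derivative - d t * c' t * d t) (at t)" for t
    by (rule has_vector_derivative_left_inverse[OF c'(1) dc cd])
  moreover have "ndiff k d" using Suc ndiff_mono by blast
  then have "ndiff k (\<lambda>t. - d t * c' t * d t)"
    by (intro ndiff_bilinear[OF bounded_bilinear_mult]
      ndiff_linear[OF bounded_linear_minus[OF bounded_linear_ident]] c'(2))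
  ultimately show ?case by (rule ndiff_SucI)
qed simp

lemma smooth_left_inverse:
  fixes c d :: "real \<Rightarrow> 'b::real_normed_algebra_1"
  assumes "smooth c" "\<And>s. d s * c s = 1" "\<And>s. c s * d s = 1"
  shows "smooth d"
  unfolding smooth_iff_ndiff
proof
  fix k show "ndiff k d"
    by (rule ndiff_left_inverse[OF _ assms(2,3)]) (use assms(1) in \<open>simp add: smooth_iff_ndiff\<close>)
qed

lemma ndiff_inverse:
  fixes f :: "real \<Rightarrow> real"
  shows "ndiff k f \<Longrightarrow> (\<And>t. f t \<noteq> 0) \<Longrightarrow> ndiff k (\<lambda>t. inverse (f t))"
  by (rule ndiff_left_inverse[of k f]) auto

lemma smooth_inverse:
  fixes f :: "real \<Rightarrow> real"
  shows "smooth f \<Longrightarrow> (\<And>t. f t \<noteq> 0) \<Longrightarrow> smooth (\<lambda>t. inverse (f t))"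
  by (simp add: smooth_iff_ndiff ndiff_inverse)

lemma smooth_inverse_function:
  fixes f g :: "real \<Rightarrow> real"
  assumes "smooth f" and f': "\<And>t. (f has_vector_derivative f' t) (at t)" and pos: "\<And>t. 0 < f' t"
    and fg: "\<And>t. f (g t) = t" and gf: "\<And>t. g (f t) = t"
  shows "smooth g"
proof -
  have sm': "smooth f'"
  proof -
    obtain f2 where "\<And>t. (f has_vector_derivative f2 t) (at t)" "smooth f2"
      using \<open>smooth f\<close> smoothE by blast
    moreover have "f2 = f'" using f' calculation(1) vector_derivative_unique_at by blast
    ultimately show ?thesis by simp
  qed
  have der: "(g has_vector_derivative inverse (f' (g t))) (at t)" for t
  proof -
    have "(g has_derivative (\<lambda>x. x * inverse (f' (g t)))) (at (f (g t)))"
      using f'[of "g t"] pos[of "g t"] 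
      by (intro has_derivative_inverse_strong[of UNIV "g t" f g "\<lambda>x. x * f' (g t)"])
         (auto simp: has_vector_derivative_def gf o_def smooth_continuous[OF \<open>smooth f\<close>] fun_eq_iff)
    then show ?thesis by (simp add: has_vector_derivative_def fg)
  qed
  have "ndiff k g" for k
  proof (induction k)
    case (Suc k)
    have "ndiff k (\<lambda>t. inverse (f' (g t)))"
      using sm' pos by (intro ndiff_inverse ndiff_compose[OF _ Suc]) (auto simp: smooth_iff_ndiff less_le)
    with der show ?case by (rule ndiff_SucI)
  qed simp
  then show ?thesis by (simp add: smooth_iff_ndiff)
qed

text \<open>The local comparison curves have derivatives \<open>G t\<close>. By uniqueness of
  derivatives the diagonal \<open>G t t\<close> agrees near every point with one of them, so the
  induction hypothesis applies to the diagonal.\<close>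

lemma ndiff_local:
  assumes "\<And>t. \<exists>g. ndiff k g \<and> (\<forall>\<^sub>F s in nhds t. f s = g s)"
  shows "ndiff k f"
  using assms
proof (induction k arbitrary: f)
  case (Suc k)
  have "\<exists>g'. ndiff k g' \<and> (\<forall>\<^sub>F s in nhds t. (f has_vector_derivative g' s) (at s))" for t
  proof -
    obtain g g' where g: "\<And>s. (g has_vector_derivative g' s) (at s)" "ndiff k g'"
      "\<forall>\<^sub>F s in nhds t. f s = g s" using Suc.prems by force
    from g(3) have "\<forall>\<^sub>F s in nhds t. \<forall>\<^sub>F x in nhds s. f x = g x"
      by (simp add: eventually_eventually)
    then have "\<forall>\<^sub>F s in nhds t. (f has_vector_derivative g' s) (at s)"
    proof eventually_elim
      case (elim s)
      have *: "(\<lambda>x. (1 / (x - s)) *\<^sub>R (f x - f s)) = (\<lambda>x. (1 / (x - s)) *\<^sub>R (f x - g s))"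
        using eventually_nhds_x_imp_x[OF elim] by simp
      have "((\<lambda>x. (1 / (x - s)) *\<^sub>R (f x - f s)) \<longlongrightarrow> g' s) (at s)"
        unfolding *
      proof (rule Lim_transform_eventually)
        show "((\<lambda>x. (1 / (x - s)) *\<^sub>R (g x - g s)) \<longlongrightarrow> g' s) (at s)"
          using g(1)[of s] by (simp only: has_vector_derivative_iff_tendsto)
        show "\<forall>\<^sub>F x in at s. (1 / (x - s)) *\<^sub>R (g x - g s) = (1 / (x - s)) *\<^sub>R (f x - g s)"
          using elim unfolding eventually_at_filter by eventually_elim simp
      qed
      then show ?case by (simp only: has_vector_derivative_iff_tendsto)
    qed
    with g(2) show ?thesis by blast
  qed
  then obtain G where G: "\<And>t. ndiff k (G t)"
    "\<And>t. \<forall>\<^sub>F s in nhds t. (f has_vector_derivative G t s) (at s)" by metis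
  have "(f has_vector_derivative G t t) (at t)" for t
    using eventually_nhds_x_imp_x[OF G(2)] .
  moreover have "ndiff k (\<lambda>t. G t t)"
  proof (rule Suc.IH)
    fix t
    have "\<forall>\<^sub>F s in nhds t. G s s = G t s"
      using G(2)[of t] by eventually_elim (rule vector_derivative_unique_at[OF calculation])
    with G(1) show "\<exists>g. ndiff k g \<and> (\<forall>\<^sub>F s in nhds t. G s s = g s)" by blast
  qed
  ultimately show ?case by (rule ndiff_SucI)
qed simp

lemma smooth_local:
  assumes "\<And>t. \<exists>g. smooth g \<and> (\<forall>\<^sub>F s in nhds t. f s = g s)"
  shows "smooth f"
  unfolding smooth_iff_ndiff
proof
  fix k show "ndiff k f"
    by (rule ndiff_local) (use assms in \<open>auto simp: smooth_iff_ndiff\<close>)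
qed

section \<open>Exponential, trigonometric and bump functions\<close>

lemma smooth_exp_scaleR:
  fixes A :: "'b::{real_normed_algebra_1,banach}"
  shows "smooth (\<lambda>t. exp (t *\<^sub>R A))"
proof (rule smooth_family[of "range (\<lambda>B t. exp (t *\<^sub>R A) * B)"])
  fix f assume "f \<in> range (\<lambda>B t. exp (t *\<^sub>R A) * B)"
  then obtain B where f: "f = (\<lambda>t. exp (t *\<^sub>R A) * B)" by blast
  have "(f has_vector_derivative exp (t *\<^sub>R A) * (A * B)) (at t)" for t
    unfolding f using bounded_linear.has_vector_derivative[OF bounded_linear_mult_left
      exp_scaleR_has_vector_derivative_right[of A t UNIV], of B] by (simp add: mult.assoc)
  then show "\<exists>f'\<in>range (\<lambda>B t. exp (t *\<^sub>R A) * B). \<forall>t. (f has_vector_derivative f' t) (at t)"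
    by (intro bexI[of _ "\<lambda>t. exp (t *\<^sub>R A) * (A * B)"]) auto
next
  show "(\<lambda>t. exp (t *\<^sub>R A)) \<in> range (\<lambda>B t. exp (t *\<^sub>R A) * B)"
    by (rule image_eqI[of _ _ 1]) simp_all
qed

lemma smooth_sin: "smooth (\<lambda>t::real. sin t)" and smooth_cos: "smooth (\<lambda>t::real. cos t)"
proof -
  let ?F = "range (\<lambda>(a, b) t. a * sin t + b * cos (t::real))"
  have *: "\<exists>f'\<in>?F. \<forall>t. (f has_vector_derivative f' t) (at t)" if "f \<in> ?F" for f
  proof -
    from that obtain a b where f: "f = (\<lambda>t. a * sin t + b * cos t)" by auto
    have "(f has_vector_derivative (- b) * sin t + a * cos t) (at t)" for t
      unfolding f has_real_derivative_iff_has_vector_derivative[symmetric]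
      by (auto intro!: derivative_eq_intros)
    moreover have "(\<lambda>t. (- b) * sin t + a * cos t) \<in> ?F"
      by (rule image_eqI[of _ _ "(- b, a)"]) auto
    ultimately show ?thesis by (intro bexI[of _ "\<lambda>t. (- b) * sin t + a * cos t"] allI)
  qed
  show "smooth (\<lambda>t::real. sin t)"
    by (rule smooth_family[of ?F, OF *]) (auto intro!: image_eqI[of _ _ "(1, 0)"])
  show "smooth (\<lambda>t::real. cos t)"
    by (rule smooth_family[of ?F, OF *]) (auto intro!: image_eqI[of _ _ "(0, 1)"])
qed

text \<open>The derivatives of \<open>exp (- 1 / x)\<close> have the form \<open>p (1 / x) * exp (- 1 / x)\<close> for polynomials
  \<open>p\<close>, and all of these tend to 0 from the right.\<close>
definition flat :: "real poly \<Rightarrow> real \<Rightarrow> real" where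
  "flat p x = (if 0 < x then poly p (inverse x) * exp (- inverse x) else 0)"

lemma flat_tendsto_0: "(flat p \<longlongrightarrow> 0) (at 0)"
proof -
  have "((\<lambda>y. poly p y * exp (- y)) \<longlongrightarrow> 0) at_top"
  proof (induction p)
    case (pCons a p)
    have "((\<lambda>y. \<Sum>i\<le>degree (pCons a p). coeff (pCons a p) i * (y ^ i / exp y)) \<longlongrightarrow>
      (\<Sum>i\<le>degree (pCons a p). coeff (pCons a p) i * 0)) at_top"
      by (intro tendsto_intros tendsto_power_div_exp_0)
    then show ?case
      by (simp add: poly_altdef sum_distrib_right exp_minus divide_inverse mult.assoc)
  qed simp
  then have "((\<lambda>x. poly p (inverse x) * exp (- inverse x)) \<longlongrightarrow> 0) (at_right 0)"
    by (rule filterlim_compose[OF _ filterlim_inverse_at_top_right])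
  then have "(flat p \<longlongrightarrow> 0) (at_right 0)"
    by (rule Lim_transform_eventually) (auto simp: flat_def eventually_at_filter)
  moreover have "(flat p \<longlongrightarrow> 0) (at_left 0)"
    by (rule tendsto_eventually) (auto simp: flat_def eventually_at_filter)
  ultimately show ?thesis by (simp add: filterlim_split_at)
qed

text \<open>With y = 1 / x one has d/dx = - y^2 d/dy, which turns p(y) exp (- y) into y^2 (p -
  p')(y) exp (- y); the polynomial \<open>[:0, 0, 1:]\<close> is y^2.\<close>

lemma flat_deriv: "(flat p has_vector_derivative flat ([:0, 0, 1:] * (p - pderiv p)) x) (at x)"
proof -
  consider "x < 0" | "x = 0" | "0 < x" by linarith
  then show ?thesis
  proof cases
    case 1
    have "((\<lambda>_. 0) has_vector_derivative flat ([:0, 0, 1:] * (p - pderiv p)) x) (at x)"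
      using 1 by (auto simp: flat_def intro!: derivative_eq_intros)
    then show ?thesis
      by (rule has_vector_derivative_transform_within_open[where S = "{..<0}"])
        (use 1 in \<open>auto simp: flat_def\<close>)
  next
    case 2
    \<comment> \<open>Division by \<open>s\<close> multiplies the polynomial by y = 1 / s, so the
      difference quotient at 0 is again a flat function and tends to 0.\<close>
    have "(1 / (s - 0)) *\<^sub>R (flat p s - flat p 0) = flat ([:0, 1:] * p) s" for s
      by (auto simp: flat_def field_simps)
    then show ?thesis using flat_tendsto_0[of "[:0, 1:] * p"]
      by (simp add: has_vector_derivative_iff_tendsto 2 flat_def[of _ 0])
  next
    case 3
    have "((\<lambda>x. poly p (inverse x) * exp (- inverse x)) has_real_derivative
       flat ([:0, 0, 1:] * (p - pderiv p)) x) (at x)"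
    proof -
      have "((\<lambda>x. poly p (inverse x) * exp (- inverse x)) has_real_derivative
         poly p (inverse x) * (exp (- inverse x) * (inverse x * inverse x)) +
         poly (pderiv p) (inverse x) * - (inverse x * inverse x) * exp (- inverse x)) (at x)"
        using 3 by (auto intro!: derivative_eq_intros DERIV_chain2[OF poly_DERIV] simp: power2_eq_square)
      moreover have "poly p (inverse x) * (exp (- inverse x) * (inverse x * inverse x)) +
         poly (pderiv p) (inverse x) * - (inverse x * inverse x) * exp (- inverse x) =
         flat ([:0, 0, 1:] * (p - pderiv p)) x"
        using 3 by (simp add: flat_def algebra_simps)
      ultimately show ?thesis by simp
    qed
    then have "((\<lambda>x. poly p (inverse x) * exp (- inverse x)) has_vector_derivative
       flat ([:0, 0, 1:] * (p - pderiv p)) x) (at x)"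
      by (simp add: has_real_derivative_iff_has_vector_derivative)
    then show ?thesis
      by (rule has_vector_derivative_transform_within_open[where S = "{0<..}"])
        (use 3 in \<open>auto simp: flat_def\<close>)
  qed
qed

lemma smooth_step_exists:
  obtains \<theta> :: "real \<Rightarrow> real" where "smooth \<theta>" "\<And>x. x \<le> 0 \<Longrightarrow> \<theta> x = 0" "\<And>x. 1 \<le> x \<Longrightarrow> \<theta> x = 1"
proof -
  have sm: "smooth (flat 1)"
    by (rule smooth_family[of "range flat"]) (auto intro: flat_deriv)
  have sm1: "smooth (\<lambda>x. flat 1 (1 - x))"
    by (rule smooth_compose[OF sm]) (intro smooth_diff smooth_const smooth_ident)
  have nonneg: "0 \<le> flat 1 x" for x by (simp add: flat_def)
  have pos: "0 < flat 1 x" if "0 < x" for x using that by (simp add: flat_def)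
  have sum_pos: "0 < flat 1 x + flat 1 (1 - x)" for x
    using nonneg[of x] nonneg[of "1 - x"] pos[of x] pos[of "1 - x"] by (cases "0 < x") auto
  show ?thesis
  proof (rule that[of "\<lambda>x. flat 1 x * inverse (flat 1 x + flat 1 (1 - x))"])
    show "smooth (\<lambda>x. flat 1 x * inverse (flat 1 x + flat 1 (1 - x)))"
      using sum_pos by (intro smooth_mult sm smooth_inverse smooth_add sm1) (auto simp: less_le)
  next
    fix x :: real assume "1 \<le> x"
    then show "flat 1 x * inverse (flat 1 x + flat 1 (1 - x)) = 1"
      using pos[of x] by (simp add: flat_def)
  qed (simp add: flat_def)
qed

lemma smooth_bump_exists:
  fixes s \<delta> :: real
  assumes "0 < \<delta>"
  obtains \<beta> :: "real \<Rightarrow> real" where "smooth \<beta>" "\<And>x. \<bar>x - s\<bar> \<le> \<delta> \<Longrightarrow> \<beta> x = 1"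
    "\<And>x. 2 * \<delta> \<le> \<bar>x - s\<bar> \<Longrightarrow> \<beta> x = 0"
proof -
  obtain \<theta> :: "real \<Rightarrow> real" where \<theta>: "smooth \<theta>" "\<And>x. x \<le> 0 \<Longrightarrow> \<theta> x = 0" "\<And>x. 1 \<le> x \<Longrightarrow> \<theta> x = 1"
    by (rule smooth_step_exists) blast
  have lin: "smooth (\<lambda>x. a + b * x)" for a b :: real
    by (intro smooth_add smooth_mult smooth_const smooth_ident)
  show ?thesis
  \<comment> \<open>The arguments are 2 - (x - s) / \<delta> and 2 + (x - s) / \<delta>. Both are at
    least 1 within distance \<delta> of \<open>s\<close>, and one of them is at most 0 from distance
    2 \<delta> on.\<close>
  proof (rule that[of "\<lambda>x. \<theta> ((2 + s / \<delta>) + (- 1 / \<delta>) * x) * \<theta> ((2 - s / \<delta>) + (1 / \<delta>) * x)"])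
    show "smooth (\<lambda>x. \<theta> ((2 + s / \<delta>) + (- 1 / \<delta>) * x) * \<theta> ((2 - s / \<delta>) + (1 / \<delta>) * x))"
      by (intro smooth_mult smooth_compose[OF \<theta>(1)] lin)
  next
    fix x assume "\<bar>x - s\<bar> \<le> \<delta>"
    then have "(x - s) / \<delta> \<le> 1" "- 1 \<le> (x - s) / \<delta>"
      using assms by (auto simp: pos_divide_le_eq pos_le_divide_eq)
    then show "\<theta> ((2 + s / \<delta>) + (- 1 / \<delta>) * x) * \<theta> ((2 - s / \<delta>) + (1 / \<delta>) * x) = 1"
      by (subst (1 2) \<theta>(3)) (simp_all add: diff_divide_distrib)
  next
    fix x assume *: "2 * \<delta> \<le> \<bar>x - s\<bar>"
    then have "2 \<le> \<bar>(x - s) / \<delta>\<bar>"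
      using assms by (simp add: abs_divide pos_le_divide_eq)
    then have "2 + s / \<delta> + - 1 / \<delta> * x \<le> 0 \<or> 2 - s / \<delta> + 1 / \<delta> * x \<le> 0"
      by (simp add: diff_divide_distrib) arith
    then show "\<theta> ((2 + s / \<delta>) + (- 1 / \<delta>) * x) * \<theta> ((2 - s / \<delta>) + (1 / \<delta>) * x) = 0"
      using \<theta>(2) by (elim disjE) simp_all
  qed
qed

section \<open>Linear differential equations\<close>

lemma global_antiderivative:
  fixes f :: "real \<Rightarrow> 'b::banach"
  assumes "continuous_on UNIV f"
  shows "\<exists>G. G 0 = c \<and> (\<forall>t. (G has_vector_derivative f t) (at t))"
proof -
  \<comment> \<open>An interval with reversed endpoints is empty and contributes 0, so the
    difference is the oriented integral from 0 to \<open>t\<close>.\<close>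
  define G where "G t = integral {0..t} f - integral {t..0} f + c" for t
  have int: "f integrable_on {a..b}" for a b
    by (rule integrable_continuous_real) (rule continuous_on_subset[OF assms subset_UNIV])
  have "(G has_vector_derivative f t) (at t)" for t
  proof -
    \<comment> \<open>A fixed left endpoint \<open>- N\<close> to the left of both 0 and
      \<open>t\<close> reduces the claim to the derivative of an integral in its upper
      endpoint.\<close>
    define N where "N = \<bar>t\<bar> + 1"
    have G: "integral {- N..s} f + (c - integral {- N..0} f) = G s" if "s \<in> {- N<..<N}" for s
    proof (cases "0 \<le> s")
      case True
      have "- N \<le> 0" using that by auto
      from Henstock_Kurzweil_Integration.integral_combine[OF this True int]
      have "integral {- N..s} f = integral {- N..0} f + integral {0..s} f" by (rule sym)
      moreover have "integral {s..0} f = 0" using True by (cases "s = 0") simp_all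
      ultimately show ?thesis unfolding G_def by simp
    next
      case False
      have "- N \<le> s" "s \<le> 0" using that False by auto
      from Henstock_Kurzweil_Integration.integral_combine[OF this int]
      have "integral {- N..0} f = integral {- N..s} f + integral {s..0} f" by (rule sym)
      moreover have "integral {0..s} f = 0" using False by simp
      ultimately show ?thesis unfolding G_def by simp
    qed
    have t: "t \<in> {- N<..<N}" by (auto simp: N_def)
    have "((\<lambda>u. integral {- N..u} f) has_vector_derivative f t) (at t within {- N..N})"
      using t by (intro integral_has_vector_derivative continuous_on_subset[OF assms subset_UNIV]) auto
    moreover have "at t within {- N..N} = at t"
      using t by (intro at_within_interior) (simp add: interior_atLeastAtMost_real)
    ultimately have "((\<lambda>u. integral {- N..u} f) has_vector_derivative f t) (at t)" by simp
    from has_vector_derivative_add[OF this has_vector_derivative_const[of "c - integral {- N..0} f"]]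
    have "((\<lambda>u. integral {- N..u} f + (c - integral {- N..0} f)) has_vector_derivative f t) (at t)"
      by simp
    then show ?thesis
      by (rule has_vector_derivative_transform_within_open[OF _ open_greaterThanLessThan t G])
  qed
  moreover have "G 0 = c" by (simp add: G_def)
  ultimately show ?thesis by blast
qed

text \<open>The majorant \<open>C * exp (K * s)\<close> has derivative
  \<open>K * C * exp (K * s)\<close>, which dominates that of \<open>G\<close>; the majorant's
  initial value \<open>C\<close> is given away.\<close>

lemma exp_growth_bound_right:
  fixes G :: "real \<Rightarrow> 'b::real_normed_vector"
  assumes "G 0 = 0" and G: "\<And>s. (G has_vector_derivative F s) (at s)" and "0 \<le> C"
    and bound: "\<And>s. 0 \<le> s \<Longrightarrow> s \<le> t \<Longrightarrow> norm (F s) \<le> K * C * exp (K * s)" and "0 \<le> t"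
  shows "norm (G t) \<le> C * exp (K * t)"
proof (cases "t = 0")
  case True
  then show ?thesis using assms by simp
next
  case False
  have "norm (G t - G 0) \<le> C * exp (K * t) - C * exp (K * 0)"
  proof (rule differentiable_bound_general)
    show "0 < t" using False \<open>0 \<le> t\<close> by simp
    show "continuous_on {0..t} G"
      by (intro continuous_at_imp_continuous_on ballI has_vector_derivative_continuous[OF G])
    show "((\<lambda>x. C * exp (K * x)) has_vector_derivative K * C * exp (K * x)) (at x)" for x
      unfolding has_real_derivative_iff_has_vector_derivative[symmetric]
      by (auto intro!: derivative_eq_intros)
    show "continuous_on {0..t} (\<lambda>x. C * exp (K * x))"
      by (intro continuous_intros)
  qed (use G bound in auto)
  then show ?thesis using assms by simp
qed

lemma has_vector_derivative_reflect:
  fixes G :: "real \<Rightarrow> 'b::real_normed_vector"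
  assumes "(G has_vector_derivative D) (at (- s))"
  shows "((\<lambda>s. G (- s)) has_vector_derivative - D) (at s)"
proof -
  have "(uminus has_vector_derivative - 1) (at s)"
    using has_vector_derivative_minus[OF has_vector_derivative_id, of "at s"] by simp
  from vector_diff_chain_at[OF this assms] show ?thesis by (simp add: o_def)
qed

lemma exp_growth_bound:
  fixes G :: "real \<Rightarrow> 'b::real_normed_vector"
  assumes "G 0 = 0" and G: "\<And>s. (G has_vector_derivative F s) (at s)" and "0 \<le> C"
    and bound: "\<And>s. \<bar>s\<bar> \<le> \<bar>t\<bar> \<Longrightarrow> norm (F s) \<le> K * C * exp (K * \<bar>s\<bar>)"
  shows "norm (G t) \<le> C * exp (K * \<bar>t\<bar>)"
proof (cases "0 \<le> t")
  case True
  have "norm (G t) \<le> C * exp (K * t)"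
  proof (rule exp_growth_bound_right[OF assms(1) G \<open>0 \<le> C\<close> _ True])
    fix s assume "0 \<le> s" "s \<le> t"
    then show "norm (F s) \<le> K * C * exp (K * s)" using bound[of s] by simp
  qed
  then show ?thesis using True by simp
next
  case False
  have "((\<lambda>s. G (- s)) has_vector_derivative - F (- s)) (at s)" for s
    by (rule has_vector_derivative_reflect[OF G])
  then have "norm (G (- (- t))) \<le> C * exp (K * (- t))"
  proof (rule exp_growth_bound_right[rotated])
    fix s assume "0 \<le> s" "s \<le> - t"
    then show "norm (- F (- s)) \<le> K * C * exp (K * s)" using bound[of "- s"] by simp
  qed (use False assms(1) \<open>0 \<le> C\<close> in auto)
  then show ?thesis using False by simp
qed

text \<open>Picard iteration: the \<open>n\<close>-th iterate is bounded by \<open>2 ^ - n * exp (K * \<bar>t\<bar>)\<close> for large \<open>K\<close>,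
  uniformly on bounded intervals.\<close>
lemma linear_ode_exists:
  fixes B :: "real \<Rightarrow> 'c::real_normed_vector" and P :: "'c \<Rightarrow> 'b \<Rightarrow> 'b::banach"
  assumes P: "bounded_bilinear P" and B: "continuous_on UNIV B"
  shows "\<exists>h. h 0 = c \<and> (\<forall>t. (h has_vector_derivative P (B t) (h t)) (at t))"
proof -
  interpret P: bounded_bilinear P by (rule P)
  define anti where "anti f = (SOME G::real \<Rightarrow> 'b. G 0 = 0 \<and> (\<forall>t. (G has_vector_derivative f t) (at t)))" for f
  have anti: "anti f 0 = 0" "(anti f has_vector_derivative f t) (at t)" if "continuous_on UNIV f" for f t
    using someI_ex[OF global_antiderivative[OF that, of 0]] by (auto simp: anti_def)
  \<comment> \<open>\<open>I n\<close> is the n-th increment of the Picard iteration, so the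
    solution is the sum of all \<open>I n\<close>.\<close>
  define I where "I = rec_nat (\<lambda>_. c) (\<lambda>_ u. anti (\<lambda>t. P (B t) (u t)))"
  have I0: "I 0 = (\<lambda>_. c)" and ISuc: "I (Suc n) = anti (\<lambda>t. P (B t) (I n t))" for n
    by (simp_all add: I_def)
  have contP: "continuous_on UNIV (\<lambda>t. P (B t) (u t))" if "continuous_on UNIV u" for u
    by (rule P.continuous_on[OF B that])
  have cont: "continuous_on UNIV (I n)" for n
  proof (induction n)
    case (Suc n)
    show ?case unfolding ISuc
      by (intro continuous_at_imp_continuous_on ballI
        has_vector_derivative_continuous[OF anti(2)[OF contP[OF Suc]]])
  qed (simp add: I0)
  note dI = anti[OF contP[OF cont], folded ISuc]
  obtain Q where Q: "0 < Q" "\<And>a b. norm (P a b) \<le> norm a * norm b * Q"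
    using P.pos_bounded by blast
  have ex: "\<exists>K L. 0 < K \<and> 0 \<le> L \<and> (\<forall>t u. \<bar>t\<bar> \<le> N \<longrightarrow> norm (P (B t) u) \<le> K / 2 * norm u) \<and>
      (\<forall>n t. \<bar>t\<bar> \<le> N \<longrightarrow> norm (I n t) \<le> (1/2) ^ n * L)" for N :: real
  proof -
    have "compact (B ` {- N..N})"
      by (intro compact_continuous_image continuous_on_subset[OF B]) auto
    from compact_imp_bounded[OF this, unfolded bounded_pos]
    obtain M where M: "0 < M" "\<And>t. t \<in> {- N..N} \<Longrightarrow> norm (B t) \<le> M" by auto
    \<comment> \<open>The operators are bounded by \<open>M * Q = K / 2\<close>, and comparison with
      \<open>exp (K * \<bar>t\<bar>)\<close> divides by \<open>K\<close> in each integration, so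
      every increment gains a factor 1/2.\<close>
    define K where "K = 2 * M * Q"
    have K: "0 < K" using M Q by (simp add: K_def)
    have PK: "norm (P (B t) u) \<le> K / 2 * norm u" if "\<bar>t\<bar> \<le> N" for t u
    proof -
      have "norm (P (B t) u) \<le> norm (B t) * norm u * Q" by (rule Q)
      also have "\<dots> \<le> M * norm u * Q"
        using that Q by (intro mult_right_mono M) auto
      finally show ?thesis by (simp add: K_def mult_ac)
    qed
    have bd: "norm (I n t) \<le> (1/2) ^ n * norm c * exp (K * \<bar>t\<bar>)" if "\<bar>t\<bar> \<le> N" for n t
      using that
    proof (induction n arbitrary: t)
      case 0
      have "norm c * 1 \<le> norm c * exp (K * \<bar>t\<bar>)" using K by (intro mult_left_mono) auto
      then show ?case by (simp add: I0)
    next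
      case (Suc n)
      show ?case
      proof (rule exp_growth_bound[OF dI])
        fix s assume "\<bar>s\<bar> \<le> \<bar>t\<bar>"
        then have s: "\<bar>s\<bar> \<le> N" using Suc.prems by simp
        have "norm (P (B s) (I n s)) \<le> K / 2 * norm (I n s)" by (rule PK[OF s])
        also have "\<dots> \<le> K / 2 * ((1/2) ^ n * norm c * exp (K * \<bar>s\<bar>))"
          using K by (intro mult_left_mono Suc.IH s) auto
        finally show "norm (P (B s) (I n s)) \<le> K * ((1/2) ^ Suc n * norm c) * exp (K * \<bar>s\<bar>)"
          by (simp add: mult_ac)
      qed simp
    qed
    have "norm (I n t) \<le> (1/2) ^ n * (norm c * exp (K * N))" if "\<bar>t\<bar> \<le> N" for n t
    proof -
      have "exp (K * \<bar>t\<bar>) \<le> exp (K * N)" using that K by simp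
      then have "(1/2) ^ n * norm c * exp (K * \<bar>t\<bar>) \<le> (1/2) ^ n * norm c * exp (K * N)"
        by (intro mult_left_mono) auto
      from order_trans[OF bd[OF that] this] show ?thesis by (simp only: mult.assoc)
    qed
    moreover have "0 \<le> norm c * exp (K * N)" by simp
    ultimately show ?thesis using K PK by blast
  qed
  define h where "h t = (\<Sum>n. I n t)" for t
  have tail: "norm (h t - (\<Sum>i<n. I i t)) \<le> 2 * (1/2) ^ n * L" and summ: "summable (\<lambda>n. I n t)"
    if L: "\<And>n. norm (I n t) \<le> (1/2) ^ n * L" for t n L
  proof -
    have g: "summable (\<lambda>n. (1/2) ^ n * L)" for L :: real
      by (intro summable_mult2 summable_geometric) simp
    show summ: "summable (\<lambda>n. I n t)"
      by (rule summable_comparison_test'[OF g]) (use L in auto)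
    have "h t - (\<Sum>i<n. I i t) = (\<Sum>i. I (i + n) t)"
      using suminf_split_initial_segment[OF summ, of n] by (simp add: h_def)
    also have "norm \<dots> \<le> (\<Sum>i. (1/2) ^ i * ((1/2) ^ n * L))"
    proof (rule norm_suminf_le)
      show "norm (I (i + n) t) \<le> (1/2) ^ i * ((1/2) ^ n * L)" for i
        using L[of "i + n"] by (simp add: power_add mult.assoc)
    qed (rule g)
    also have "\<dots> = (\<Sum>i. (1/2) ^ i) * ((1/2) ^ n * L)"
      by (rule suminf_mult2[symmetric]) (simp add: summable_geometric)
    also have "\<dots> = 2 * (1/2) ^ n * L"
      by (simp add: suminf_geometric)
    finally show "norm (h t - (\<Sum>i<n. I i t)) \<le> 2 * (1/2) ^ n * L" .
  qed
  have lim0: "(\<lambda>n. (1/2) ^ n * L) \<longlonglongrightarrow> 0" for L :: real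
    using tendsto_mult_left_zero[OF LIMSEQ_realpow_zero[of "1/2"], of L] by simp
  have conth: "continuous_on UNIV h"
  proof -
    have "isCont h t" for t
    proof -
      define N where "N = \<bar>t\<bar> + 1"
      obtain L where L: "0 \<le> L" "\<And>n s. \<bar>s\<bar> \<le> N \<Longrightarrow> norm (I n s) \<le> (1/2) ^ n * L"
        using ex[of N] by blast
      have "uniform_limit {- N..N} (\<lambda>n s. \<Sum>i<n. I i s) h sequentially"
      proof (rule uniform_limitI)
        fix e :: real assume "0 < e"
        have "\<forall>\<^sub>F n in sequentially. (1/2) ^ n * (2 * L) < e"
          by (rule order_tendstoD(2)[OF lim0 \<open>0 < e\<close>])
        then show "\<forall>\<^sub>F n in sequentially. \<forall>s\<in>{- N..N}. dist (\<Sum>i<n. I i s) (h s) < e"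
        proof eventually_elim
          case (elim n)
          show ?case
          proof
            fix s assume "s \<in> {- N..N}"
            then have "norm (h s - (\<Sum>i<n. I i s)) \<le> 2 * (1/2) ^ n * L"
              by (intro tail L(2)) auto
            with elim show "dist (\<Sum>i<n. I i s) (h s) < e"
              by (simp add: dist_norm norm_minus_commute mult_ac)
          qed
        qed
      qed
      then have "continuous_on {- N..N} h"
        by (rule uniform_limit_theorem[rotated])
          (simp_all add: continuous_on_sum continuous_on_subset[OF cont subset_UNIV])
      then show ?thesis
        by (rule continuous_on_interior) (auto simp: N_def)
    qed
    then show ?thesis by (simp add: continuous_on_eq_continuous_at)
  qed
  obtain G where G: "G 0 = c" "\<And>t. (G has_vector_derivative P (B t) (h t)) (at t)"
    using global_antiderivative[OF contP[OF conth], of c] by blast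
  have dS: "((\<lambda>t. \<Sum>i<Suc n. I i t) has_vector_derivative P (B t) (\<Sum>i<n. I i t)) (at t)" for n t
  proof (induction n)
    case 0
    show ?case by (simp add: I0 P.zero_right)
  next
    case (Suc n)
    from has_vector_derivative_add[OF Suc dI(2)[of n t]]
    show ?case by (simp add: P.add_right)
  qed
  have S0: "(\<Sum>i<Suc n. I i 0) = c" for n
    by (induction n) (simp_all add: I0 dI(1))
  \<comment> \<open>\<open>G\<close> integrates the right-hand side formed with \<open>h\<close>.
    Its difference from a partial sum has as derivative \<open>P (B s)\<close> applied to a tail of
    the series, so it decays like that tail; \<open>G\<close> and \<open>h\<close> are the limit of
    the same partial sums.\<close>
  have "G t = h t" for t
  proof -
    obtain K L where K: "0 < K" "0 \<le> L" "\<And>s u. \<bar>s\<bar> \<le> \<bar>t\<bar> \<Longrightarrow> norm (P (B s) u) \<le> K / 2 * norm u"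
      "\<And>n s. \<bar>s\<bar> \<le> \<bar>t\<bar> \<Longrightarrow> norm (I n s) \<le> (1/2) ^ n * L"
      using ex[of "\<bar>t\<bar>"] by blast
    have "norm (G t - (\<Sum>i<Suc n. I i t)) \<le> (1/2) ^ n * L * exp (K * \<bar>t\<bar>)" for n
    proof (rule exp_growth_bound[where F = "\<lambda>s. P (B s) (h s - (\<Sum>i<n. I i s))"])
      show "((\<lambda>t. G t - (\<Sum>i<Suc n. I i t)) has_vector_derivative
        P (B s) (h s - (\<Sum>i<n. I i s))) (at s)" for s
        using has_vector_derivative_diff[OF G(2) dS] by (simp add: P.diff_right)
    next
      fix s assume s: "\<bar>s\<bar> \<le> \<bar>t\<bar>"
      have "norm (P (B s) (h s - (\<Sum>i<n. I i s))) \<le> K / 2 * norm (h s - (\<Sum>i<n. I i s))"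
        by (rule K(3)[OF s])
      also have "\<dots> \<le> K / 2 * (2 * (1/2) ^ n * L)"
        using K(1) by (intro mult_left_mono tail K(4) s) auto
      also have "\<dots> = K * ((1/2) ^ n * L) * 1" by simp
      also have "\<dots> \<le> K * ((1/2) ^ n * L) * exp (K * \<bar>s\<bar>)"
        using K by (intro mult_left_mono) auto
      finally show "norm (P (B s) (h s - (\<Sum>i<n. I i s))) \<le> K * ((1/2) ^ n * L) * exp (K * \<bar>s\<bar>)" .
    qed (use G(1) S0 K in auto)
    then have "(\<lambda>n. G t - (\<Sum>i<Suc n. I i t)) \<longlonglongrightarrow> 0"
      by (intro Lim_null_comparison[OF _ lim0[of "L * exp (K * \<bar>t\<bar>)"]]) (auto simp: mult.assoc)
    moreover have "(\<lambda>n. G t - (\<Sum>i<Suc n. I i t)) \<longlonglongrightarrow> G t - h t"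
      unfolding h_def
      by (intro tendsto_diff tendsto_const LIMSEQ_Suc[OF summable_LIMSEQ]
        summ[where L = L, OF K(4)[OF order_refl]])
    ultimately have "G t - h t = 0" by (rule LIMSEQ_unique[rotated])
    then show ?thesis by simp
  qed
  then have "G = h" by auto
  with G show ?thesis by blast
qed

section \<open>The algebra of endomorphisms\<close>

text \<open>A copy of the bounded operators with composition as the product of a normed algebra with
  1; \<open>exp\<close>, powers and the product rule become available for paths of
  automorphisms.\<close>

typedef (overloaded) 'a endo = "UNIV :: ('a::euclidean_space \<Rightarrow>\<^sub>L 'a) set"
  morphisms endo_blinfun Endo ..

setup_lifting type_definition_endo

lift_definition app :: "'a::euclidean_space endo \<Rightarrow> 'a \<Rightarrow> 'a" is blinfun_apply .

instantiation endo :: (euclidean_space) real_normed_algebra_1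
begin

lift_definition norm_endo :: "'a endo \<Rightarrow> real" is norm .
lift_definition zero_endo :: "'a endo" is 0 .
lift_definition one_endo :: "'a endo" is id_blinfun .
lift_definition plus_endo :: "'a endo \<Rightarrow> 'a endo \<Rightarrow> 'a endo" is "(+)" .
lift_definition minus_endo :: "'a endo \<Rightarrow> 'a endo \<Rightarrow> 'a endo" is "(-)" .
lift_definition uminus_endo :: "'a endo \<Rightarrow> 'a endo" is uminus .
lift_definition scaleR_endo :: "real \<Rightarrow> 'a endo \<Rightarrow> 'a endo" is scaleR .
lift_definition times_endo :: "'a endo \<Rightarrow> 'a endo \<Rightarrow> 'a endo" is blinfun_compose .

definition dist_endo :: "'a endo \<Rightarrow> 'a endo \<Rightarrow> real"
  where "dist_endo a b = norm (a - b)"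

definition
  "(uniformity :: ('a endo \<times> 'a endo) filter) = (INF e\<in>{0 <..}. principal {(x, y). dist x y < e})"

definition open_endo :: "'a endo set \<Rightarrow> bool"
  where "open_endo S = (\<forall>x\<in>S. \<forall>\<^sub>F (x', y) in uniformity. x' = x \<longrightarrow> y \<in> S)"

definition sgn_endo :: "'a endo \<Rightarrow> 'a endo"
  where "sgn_endo x = scaleR (inverse (norm x)) x"

instance
proof
  fix a b c :: "'a endo" and r s :: real
  show "a + b + c = a + (b + c)" by transfer simp
  show "a + b = b + a" by transfer simp
  show "0 + a = a" by transfer simp
  show "- a + a = 0" by transfer simp
  show "a - b = a + - b" by transfer simp
  show "r *\<^sub>R (a + b) = r *\<^sub>R a + r *\<^sub>R b" by transfer (rule scaleR_add_right)
  show "(r + s) *\<^sub>R a = r *\<^sub>R a + s *\<^sub>R a" by transfer (rule scaleR_add_left)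
  show "r *\<^sub>R s *\<^sub>R a = (r * s) *\<^sub>R a" by transfer simp
  show "1 *\<^sub>R a = a" by transfer simp
  show "a * b * c = a * (b * c)" by transfer (auto intro!: blinfun_eqI)
  show "1 * a = a" by transfer (auto intro!: blinfun_eqI)
  show "a * 1 = a" by transfer (auto intro!: blinfun_eqI)
  show "(a + b) * c = a * c + b * c" by transfer (auto intro!: blinfun_eqI simp: blinfun.bilinear_simps)
  show "a * (b + c) = a * b + a * c" by transfer (auto intro!: blinfun_eqI simp: blinfun.bilinear_simps)
  show "r *\<^sub>R a * b = r *\<^sub>R (a * b)" by transfer (auto intro!: blinfun_eqI simp: blinfun.bilinear_simps)
  show "a * r *\<^sub>R b = r *\<^sub>R (a * b)" by transfer (auto intro!: blinfun_eqI simp: blinfun.bilinear_simps)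
  show "(0::'a endo) \<noteq> 1" 
  proof
    assume "(0::'a endo) = 1"
    then have "norm (0::'a \<Rightarrow>\<^sub>L 'a) = norm (id_blinfun::'a \<Rightarrow>\<^sub>L 'a)" by transfer simp
    then show False by (simp add: norm_blinfun_id)
  qed
  show "dist a b = norm (a - b)" by (rule dist_endo_def)
  show "sgn a = inverse (norm a) *\<^sub>R a" by (rule sgn_endo_def)
  show "(norm a = 0) = (a = 0)" by transfer simp
  show "norm (a + b) \<le> norm a + norm b" by transfer (rule norm_triangle_ineq)
  show "norm (r *\<^sub>R a) = \<bar>r\<bar> * norm a" by transfer simp
  show "norm (a * b) \<le> norm a * norm b" by transfer (rule norm_blinfun_compose)
  show "norm (1::'a endo) = 1" by transfer (rule norm_blinfun_id)
qed (rule uniformity_endo_def open_endo_def)+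

end

lemma bounded_linear_endo_blinfun: "bounded_linear endo_blinfun"
  by (rule bounded_linear_intro[where K = 1]) (transfer, simp)+

lemma bounded_linear_Endo: "bounded_linear Endo"
  by (rule bounded_linear_intro[where K = 1])
    (simp_all add: plus_endo.abs_eq scaleR_endo.abs_eq norm_endo.abs_eq eq_onp_same_args)

instance endo :: (euclidean_space) banach
proof
  fix X :: "nat \<Rightarrow> 'a endo"
  assume "Cauchy X"
  then have "Cauchy (\<lambda>n. endo_blinfun (X n))"
    by (rule bounded_linear.Cauchy[OF bounded_linear_endo_blinfun])
  then have "convergent (\<lambda>n. endo_blinfun (X n))" by (rule Cauchy_convergent)
  then obtain L where "(\<lambda>n. endo_blinfun (X n)) \<longlonglongrightarrow> L" by (auto simp: convergent_def)
  from bounded_linear.tendsto[OF bounded_linear_Endo this] show "convergent X"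
    by (auto simp: convergent_def endo_blinfun_inverse)
qed

lemma endo_eqI: "(\<And>x. app f x = app g x) \<Longrightarrow> f = g"
  by transfer (rule blinfun_eqI)

lemma bounded_bilinear_app: "bounded_bilinear app"
proof
  fix a a' :: "'a endo" and b b' :: 'a and r :: real
  show "app (a + a') b = app a b + app a' b" by transfer (simp add: blinfun.bilinear_simps)
  show "app a (b + b') = app a b + app a b'" by transfer (simp add: blinfun.bilinear_simps)
  show "app (r *\<^sub>R a) b = r *\<^sub>R app a b" by transfer (simp add: blinfun.bilinear_simps)
  show "app a (r *\<^sub>R b) = r *\<^sub>R app a b" by transfer (simp add: blinfun.bilinear_simps)
  have "norm (app a b) \<le> norm a * norm b * 1" for a :: "'a endo" and b
    by transfer (simp add: norm_blinfun)
  then show "\<exists>K. \<forall>a b. norm (app (a :: 'a endo) b) \<le> norm a * norm b * K" by blast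
qed

interpretation app: bounded_bilinear app by (rule bounded_bilinear_app)

lemma norm_app: "norm (app f x) \<le> norm f * norm x"
  by transfer (rule norm_blinfun)

lemma norm_endo_bound: "0 \<le> b \<Longrightarrow> (\<And>x. norm (app f x) \<le> b * norm x) \<Longrightarrow> norm f \<le> b"
  by transfer (rule norm_blinfun_bound)

lemma app_mult [simp]: "app (f * g) x = app f (app g x)"
  by transfer simp

lemma app_one [simp]: "app 1 x = x"
  by transfer simp

lemma linear_app: "linear (app f)"
  by (simp add: app.bounded_linear_right bounded_linear.linear)

definition endo_of :: "('a::euclidean_space \<Rightarrow> 'a) \<Rightarrow> 'a endo" where
  "endo_of f = Endo (Blinfun f)"

lemma app_endo_of: "linear f \<Longrightarrow> app (endo_of f) x = f x"
  by (simp add: endo_of_def app.abs_eq bounded_linear_Blinfun_apply linear_conv_bounded_linear)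

lemma endo_of_app [simp]: "endo_of (app f) = f"
  by (rule endo_eqI) (simp add: app_endo_of linear_app)

text \<open>Finite dimension makes one-sided inverses two-sided; for this reason
  \<open>aut_grp\<close> asks for a right inverse only.\<close>

lemma endo_mult_commute_one:
  fixes f g :: "'a::euclidean_space endo"
  assumes "f * g = 1"
  shows "g * f = 1"
proof -
  have "app f \<circ> app g = id" using assms by (simp add: fun_eq_iff app_mult[symmetric] del: app_mult)
  then have "app g \<circ> app f = id" by (rule linear_inverse_left[OF linear_app linear_app, THEN iffD1])
  then show ?thesis by (intro endo_eqI) (simp add: fun_eq_iff)
qed

section \<open>Groups of automorphisms of a bilinear operation\<close>

definition einv :: "'a::euclidean_space endo \<Rightarrow> 'a endo" where
  "einv c = (SOME d. c * d = 1)"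

text \<open>The set \<open>S\<close> collects the operators the automorphisms have to commute with: the complex structure
  if the ground field is complex, and, for centralizers, the centralized automorphism.\<close>
definition aut_grp :: "('a::euclidean_space \<Rightarrow> 'a \<Rightarrow> 'a) \<Rightarrow> 'a endo set \<Rightarrow> 'a endo set" where
  "aut_grp br S = {c. (\<exists>d. c * d = 1) \<and> (\<forall>x y. app c (br x y) = br (app c x) (app c y))
     \<and> (\<forall>X\<in>S. c * X = X * c)}"

definition derivations :: "('a::euclidean_space \<Rightarrow> 'a \<Rightarrow> 'a) \<Rightarrow> 'a endo set \<Rightarrow> 'a endo set" where
  "derivations br S = {D. (\<forall>x y. app D (br x y) = br (app D x) y + br x (app D y))
     \<and> (\<forall>X\<in>S. D * X = X * D)}"

lemma einv_right: "c * d = 1 \<Longrightarrow> c * einv c = 1"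
  unfolding einv_def by (rule someI)

lemma einv_left: "c * d = 1 \<Longrightarrow> einv c * c = 1"
  by (rule endo_mult_commute_one) (rule einv_right)

lemma einv_unique: "c * d = 1 \<Longrightarrow> einv c = d"
  by (metis einv_left mult.assoc mult.left_neutral mult.right_neutral)

lemma aut_grp_inverse:
  assumes "c \<in> aut_grp br S"
  shows "c * einv c = 1" "einv c * c = 1"
    "app c (app (einv c) x) = x" "app (einv c) (app c x) = x"
    "c * (einv c * X) = X" "einv c * (c * X) = X"
proof -
  obtain d where "c * d = 1" using assms by (auto simp: aut_grp_def)
  then show *: "c * einv c = 1" "einv c * c = 1" by (auto intro: einv_right einv_left)
  show "app c (app (einv c) x) = x" using * by (metis app_mult app_one)
  show "app (einv c) (app c x) = x" using * by (metis app_mult app_one)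
  show "c * (einv c * X) = X" "einv c * (c * X) = X"
    using * by (metis mult.assoc mult.left_neutral)+
qed

lemma aut_grp_br: "c \<in> aut_grp br S \<Longrightarrow> app c (br x y) = br (app c x) (app c y)"
  by (simp add: aut_grp_def)

lemma aut_grp_comm: "c \<in> aut_grp br S \<Longrightarrow> X \<in> S \<Longrightarrow> c * X = X * c"
  by (simp add: aut_grp_def)

lemma aut_grp_insert: "c \<in> aut_grp br (insert X S) \<longleftrightarrow> c \<in> aut_grp br S \<and> c * X = X * c"
  by (auto simp: aut_grp_def)

lemma aut_grp_one: "1 \<in> aut_grp br S"
  by (auto simp: aut_grp_def intro: exI[of _ 1])

lemma aut_grp_mult:
  assumes "c \<in> aut_grp br S" "d \<in> aut_grp br S"
  shows "c * d \<in> aut_grp br S"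
proof -
  have "c * d * (einv d * einv c) = 1"
    using aut_grp_inverse[OF assms(1)] aut_grp_inverse[OF assms(2)] by (simp add: mult.assoc)
  moreover have "c * d * X = X * (c * d)" if "X \<in> S" for X
    using aut_grp_comm[OF assms(1) that] aut_grp_comm[OF assms(2) that] by (metis mult.assoc)
  ultimately show ?thesis
    using aut_grp_br[OF assms(1)] aut_grp_br[OF assms(2)] unfolding aut_grp_def by auto
qed

lemma aut_grp_einv:
  assumes c: "c \<in> aut_grp br S"
  shows "einv c \<in> aut_grp br S"
proof -
  have "app (einv c) (br x y) = br (app (einv c) x) (app (einv c) y)" for x y
    using aut_grp_br[OF c, of "app (einv c) x" "app (einv c) y"] aut_grp_inverse[OF c] by metis
  moreover have "einv c * X = X * einv c" if "X \<in> S" for X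
  proof -
    have "einv c * X = einv c * (X * c) * einv c"
      using aut_grp_inverse[OF c] by (simp add: mult.assoc)
    also have "\<dots> = einv c * (c * X) * einv c" using aut_grp_comm[OF c that] by simp
    finally show ?thesis using aut_grp_inverse[OF c] by simp
  qed
  ultimately show ?thesis
    using aut_grp_inverse[OF c] unfolding aut_grp_def by auto
qed

lemma aut_grp_power: "c \<in> aut_grp br S \<Longrightarrow> c ^ n \<in> aut_grp br S"
  by (induction n) (auto intro: aut_grp_one aut_grp_mult)

lemma derivations_br: "D \<in> derivations br S \<Longrightarrow> app D (br x y) = br (app D x) y + br x (app D y)"
  by (simp add: derivations_def)

lemma derivations_comm: "D \<in> derivations br S \<Longrightarrow> X \<in> S \<Longrightarrow> D * X = X * D"
  by (simp add: derivations_def)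

lemma smooth_einv:
  assumes "smooth c" "\<And>t. c t \<in> aut_grp br S"
  shows "smooth (\<lambda>t. einv (c t))"
  by (rule smooth_left_inverse[OF assms(1)]) (auto simp: aut_grp_inverse[OF assms(2)])

text \<open>Without its linear term the exponential series is a contraction on the ball of radius
  1/4. The factor \<open>n + 2\<close> from a difference of powers is absorbed by the factorial, and
  the geometric series that remains sums to norm (D - E) / 3.\<close>

lemma exp_small_lipschitz:
  fixes D E :: "'b::{real_normed_algebra_1,banach}"
  assumes D: "norm D \<le> 1/4" and E: "norm E \<le> 1/4"
  shows "norm ((exp D - D) - (exp E - E)) \<le> norm (D - E) / 2"
proof -
  have pow: "norm (D ^ Suc n - E ^ Suc n) \<le> real (Suc n) * (1/4) ^ n * norm (D - E)" for n
  proof (induction n)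
    case (Suc n)
    have "D ^ Suc (Suc n) - E ^ Suc (Suc n) = D * (D ^ Suc n - E ^ Suc n) + (D - E) * E ^ Suc n"
      by (simp add: algebra_simps)
    also have "norm \<dots> \<le> norm D * norm (D ^ Suc n - E ^ Suc n) + norm (D - E) * norm (E ^ Suc n)"
      by (intro norm_triangle_mono norm_mult_ineq)
    also have "\<dots> \<le> (1/4) * (real (Suc n) * (1/4) ^ n * norm (D - E)) + norm (D - E) * (1/4) ^ Suc n"
    proof (intro add_mono mult_mono mult_left_mono D Suc)
      have "norm (E ^ Suc n) \<le> norm E ^ Suc n" by (rule norm_power_ineq)
      also have "\<dots> \<le> (1/4) ^ Suc n" by (intro power_mono E) simp
      finally show "norm (E ^ Suc n) \<le> (1/4) ^ Suc n" .
    qed auto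
    also have "\<dots> = real (Suc (Suc n)) * (1/4) ^ Suc n * norm (D - E)"
      by (simp add: algebra_simps)
    finally show ?case .
  qed simp
  define f where "f = (\<lambda>(X::'b) n. X ^ n /\<^sub>R fact n)"
  have sm: "summable (f X)" for X unfolding f_def by (rule summable_exp_generic)
  have ex: "exp X - X = 1 + (\<Sum>n. f X (n + 2))" for X
  proof -
    have "exp X = suminf (f X)" by (simp add: exp_def f_def)
    also have "\<dots> = (\<Sum>n. f X (n + 2)) + (\<Sum>n<2. f X n)"
      by (rule suminf_split_initial_segment[OF sm])
    also have "(\<Sum>n<2. f X n) = 1 + X" by (simp add: f_def numeral_2_eq_2)
    finally show ?thesis by (simp add: algebra_simps)
  qed
  have "(exp D - D) - (exp E - E) = (\<Sum>n. f D (n + 2) - f E (n + 2))"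
    unfolding ex add_diff_cancel_left
    by (rule suminf_diff[OF summable_ignore_initial_segment[OF sm] summable_ignore_initial_segment[OF sm]])
  also have "norm \<dots> \<le> (\<Sum>n. (1/4) ^ n * (norm (D - E) / 4))"
  proof (rule norm_suminf_le)
    fix n
    have "f D (n + 2) - f E (n + 2) = (D ^ Suc (Suc n) - E ^ Suc (Suc n)) /\<^sub>R fact (n + 2)"
      by (simp add: f_def scaleR_diff_right)
    then have "norm (f D (n + 2) - f E (n + 2)) = norm (D ^ Suc (Suc n) - E ^ Suc (Suc n)) / fact (n + 2)"
      by (simp add: divide_inverse)
    also have "\<dots> \<le> (real (Suc (Suc n)) * (1/4) ^ Suc n * norm (D - E)) / fact (n + 2)"
      by (intro divide_right_mono pow) simp
    also have "\<dots> \<le> (1/4) ^ Suc n * norm (D - E)"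
    proof -
      have "real (n + 2) \<le> fact (n + 2)"
        using fact_ge_self[of "n + 2"] by (metis of_nat_fact of_nat_le_iff)
      then have "real (Suc (Suc n)) / fact (n + 2) \<le> 1" by simp
      from mult_right_mono[OF this, of "(1/4) ^ Suc n * norm (D - E)"] show ?thesis by simp
    qed
    finally show "norm (f D (n + 2) - f E (n + 2)) \<le> (1/4) ^ n * (norm (D - E) / 4)" by simp
  qed (intro summable_mult2 summable_geometric, simp)
  also have "\<dots> = (\<Sum>n. (1/4) ^ n) * (norm (D - E) / 4)"
    by (rule suminf_mult2[symmetric]) (simp add: summable_geometric)
  also have "\<dots> = norm (D - E) / 3" by (simp add: suminf_geometric)
  also have "\<dots> \<le> norm (D - E) / 2" by simp
  finally show ?thesis .
qed

lemma exp_small: 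
  fixes D :: "'b::{real_normed_algebra_1,banach}"
  assumes "norm D \<le> 1/4"
  shows "norm (exp D - 1 - D) \<le> norm D / 2"
  using exp_small_lipschitz[OF assms, of 0] by (simp add: algebra_simps)

text \<open>\<open>exp D = c\<close> is solved as the fixed point equation
  \<open>D = c - exp D + D\<close>. The radii fit: for \<open>norm D \<le> 1/8\<close> the
  right-hand side has norm at most 1/16 + (1/8) / 2 = 1/8.\<close>

lemma exp_locally_surjective:
  fixes c :: "'b::{real_normed_algebra_1,banach}"
  assumes c: "norm (c - 1) \<le> 1/16"
  shows "\<exists>D. norm D \<le> 1/8 \<and> exp D = c"
proof -
  have "\<exists>!D\<in>cball 0 (1/8). c - exp D + D = (D::'b)"
  proof (rule Banach_fix[where c = "1/2"])
    show "(\<lambda>D. c - exp D + D) ` cball 0 (1/8) \<subseteq> cball 0 (1/8::real)"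
    proof clarify
      fix D :: 'b assume "D \<in> cball 0 (1/8)"
      then have D: "norm D \<le> 1/8" by simp
      have "c - exp D + D = (c - 1) - (exp D - 1 - D)" by simp
      also have "norm \<dots> \<le> norm (c - 1) + norm (exp D - 1 - D)" by (rule norm_triangle_ineq4)
      also have "\<dots> \<le> 1/16 + (1/8) / 2" using c exp_small[of D] D by linarith
      finally show "c - exp D + D \<in> cball 0 (1/8)" by simp
    qed
    fix D E :: 'b assume "D \<in> cball 0 (1/8)" "E \<in> cball 0 (1/8)"
    then have "norm ((exp E - E) - (exp D - D)) \<le> norm (E - D) / 2"
      by (intro exp_small_lipschitz) simp_all
    moreover have "(exp E - E) - (exp D - D) = (c - exp D + D) - (c - exp E + E)" by simp
    ultimately show "dist (c - exp D + D) (c - exp E + E) \<le> 1/2 * dist D E"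
      by (simp add: dist_norm norm_minus_commute)
  qed (auto simp: complete_eq_closed)
  then show ?thesis by auto
qed

text \<open>The points \<open>(1/2) ^ n\<close> are those reached by repeated square roots; what is
  known at these points alone determines the derivative at 0.\<close>

lemma has_vector_derivative_dyadic_zero:
  fixes f :: "real \<Rightarrow> 'b::real_normed_vector"
  assumes "(f has_vector_derivative L) (at 0)" "f 0 = 0" "\<And>n. f ((1/2) ^ n) = 0"
  shows "L = 0"
proof -
  have "((\<lambda>s. (1 / (s - 0)) *\<^sub>R (f s - f 0)) \<longlongrightarrow> L) (at 0)"
    using assms(1) by (simp only: has_vector_derivative_iff_tendsto)
  moreover have "filterlim (\<lambda>n. (1/2::real) ^ n) (at 0) sequentially"
    by (rule filterlim_atI) (auto intro!: LIMSEQ_realpow_zero)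
  ultimately have "(\<lambda>n. (1 / ((1/2) ^ n - 0)) *\<^sub>R (f ((1/2) ^ n) - f 0)) \<longlonglongrightarrow> L"
    by (rule filterlim_compose)
  then have "(\<lambda>n. 0) \<longlonglongrightarrow> L" by (simp add: assms)
  then show ?thesis by (simp add: LIMSEQ_const_iff)
qed

text \<open>\<open>k\<close> solves the adjoint equation, so \<open>k t * h t\<close> is constantly
  1. For any solution \<open>z\<close> the curve \<open>app (k t) (z t)\<close> is constant as well,
  which is uniqueness; the last conclusion drives every argument by parallel transport.\<close>

lemma evolution_exists:
  fixes B :: "real \<Rightarrow> 'a::euclidean_space endo"
  assumes B: "continuous_on UNIV B"
  obtains h where "h 0 = 1" "\<And>t. (h has_vector_derivative B t * h t) (at t)" "\<And>t. \<exists>d. h t * d = 1"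
    "\<And>z t. (\<And>t. (z has_vector_derivative app (B t) (z t)) (at t)) \<Longrightarrow> z t = app (h t) (z 0)"
proof -
  obtain h where h: "h 0 = 1" "\<And>t. (h has_vector_derivative B t * h t) (at t)"
    using linear_ode_exists[OF bounded_bilinear_mult B] by blast
  obtain k where k: "k 0 = 1" "\<And>t. (k has_vector_derivative - (k t * B t)) (at t)"
    using linear_ode_exists[OF bounded_bilinear.flip[OF bounded_bilinear_mult] continuous_on_minus[OF B],
      of 1] by auto
  have const: "g t = g 0" if "\<And>t. (g has_vector_derivative 0) (at t)" for g :: "real \<Rightarrow> 'b::real_normed_vector" and t
    using has_vector_derivative_zero_constant[of UNIV g] that
    by (metis UNIV_I convex_UNIV)
  have kh: "k t * h t = 1" for t
  proof -
    have "((\<lambda>t. k t * h t) has_vector_derivative 0) (at t)" for t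
      using bounded_bilinear.has_vector_derivative[OF bounded_bilinear_mult k(2) h(2), of t]
      by (simp add: algebra_simps)
    from const[OF this, of t] show ?thesis by (simp add: h k)
  qed
  have hk: "h t * k t = 1" for t by (rule endo_mult_commute_one[OF kh])
  show ?thesis
  proof (rule that[OF h])
    fix z t assume z: "\<And>t. (z has_vector_derivative app (B t) (z t)) (at t)"
    have "((\<lambda>t. app (k t) (z t)) has_vector_derivative 0) (at t)" for t
      using bounded_bilinear.has_vector_derivative[OF bounded_bilinear_app k(2) z, of t]
      by (simp add: app.bilinear_simps)
    from const[OF this, of t] have "app (h t) (app (k t) (z t)) = app (h t) (z 0)" by (simp add: k)
    then show "z t = app (h t) (z 0)" by (simp add: app_mult[symmetric] hk del: app_mult)
  qed (use hk in blast)
qed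

section \<open>Derivations and one-parameter families of automorphisms\<close>

context
  fixes br :: "'a::euclidean_space \<Rightarrow> 'a \<Rightarrow> 'a" and S :: "'a endo set"
  assumes bilin: "bounded_bilinear br"
begin

interpretation br: bounded_bilinear br by (rule bilin)

lemma derivations_zero: "0 \<in> derivations br S"
  by (simp add: derivations_def app.zero_left br.zero_left br.zero_right)

lemma derivations_add: "D \<in> derivations br S \<Longrightarrow> E \<in> derivations br S \<Longrightarrow> D + E \<in> derivations br S"
  by (auto simp: derivations_def app.add_left br.add_left br.add_right algebra_simps)

lemma derivations_scaleR: "D \<in> derivations br S \<Longrightarrow> r *\<^sub>R D \<in> derivations br S"
  by (auto simp: derivations_def app.scaleR_left br.scaleR_left br.scaleR_right scaleR_add_right)

lemma derivations_diff: "D \<in> derivations br S \<Longrightarrow> E \<in> derivations br S \<Longrightarrow> D - E \<in> derivations br S"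
  using derivations_add[of D "(-1) *\<^sub>R E"] derivations_scaleR[of E "-1"] by simp

lemma derivations_sum: "(\<And>i. i \<in> I \<Longrightarrow> D i \<in> derivations br S) \<Longrightarrow> sum D I \<in> derivations br S"
  by (induction I rule: infinite_finite_induct) (auto intro: derivations_zero derivations_add)

lemma derivations_conj:
  assumes D: "D \<in> derivations br S" and c: "c \<in> aut_grp br S"
  shows "c * D * einv c \<in> derivations br S"
proof -
  note ci = aut_grp_einv[OF c]
  have "c * D * einv c * X = X * (c * D * einv c)" if "X \<in> S" for X
  proof -
    have "c * D * einv c * X = c * D * (einv c * X)" by (simp add: mult.assoc)
    also have "\<dots> = c * (D * X) * einv c" using aut_grp_comm[OF ci that] by (simp add: mult.assoc)
    also have "\<dots> = (c * X) * D * einv c" using derivations_comm[OF D that] by (simp add: mult.assoc)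
    finally show ?thesis using aut_grp_comm[OF c that] by (simp add: mult.assoc)
  qed
  then show ?thesis
    by (auto simp: derivations_def aut_grp_br[OF ci] derivations_br[OF D] app.add_right
      aut_grp_br[OF c] aut_grp_inverse[OF c])
qed

text \<open>Differentiating the identities that define the group, and then replacing
  \<open>x\<close> and \<open>y\<close> by their images under \<open>einv (c t)\<close>, gives the
  Leibniz rule.\<close>

lemma log_derivative_in_derivations:
  assumes c: "\<And>t. c t \<in> aut_grp br S" and d: "(c has_vector_derivative c') (at t)"
  shows "c' * einv (c t) \<in> derivations br S"
proof -
  have appd: "((\<lambda>t. app (c t) x) has_vector_derivative app c' x) (at t)" for x
    by (rule bounded_linear.has_vector_derivative[OF app.bounded_linear_left d])
  have 1: "app c' (br x y) = br (app (c t) x) (app c' y) + br (app c' x) (app (c t) y)" for x y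
  proof -
    have "((\<lambda>t. app (c t) (br x y)) has_vector_derivative
        br (app (c t) x) (app c' y) + br (app c' x) (app (c t) y)) (at t)"
      using br.has_vector_derivative[OF appd appd, of x y] by (simp add: aut_grp_br[OF c])
    then show ?thesis using appd vector_derivative_unique_at by blast
  qed
  have 2: "c' * X = X * c'" if "X \<in> S" for X
  proof -
    have "((\<lambda>t. c t * X) has_vector_derivative c' * X) (at t)"
      by (rule bounded_linear.has_vector_derivative[OF bounded_linear_mult_left d])
    moreover have "((\<lambda>t. c t * X) has_vector_derivative X * c') (at t)"
      using bounded_linear.has_vector_derivative[OF bounded_linear_mult_right d, of X]
      by (simp add: aut_grp_comm[OF c that])
    ultimately show ?thesis by (rule vector_derivative_unique_at)
  qed
  note ci = aut_grp_einv[OF c[of t]]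
  have "c' * einv (c t) * X = X * (c' * einv (c t))" if "X \<in> S" for X
    using 2[OF that] aut_grp_comm[OF ci that] by (metis mult.assoc)
  then show ?thesis
    by (auto simp: derivations_def aut_grp_br[OF ci] 1 aut_grp_inverse[OF c] add.commute)
qed

text \<open>When \<open>B\<close> is a derivation at all times, the bracket of two solutions is a
  solution, and so is the image of a solution under an element of \<open>S\<close>. Uniqueness
  identifies both with \<open>h t\<close> applied to their initial values.\<close>

lemma evolution_in_aut_grp:
  assumes "h 0 = 1" and h': "\<And>t. (h has_vector_derivative B t * h t) (at t)" and "\<And>t. \<exists>d. h t * d = 1"
    and uniq: "\<And>z t. (\<And>t. (z has_vector_derivative app (B t) (z t)) (at t)) \<Longrightarrow> z t = app (h t) (z 0)"
    and B: "\<And>t. B t \<in> derivations br S"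
  shows "h t \<in> aut_grp br S"
proof -
  have apph: "((\<lambda>t. app (h t) x) has_vector_derivative app (B t * h t) x) (at t)" for x t
    by (rule bounded_linear.has_vector_derivative[OF app.bounded_linear_left h'])
  have "br (app (h t) x) (app (h t) y) = app (h t) (br (app (h 0) x) (app (h 0) y))" for x y
  proof (rule uniq)
    fix t
    show "((\<lambda>t. br (app (h t) x) (app (h t) y)) has_vector_derivative
      app (B t) (br (app (h t) x) (app (h t) y))) (at t)"
      using br.has_vector_derivative[OF apph apph, of x y t]
      by (simp add: derivations_br[OF B] add.commute)
  qed
  moreover have "app X (app (h t) x) = app (h t) (app X (app (h 0) x))" if "X \<in> S" for X x
  proof (rule uniq)
    fix t
    have "app X (app (B t) y) = app (B t) (app X y)" for y
      using derivations_comm[OF B that, of t] by (metis app_mult)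
    then show "((\<lambda>t. app X (app (h t) x)) has_vector_derivative app (B t) (app X (app (h t) x))) (at t)"
      using bounded_linear.has_vector_derivative[OF app.bounded_linear_right apph, of X x t] by simp
  qed
  ultimately show ?thesis
    using assms(1,3) by (auto simp: aut_grp_def intro!: endo_eqI)
qed

text \<open>The exponential is the time-1 evolution for the constant coefficient
  \<open>D\<close>.\<close>

lemma exp_derivation_in_aut_grp:
  assumes D: "D \<in> derivations br S"
  shows "exp D \<in> aut_grp br S"
proof -
  obtain h where h: "h 0 = 1" "\<And>t. (h has_vector_derivative D * h t) (at t)" "\<And>t. \<exists>d. h t * d = 1"
    "\<And>z t. (\<And>t. (z has_vector_derivative app D (z t)) (at t)) \<Longrightarrow> z t = app (h t) (z 0)"
    by (rule evolution_exists[of "\<lambda>_. D"]) auto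
  have "app (exp (t *\<^sub>R D)) x = app (h t) (app (exp (0 *\<^sub>R D)) x)" for x t
  proof (rule h(4))
    fix t show "((\<lambda>t. app (exp (t *\<^sub>R D)) x) has_vector_derivative app D (app (exp (t *\<^sub>R D)) x)) (at t)"
      using bounded_linear.has_vector_derivative[OF app.bounded_linear_left
        exp_scaleR_has_vector_derivative_left[of D t], of x] by simp
  qed
  from this[of 1] have "exp D = h 1" by (intro endo_eqI) simp
  then show ?thesis using evolution_in_aut_grp[OF h D] by simp
qed

text \<open>The defect \<open>d x y = s (br x y) - br (s x) (s y)\<close> satisfies \<open>s (d x y) = - d (s x) (s y)\<close>, which for
  \<open>s\<close> near 1 says \<open>2 d\<close> is small compared to \<open>d\<close>.\<close>
lemma aut_grp_square_root:
  assumes ss: "s * s \<in> aut_grp br S" and small: "norm (s - 1) \<le> 1/4"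
  shows "s \<in> aut_grp br S"
proof -
  define M where "M = s - 1"
  have s: "s = 1 + M" and M: "norm M \<le> 1/4" using small by (simp_all add: M_def)
  define d where "d x y = app s (br x y) - br (app s x) (app s y)" for x y
  have d0: "app s (d x y) = - d (app s x) (app s y)" for x y
    using aut_grp_br[OF ss, of x y] by (simp add: d_def app.diff_right)
  have dadd: "d (x + x') y = d x y + d x' y" "d x (y + y') = d x y + d x y'" for x x' y y'
    by (simp_all add: d_def br.add_left br.add_right app.add_right)
  have "a + m = - (a + b + c + e) \<Longrightarrow> 2 *\<^sub>R a = - (m + b + c + e)" for a m b c e :: 'a
    by (simp only: eq_neg_iff_add_eq_0 scaleR_2 ac_simps)
  moreover have "d x y + app M (d x y) = - (d x y + d (app M x) y + d x (app M y) + d (app M x) (app M y))"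
    for x y using d0[of x y] by (simp add: s app.add_left dadd)
  ultimately have d1: "2 *\<^sub>R d x y = - (app M (d x y) + d (app M x) y + d x (app M y) + d (app M x) (app M y))" for x y
    by blast
  \<comment> \<open>With \<open>norm M \<le> 1/4\<close> the four terms in \<open>d1\<close> are at
    most 1/4, 1/4, 1/4 and 1/16 of \<open>K * norm x * norm y\<close>, together 13/16 of it. The
    factor 2 in \<open>d1\<close> then halves the bound, and iteration forces \<open>d\<close> to be
    0.\<close>
  have improve: "norm (d x y) \<le> K / 2 * norm x * norm y"
    if K: "0 \<le> K" "\<And>x y. norm (d x y) \<le> K * norm x * norm y" for K x y
  proof -
    have Mx: "norm (app M x) \<le> norm x / 4" for x
      using order_trans[OF norm_app mult_right_mono[OF M norm_ge_zero]] by simp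
    have n1: "norm (app M (d x y)) \<le> (K * norm x * norm y) / 4"
      using Mx[of "d x y"] K(2)[of x y] by simp
    have n2: "norm (d (app M x) y) \<le> K * (norm x / 4) * norm y"
      by (rule order_trans[OF K(2)]) (intro mult_right_mono mult_left_mono Mx K(1) norm_ge_zero)
    have n3: "norm (d x (app M y)) \<le> K * norm x * (norm y / 4)"
      by (rule order_trans[OF K(2)]) (intro mult_left_mono Mx mult_nonneg_nonneg K(1) norm_ge_zero)
    have n4: "norm (d (app M x) (app M y)) \<le> K * (norm x / 4) * (norm y / 4)"
      by (rule order_trans[OF K(2)])
        (intro mult_mono mult_left_mono Mx mult_nonneg_nonneg K(1) norm_ge_zero, simp)
    have "2 * norm (d x y) = norm (2 *\<^sub>R d x y)" by simp
    also have "\<dots> = norm (app M (d x y) + d (app M x) y + d x (app M y) + d (app M x) (app M y))"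
      unfolding d1 by (rule norm_minus_cancel)
    also have "\<dots> \<le> norm (app M (d x y)) + norm (d (app M x) y) + norm (d x (app M y)) +
      norm (d (app M x) (app M y))"
      by (intro norm_triangle_mono order_refl)
    also have "\<dots> \<le> 13/16 * (K * norm x * norm y)" using n1 n2 n3 n4 by simp
    also have "\<dots> \<le> K * norm x * norm y"
      using mult_nonneg_nonneg[OF mult_nonneg_nonneg[OF K(1) norm_ge_zero[of x]] norm_ge_zero[of y]]
      by linarith
    finally show ?thesis by simp
  qed
  obtain Q where Q: "0 < Q" "\<And>a b. norm (br a b) \<le> norm a * norm b * Q"
    using br.pos_bounded by blast
  define K where "K = norm s * Q + norm s * norm s * Q"
  have K: "norm (d x y) \<le> K * norm x * norm y" for x y
  proof -
    have "norm (d x y) \<le> norm (app s (br x y)) + norm (br (app s x) (app s y))"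
      unfolding d_def by (rule norm_triangle_ineq4)
    also have "norm (app s (br x y)) \<le> norm s * (norm x * norm y * Q)"
      by (rule order_trans[OF norm_app mult_left_mono[OF Q(2) norm_ge_zero]])
    also have "norm (br (app s x) (app s y)) \<le> (norm s * norm x) * (norm s * norm y) * Q"
      by (rule order_trans[OF Q(2)]) (intro mult_right_mono mult_mono norm_app; use Q in simp)
    finally show ?thesis by (simp add: K_def algebra_simps)
  qed
  have K0: "0 \<le> K" using Q(1) by (simp add: K_def)
  have "norm (d x y) \<le> (1/2) ^ n * K * norm x * norm y" for n x y
  proof (induction n arbitrary: x y)
    case (Suc n)
    show ?case using improve[OF _ Suc] K0 by simp
  qed (simp add: K)
  then have decay: "norm (d x y) \<le> (1/2) ^ n * (K * norm x * norm y)" for n x y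
    by (simp add: mult.assoc)
  have "norm (d x y) \<le> 0" for x y
  proof (rule LIMSEQ_le_const)
    show "(\<lambda>n. (1/2) ^ n * (K * norm x * norm y)) \<longlonglongrightarrow> 0"
      by (intro tendsto_mult_left_zero LIMSEQ_realpow_zero) simp_all
  qed (use decay in blast)
  then have "app s (br x y) = br (app s x) (app s y)" for x y by (simp add: d_def)
  moreover have "s * X = X * s" if "X \<in> S" for X
  proof -
    \<comment> \<open>The commutator is treated like \<open>d\<close>: as \<open>s * s\<close>
      commutes with \<open>X\<close>, \<open>s * E = - (E * s)\<close>, so 2 E = - (M E + E M),
      which has at most half the norm of \<open>E\<close>.\<close>
    define E where "E = s * X - X * s"
    have "s * E + E * s = 0"
      using aut_grp_comm[OF ss that] by (simp add: E_def algebra_simps)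
    then have "2 *\<^sub>R E + (M * E + E * M) = 0" by (simp add: s algebra_simps scaleR_2)
    then have "2 *\<^sub>R E = - (M * E + E * M)" by (simp only: eq_neg_iff_add_eq_0)
    then have "2 * norm E = norm (M * E + E * M)"
      by (metis norm_minus_cancel norm_scaleR abs_numeral)
    also have "\<dots> \<le> norm M * norm E + norm E * norm M"
      by (intro norm_triangle_mono norm_mult_ineq)
    also have "\<dots> \<le> (1/4) * norm E + norm E * (1/4)"
      by (intro add_mono mult_right_mono mult_left_mono M norm_ge_zero)
    finally show ?thesis by (simp add: E_def)
  qed
  moreover have "s * (s * einv (s * s)) = 1"
    using aut_grp_inverse(1)[OF ss] by (simp add: mult.assoc)
  ultimately show ?thesis unfolding aut_grp_def by blast
qed

lemma aut_grp_near_one: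
  assumes c: "c \<in> aut_grp br S" and near: "norm (c - 1) \<le> 1/16"
  shows "\<exists>D\<in>derivations br S. exp D = c"
proof -
  obtain D where D: "norm D \<le> 1/8" "exp D = c" using exp_locally_surjective[OF near] by blast
  \<comment> \<open>Halving the exponent takes a square root. From \<open>norm ?E \<le> 1/8\<close>
    the distance of \<open>exp ?E\<close> from 1 is at most 3/16, so the square root argument
    applies at every stage.\<close>
  have e: "exp ((1/2) ^ n *\<^sub>R D) \<in> aut_grp br S" for n
  proof (induction n)
    case (Suc n)
    let ?E = "(1/2) ^ Suc n *\<^sub>R D"
    have "(1/2::real) ^ Suc n \<le> 1" by (rule power_le_one) auto
    from mult_right_mono[OF this norm_ge_zero, of D] have nE: "norm ?E \<le> norm D" by simp
    have "exp ?E * exp ?E = exp (?E + ?E)" by (rule exp_add_commuting[symmetric]) simp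
    also have "?E + ?E = (1/2) ^ n *\<^sub>R D" by (simp add: scaleR_2[symmetric])
    finally have "exp ?E * exp ?E \<in> aut_grp br S" using Suc by simp
    moreover have "norm (exp ?E - 1) \<le> norm (exp ?E - 1 - ?E) + norm ?E"
      using norm_triangle_ineq[of "exp ?E - 1 - ?E" ?E] by simp
    then have "norm (exp ?E - 1) \<le> 1/4"
      using exp_small[of ?E] nE D by linarith
    ultimately show ?case by (rule aut_grp_square_root)
  qed (simp add: D c)
  let ?e = "\<lambda>t. exp (t *\<^sub>R D)"
  have de: "(?e has_vector_derivative D) (at 0)"
    using exp_scaleR_has_vector_derivative_left[of D 0] by simp
  have ae: "((\<lambda>t. app (?e t) x) has_vector_derivative app D x) (at 0)" for x
    by (rule bounded_linear.has_vector_derivative[OF app.bounded_linear_left de])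
  have "app D (br x y) - (br x (app D y) + br (app D x) y) = 0" for x y
  proof (rule has_vector_derivative_dyadic_zero)
    show "((\<lambda>t. app (?e t) (br x y) - br (app (?e t) x) (app (?e t) y)) has_vector_derivative
      app D (br x y) - (br x (app D y) + br (app D x) y)) (at 0)"
      using has_vector_derivative_diff[OF ae br.has_vector_derivative[OF ae ae], of "br x y" x y] by simp
  qed (simp_all add: aut_grp_br[OF e])
  moreover have "D * X - X * D = 0" if "X \<in> S" for X
  proof (rule has_vector_derivative_dyadic_zero)
    show "((\<lambda>t. ?e t * X - X * ?e t) has_vector_derivative D * X - X * D) (at 0)"
      by (intro has_vector_derivative_diff de
        bounded_linear.has_vector_derivative[OF bounded_linear_mult_left]
        bounded_linear.has_vector_derivative[OF bounded_linear_mult_right])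
  qed (simp_all add: aut_grp_comm[OF e that])
  ultimately have "D \<in> derivations br S" by (simp add: derivations_def add.commute)
  with D show ?thesis by blast
qed

text \<open>\<open>R a b\<close> says that a smooth path from 1 ends at the quotient of
  \<open>b\<close> by \<open>a\<close>. Such paths are combined by pointwise multiplication instead
  of concatenation, so no corners arise; near \<open>a\<close> the path
  \<open>exp (t *\<^sub>R D)\<close> serves. An equivalence relation with open classes is trivial on
  a connected set.\<close>

lemma smooth_path_in_component:
  assumes T: "connected T" "T \<subseteq> aut_grp br S" "1 \<in> T" "c \<in> T"
  shows "\<exists>p. smooth p \<and> (\<forall>t. p t \<in> aut_grp br S) \<and> p 0 = 1 \<and> p 1 = c"
proof -
  define R where "R a b \<longleftrightarrow> (\<exists>p. smooth p \<and> (\<forall>t. p t \<in> aut_grp br S) \<and> p (0::real) = 1 \<and> b = a * p 1)" for a b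
  have "R 1 c"
  proof (rule connected_equivalence_relation[OF T(1,3,4)])
    fix a b assume "R a b"
    then obtain p where p: "smooth p" "\<And>t. p t \<in> aut_grp br S" "p 0 = 1" "b = a * p 1"
      by (auto simp: R_def)
    have "einv (p 0) = 1" by (rule einv_unique) (simp add: p)
    moreover have "a = b * einv (p 1)"
      using p(4) by (simp add: mult.assoc aut_grp_inverse[OF p(2)])
    ultimately show "R b a" unfolding R_def
      by (intro exI[of _ "\<lambda>t. einv (p t)"]) (auto intro: smooth_einv p aut_grp_einv)
  next
    fix a b d assume "R a b" "R b d"
    then obtain p q where p: "smooth p" "\<And>t. p t \<in> aut_grp br S" "p 0 = 1" "b = a * p 1"
      and q: "smooth q" "\<And>t. q t \<in> aut_grp br S" "q 0 = 1" "d = b * q 1"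
      unfolding R_def by blast
    then show "R a d" unfolding R_def
      by (intro exI[of _ "\<lambda>t. p t * q t"]) (auto intro: smooth_mult aut_grp_mult simp: mult.assoc)
  next
    fix a assume a: "a \<in> T"
    then have aG: "a \<in> aut_grp br S" using T by blast
    \<comment> \<open>Chosen so that \<open>norm (einv a * b - 1)\<close> is at most 1/16 for
      \<open>b\<close> in the ball.\<close>
    define \<delta> where "\<delta> = 1 / (16 * (norm (einv a) + 1))"
    have \<delta>: "0 < \<delta>" by (simp add: \<delta>_def add_nonneg_pos)
    have "R a b" if b: "b \<in> T \<inter> ball a \<delta>" for b
    proof -
      have bG: "b \<in> aut_grp br S" using b T by blast
      have "einv a * b - 1 = einv a * (b - a)"
        using aut_grp_inverse[OF aG] by (simp add: algebra_simps)
      then have "norm (einv a * b - 1) \<le> norm (einv a) * norm (b - a)"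
        by (simp add: norm_mult_ineq)
      also have "\<dots> \<le> (norm (einv a) + 1) * \<delta>"
        using b by (intro mult_mono) (auto simp: dist_norm norm_minus_commute)
      also have "\<dots> = 1/16"
        using norm_ge_zero[of "einv a"] by (simp add: \<delta>_def field_simps add_nonneg_eq_0_iff)
      finally obtain D where D: "D \<in> derivations br S" "exp D = einv a * b"
        using aut_grp_near_one[OF aut_grp_mult[OF aut_grp_einv[OF aG] bG]] by blast
      have "b = a * exp D" using D(2) aut_grp_inverse[OF aG] by simp
      then show "R a b" unfolding R_def
        using exp_derivation_in_aut_grp[OF derivations_scaleR[OF D(1)]]
        by (intro exI[of _ "\<lambda>t. exp (t *\<^sub>R D)"]) (simp add: smooth_exp_scaleR)
    qed
    moreover have "openin (top_of_set T) (T \<inter> ball a \<delta>)" by (simp add: openin_open_Int)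
    moreover have "a \<in> T \<inter> ball a \<delta>" using a \<delta> by simp
    ultimately show "\<exists>U. openin (top_of_set T) U \<and> a \<in> U \<and> (\<forall>b\<in>U. R a b)" by blast
  qed
  then show ?thesis unfolding R_def by (metis mult.left_neutral)
qed

end

section \<open>Loops with prescribed values\<close>

definition zpow :: "('b \<Rightarrow> 'b) \<Rightarrow> int \<Rightarrow> 'b \<Rightarrow> 'b" where
  "zpow f k = (if 0 \<le> k then f ^^ nat k else inv f ^^ nat (- k))"

lemma zpow_0 [simp]: "zpow f 0 x = x"
  by (simp add: zpow_def)

lemma zpow_Suc:
  assumes "bij f"
  shows "zpow f (k + 1) x = f (zpow f k x)"
proof (cases "0 \<le> k")
  case True
  then show ?thesis by (simp add: zpow_def nat_add_distrib)
next
  case False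
  then have "nat (- k) = Suc (nat (- (k + 1)))" by simp
  moreover have "f (inv f y) = y" for y using assms by (simp add: bij_is_surj surj_f_inv_f)
  ultimately show ?thesis using False by (cases "k = -1") (simp_all add: zpow_def)
qed

lemma zpow_1: "bij f \<Longrightarrow> zpow f 1 x = f x"
  using zpow_Suc[of f 0 x] by simp

lemma zpow_invariant:
  assumes "\<And>x. Q x \<Longrightarrow> Q (f x)" "\<And>x. Q x \<Longrightarrow> Q (inv f x)" "Q x"
  shows "Q (zpow f k x)"
proof -
  have "Q ((g ^^ n) x)" if "\<And>x. Q x \<Longrightarrow> Q (g x)" for g n
    using that assms(3) by (induction n) auto
  with assms(1,2) show ?thesis by (simp add: zpow_def)
qed

lemma zpow_Suc_right:
  assumes "bij f"
  shows "zpow f (k + 1) x = zpow f k (f x)"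
proof (induction k rule: int_induct[of _ 0])
  case base
  then show ?case by (simp add: zpow_1 assms)
next
  case (step1 i)
  then show ?case by (simp only: zpow_Suc[OF assms])
next
  case (step2 i)
  have "f (zpow f (i - 1) (f x)) = zpow f i (f x)" using zpow_Suc[OF assms, of "i - 1"] by simp
  also have "\<dots> = f (zpow f i x)" using step2 by (simp add: zpow_Suc assms)
  finally have "zpow f (i - 1) (f x) = zpow f i x"
    using assms by (meson bij_is_inj injD)
  then show ?case by simp
qed

lemma bounded_linear_zpow:
  assumes "bounded_linear f" "bounded_linear (inv f)"
  shows "bounded_linear (zpow f k)"
proof -
  have "bounded_linear (g ^^ n)" if "bounded_linear g" for g :: "'a \<Rightarrow> 'a" and n
  proof (induction n)
    case (Suc n)
    from bounded_linear_compose[OF that this] show ?case by (simp add: o_def)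
  qed (simp add: id_def)
  with assms show ?thesis by (simp add: zpow_def)
qed

text \<open>The curve \<open>g\<close> is used on the interval \<open>[-pi, pi]\<close>; the condition near \<open>-pi\<close> makes the pieces fit.\<close>
lemma twisted_extension:
  fixes g :: "real \<Rightarrow> 'b::real_normed_vector"
  assumes bij: "bij \<Sigma>" and lin: "bounded_linear \<Sigma>" "bounded_linear (inv \<Sigma>)" and g: "smooth g"
    and \<epsilon>: "0 < \<epsilon>" and match: "\<And>t. \<bar>t + pi\<bar> < \<epsilon> \<Longrightarrow> g (t + 2 * pi) = \<Sigma> (g t)"
  obtains u where "smooth u" "\<And>t. u (t + 2 * pi) = \<Sigma> (u t)" "\<And>t. \<bar>t\<bar> \<le> pi \<Longrightarrow> u t = g t"
    "\<And>t. \<exists>k. u t = zpow \<Sigma> k (g (t - 2 * pi * of_int k))"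
proof -
  \<comment> \<open>\<open>K t\<close> numbers the period [-pi, pi) + 2 pi k that contains
    \<open>t\<close>.\<close>
  define K where "K t = \<lfloor>(t + pi) / (2 * pi)\<rfloor>" for t
  define u where "u t = zpow \<Sigma> (K t) (g (t - 2 * pi * of_int (K t)))" for t
  have K: "K t = k" if "- pi \<le> t - 2 * pi * of_int k" "t - 2 * pi * of_int k < pi" for t k
    unfolding K_def using that by (intro floor_unique) (simp_all add: field_simps)
  have K_bounds: "- pi \<le> t - 2 * pi * of_int (K t)" "t - 2 * pi * of_int (K t) < pi" for t
  proof -
    have "of_int (K t) \<le> (t + pi) / (2 * pi)" "(t + pi) / (2 * pi) < of_int (K t) + 1"
      by (simp_all add: K_def)
    then show "- pi \<le> t - 2 * pi * of_int (K t)" "t - 2 * pi * of_int (K t) < pi"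
      by (simp_all add: field_simps)
  qed
  show ?thesis
  proof (rule that)
    show "smooth u"
    proof (rule smooth_local)
      fix t
      define k where "k = K t"
      define r where "r = t - 2 * pi * of_int k"
      have r: "- pi \<le> r" "r < pi" using K_bounds[of t] by (simp_all add: r_def k_def)
      \<comment> \<open>Inside a period the neighbourhood avoids both ends. At the seam
        \<open>r = - pi\<close> its left half belongs to piece \<open>k - 1\<close>, which
        \<open>match\<close> identifies with piece \<open>k\<close>.\<close>
      define \<delta> where "\<delta> = min \<epsilon> (min (pi - r) (if r = - pi then pi else r + pi))"
      have \<delta>: "0 < \<delta>" using \<epsilon> r by (simp add: \<delta>_def)
      have "u s = zpow \<Sigma> k (g (s - 2 * pi * of_int k))" if s: "\<bar>s - t\<bar> < \<delta>" for s
      proof (cases "- pi \<le> s - 2 * pi * of_int k")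
        case True
        have "\<bar>s - t\<bar> < pi - r" using s by (simp add: \<delta>_def)
        then have "s - 2 * pi * of_int k < pi" by (simp add: r_def)
        with True have "K s = k" by (intro K)
        then show ?thesis by (simp add: u_def)
      next
        case False
        have rpi: "r = - pi"
        proof (rule ccontr)
          assume "r \<noteq> - pi"
          then have "\<bar>s - t\<bar> < r + pi" using s by (simp add: \<delta>_def)
          with False show False by (simp add: r_def)
        qed
        define x where "x = s - 2 * pi * of_int k"
        have x: "\<bar>x + pi\<bar> < \<epsilon>" "\<bar>x + pi\<bar> < pi"
        proof -
          have "x + pi = s - t" using rpi by (simp add: x_def r_def)
          then show "\<bar>x + pi\<bar> < \<epsilon>" "\<bar>x + pi\<bar> < pi" using s rpi by (simp_all add: \<delta>_def)
        qed
        have xs: "s - 2 * pi * of_int (k - 1) = x + 2 * pi" by (simp add: x_def algebra_simps)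
        have "K s = k - 1" using x False by (intro K) (simp_all only: xs, simp_all add: x_def)
        then have "u s = zpow \<Sigma> (k - 1) (\<Sigma> (g x))" by (simp only: u_def xs match[OF x(1)])
        also have "\<dots> = zpow \<Sigma> k (g x)" using zpow_Suc_right[OF bij, of "k - 1"] by simp
        finally show ?thesis by (simp add: x_def)
      qed
      then have "\<forall>\<^sub>F s in nhds t. u s = zpow \<Sigma> k (g (s - 2 * pi * of_int k))"
        using \<delta> by (auto simp: eventually_nhds_metric dist_real_def)
      moreover have "smooth (\<lambda>s. zpow \<Sigma> k (g (s - 2 * pi * of_int k)))"
        by (intro smooth_linear[OF bounded_linear_zpow[OF lin]] smooth_compose[OF g] smooth_diff
          smooth_ident smooth_const)
      ultimately show "\<exists>w. smooth w \<and> (\<forall>\<^sub>F s in nhds t. u s = w s)" by blast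
    qed
    fix t
    have "K (t + 2 * pi) = K t + 1"
      using K_bounds[of t] by (intro K) (simp_all add: algebra_simps)
    moreover have "t + 2 * pi - 2 * pi * of_int (K t + 1) = t - 2 * pi * of_int (K t)"
      by (simp add: algebra_simps)
    ultimately show "u (t + 2 * pi) = \<Sigma> (u t)"
      by (simp only: u_def zpow_Suc[OF bij])
    \<comment> \<open>Values of \<open>u\<close> arise from values of \<open>g\<close> by powers of
      \<open>\<Sigma>\<close>; through this, membership in a group passes from \<open>g\<close> to
      \<open>u\<close>.\<close>
    show "\<exists>k. u t = zpow \<Sigma> k (g (t - 2 * pi * of_int k))" unfolding u_def by blast
    show "u t = g t" if "\<bar>t\<bar> \<le> pi"
    proof (cases "t = pi")
      case True
      have "K t = 1" unfolding True by (rule K) simp_all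
      moreover have "g pi = \<Sigma> (g (- pi))" using match[of "- pi"] \<epsilon> by simp
      ultimately show ?thesis by (simp add: u_def True zpow_1[OF bij])
    next
      case False
      then have "K t = 0" using that by (intro K) auto
      then show ?thesis by (simp add: u_def)
    qed
  qed
qed

lemma loop_alg_smooth: "u \<in> loop_alg \<sigma> \<Longrightarrow> smooth u"
  by (simp add: loop_alg_def)

lemma loop_alg_shift: "u \<in> loop_alg \<sigma> \<Longrightarrow> u (t + 2 * pi) = \<sigma> (u t)"
  by (simp add: loop_alg_def)

lemma loop_algI: "smooth u \<Longrightarrow> (\<And>t. u (t + 2 * pi) = \<sigma> (u t)) \<Longrightarrow> u \<in> loop_alg \<sigma>"
  by (simp add: loop_alg_def)

lemma loop_alg_zpow:
  assumes "bij \<sigma>" "u \<in> loop_alg \<sigma>"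
  shows "u (t + 2 * pi * of_int k) = zpow \<sigma> k (u t)"
proof (induction k rule: int_induct[of _ 0])
  case (step1 i)
  have "t + 2 * pi * of_int (i + 1) = (t + 2 * pi * of_int i) + 2 * pi" by (simp add: algebra_simps)
  then show ?case by (simp only: loop_alg_shift[OF assms(2)] step1 zpow_Suc[OF assms(1)])
next
  case (step2 i)
  have "t + 2 * pi * of_int i = (t + 2 * pi * of_int (i - 1)) + 2 * pi" by (simp add: algebra_simps)
  then have "\<sigma> (u (t + 2 * pi * of_int (i - 1))) = zpow \<sigma> i (u t)"
    using step2 loop_alg_shift[OF assms(2)] by metis
  also have "\<dots> = \<sigma> (zpow \<sigma> (i - 1) (u t))" using zpow_Suc[OF assms(1), of "i - 1"] by simp
  finally show ?case using assms(1) by (meson bij_is_inj injD)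
qed simp

lemma real_mod_2pi:
  fixes s t :: real
  obtains r and k :: int where "t = r + 2 * pi * of_int k" "\<bar>r - s\<bar> \<le> pi"
proof -
  define k where "k = \<lfloor>(t - s + pi) / (2 * pi)\<rfloor>"
  have "of_int k \<le> (t - s + pi) / (2 * pi)" "(t - s + pi) / (2 * pi) < of_int k + 1"
    by (simp_all add: k_def)
  then have "\<bar>(t - 2 * pi * of_int k) - s\<bar> \<le> pi" by (simp add: field_simps abs_le_iff)
  then show ?thesis by (intro that[of "t - 2 * pi * of_int k" k]) simp_all
qed

lemma loop_alg_eqI:
  assumes "bij \<sigma>" "u \<in> loop_alg \<sigma>" "v \<in> loop_alg \<sigma>" "\<And>t. \<bar>t - s\<bar> \<le> pi \<Longrightarrow> u t = v t"
  shows "u = v"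
proof
  fix t
  obtain r k where "t = r + 2 * pi * of_int k" "\<bar>r - s\<bar> \<le> pi" by (rule real_mod_2pi)
  then show "u t = v t" using loop_alg_zpow[OF assms(1,2)] loop_alg_zpow[OF assms(1,3)] assms(4) by simp
qed

text \<open>For a curve supported strictly inside one period around \<open>s\<close>, both sides of
  the matching condition vanish near the seam.\<close>

lemma loop_extension:
  fixes g :: "real \<Rightarrow> 'a::euclidean_space"
  assumes \<sigma>: "bij \<sigma>" "linear \<sigma>" and g: "smooth g" and c: "c < pi" and supp: "\<And>t. c \<le> \<bar>t - s\<bar> \<Longrightarrow> g t = 0"
  shows "\<exists>u\<in>loop_alg \<sigma>. \<forall>t. \<bar>t - s\<bar> \<le> pi \<longrightarrow> u t = g t"
proof -
  have "linear (inv \<sigma>)"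
    using \<sigma> by (metis bij_betw_def inj_linear_imp_inv_linear)
  then have lin: "bounded_linear \<sigma>" "bounded_linear (inv \<sigma>)"
    using \<sigma> by (simp_all add: linear_conv_bounded_linear)
  have "smooth (\<lambda>t. g (t + s))"
    by (intro smooth_compose[OF g] smooth_add smooth_ident smooth_const)
  moreover have "g (t + 2 * pi + s) = \<sigma> (g (t + s))" if "\<bar>t + pi\<bar> < pi - c" for t
  proof -
    have "g (t + 2 * pi + s) = 0" "g (t + s) = 0" using that by (auto intro!: supp)
    then show ?thesis using linear_0[OF \<sigma>(2)] by simp
  qed
  ultimately obtain v where v: "smooth v" "\<And>t. v (t + 2 * pi) = \<sigma> (v t)" "\<And>t. \<bar>t\<bar> \<le> pi \<Longrightarrow> v t = g (t + s)"
    using twisted_extension[OF \<sigma>(1) lin, of "\<lambda>t. g (t + s)" "pi - c"] c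
    by (metis diff_gt_0_iff_gt)
  show ?thesis
  proof (intro bexI[of _ "\<lambda>t. v (t - s)"] loop_algI)
    show "smooth (\<lambda>t. v (t - s))"
      by (intro smooth_compose[OF v(1)] smooth_diff smooth_ident smooth_const)
    show "v (t + 2 * pi - s) = \<sigma> (v (t - s))" for t
      using v(2)[of "t - s"] by (simp add: algebra_simps)
  qed (use v(3) in simp)
qed

lemma loop_locally_constant:
  fixes x :: "'a::euclidean_space"
  assumes \<sigma>: "bij \<sigma>" "linear \<sigma>" and \<delta>: "0 < \<delta>" "\<delta> \<le> 1"
  shows "\<exists>u\<in>loop_alg \<sigma>. (\<forall>t. \<bar>t - s\<bar> \<le> \<delta> \<longrightarrow> u t = x) \<and> (\<forall>t. \<bar>t - s\<bar> \<le> pi \<longrightarrow> 2 * \<delta> \<le> \<bar>t - s\<bar> \<longrightarrow> u t = 0)"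
proof -
  obtain \<beta> :: "real \<Rightarrow> real" where \<beta>: "smooth \<beta>" "\<And>t. \<bar>t - s\<bar> \<le> \<delta> \<Longrightarrow> \<beta> t = 1" "\<And>t. 2 * \<delta> \<le> \<bar>t - s\<bar> \<Longrightarrow> \<beta> t = 0"
    by (rule smooth_bump_exists[OF \<delta>(1), of s]) blast
  have "2 * \<delta> < pi" using \<delta> pi_gt3 by linarith
  moreover have "smooth (\<lambda>t. \<beta> t *\<^sub>R x)" by (intro smooth_scaleR \<beta>(1) smooth_const)
  ultimately obtain u where u: "u \<in> loop_alg \<sigma>" "\<And>t. \<bar>t - s\<bar> \<le> pi \<Longrightarrow> u t = \<beta> t *\<^sub>R x"
    using loop_extension[OF \<sigma>, of "\<lambda>t. \<beta> t *\<^sub>R x" "2 * \<delta>" s] \<beta>(3) by force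
  have "u t = x" if "\<bar>t - s\<bar> \<le> \<delta>" for t
  proof -
    have "\<bar>t - s\<bar> \<le> pi" using that \<delta> pi_gt3 by linarith
    with that show ?thesis by (simp add: u \<beta>)
  qed
  with u \<beta>(3) show ?thesis by (intro bexI[of _ u]) auto
qed

lemma loop_through:
  fixes x :: "'a::euclidean_space"
  assumes "bij \<sigma>" "linear \<sigma>"
  shows "\<exists>u\<in>loop_alg \<sigma>. u s = x"
  using loop_locally_constant[OF assms, of 1 s x] by force

text \<open>Let \<open>r\<close> represent \<open>s\<close> within distance pi of \<open>t\<close>.
  If \<open>r\<close> differs from \<open>t\<close>, a bump with value \<open>x\<close> at
  \<open>t\<close> and support of radius at most the distance of \<open>r\<close> and
  \<open>t\<close> vanishes at \<open>r\<close>, hence at \<open>s\<close>.\<close>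

lemma loops_separate:
  fixes x :: "'a::euclidean_space" and \<sigma> :: "'a \<Rightarrow> 'a"
  assumes \<sigma>: "bij \<sigma>" "linear \<sigma>" and eq: "\<And>u. u \<in> loop_alg \<sigma> \<Longrightarrow> u s = 0 \<Longrightarrow> u t = 0 \<or> x = 0" and "x \<noteq> 0"
  shows "\<exists>k::int. t = s + 2 * pi * of_int k"
proof -
  obtain r k where r: "s = r + 2 * pi * of_int k" "\<bar>r - t\<bar> \<le> pi" by (rule real_mod_2pi)
  have "r = t"
  proof (rule ccontr)
    assume "r \<noteq> t"
    define \<delta> where "\<delta> = min 1 (\<bar>r - t\<bar> / 2)"
    have "\<delta> \<le> \<bar>r - t\<bar> / 2" unfolding \<delta>_def by (rule min.cobounded2)
    then have \<delta>: "0 < \<delta>" "\<delta> \<le> 1" "2 * \<delta> \<le> \<bar>r - t\<bar>" using \<open>r \<noteq> t\<close> by (auto simp: \<delta>_def)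
    obtain u where u: "u \<in> loop_alg \<sigma>" "u t = x" "u r = 0"
      using loop_locally_constant[OF \<sigma> \<delta>(1,2), of t x] \<delta> r(2) by force
    have "zpow \<sigma> k 0 = (0::'a)"
      by (rule zpow_invariant) (use \<sigma> linear_0[OF \<sigma>(2)] in \<open>auto simp: bij_def inv_f_eq\<close>)
    then have "u s = 0" using loop_alg_zpow[OF \<sigma>(1) u(1), of r k] u(3) r(1) by simp
    with eq[OF u(1)] u(2) \<open>x \<noteq> 0\<close> show False by simp
  qed
  then show ?thesis using r by (intro exI[of _ "- k"]) simp
qed

section \<open>Isomorphisms of loop algebras\<close>

locale simple_lie_algebra =
  fixes cplx :: bool and J :: "'a::euclidean_space \<Rightarrow> 'a" and br :: "'a \<Rightarrow> 'a \<Rightarrow> 'a"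
  assumes simple: "simple_lie cplx J br"
begin

lemma lie: "lie_alg cplx J br"
  using simple by (simp add: simple_lie_def)

lemma bilin: "bounded_bilinear br"
  using lie by (simp add: lie_alg_def bilinear_conv_bounded_bilinear)

sublocale br: bounded_bilinear br by (rule bilin)

lemma br_self: "br x x = 0"
  using lie by (simp add: lie_alg_def)

lemma br_antisym: "br x y = - br y x"
proof -
  have "br (x + y) (x + y) = br x x + br x y + (br y x + br y y)" by (simp add: br.add_left br.add_right)
  then have "br x y + br y x = 0" by (simp add: br_self)
  then show ?thesis by (simp add: eq_neg_iff_add_eq_0)
qed

lemma J_linear: "cplx \<Longrightarrow> linear J"
  using lie by (simp add: lie_alg_def)

lemma br_J: "cplx \<Longrightarrow> br (J x) y = J (br x y)"
  using lie by (simp add: lie_alg_def)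

lemma ideal_trivial: "lie_ideal cplx J br I \<Longrightarrow> I = {0} \<or> I = UNIV"
  using simple by (simp add: simple_lie_def)

text \<open>The center is an ideal, and it is proper because the bracket is not identically
  0.\<close>

lemma center_trivial:
  assumes "\<And>y. br x y = 0"
  shows "x = 0"
proof -
  let ?Z = "{x. \<forall>y. br x y = 0}"
  have "lie_ideal cplx J br ?Z"
    unfolding lie_ideal_def F_subspace_def
  proof (intro conjI impI allI)
    show "subspace ?Z"
      by (auto simp: subspace_def br.zero_left br.add_left br.scaleR_left)
    show "J ` ?Z \<subseteq> ?Z" if cplx
      using that linear_0[OF J_linear] by (auto simp: br_J)
    fix x y assume "y \<in> ?Z"
    then show "br x y \<in> ?Z" using br_antisym[of x y] by (simp add: br.zero_left)
  qed
  moreover have "?Z \<noteq> UNIV"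
    using simple by (auto simp: simple_lie_def)
  ultimately have "?Z = {0}" using ideal_trivial by blast
  with assms show ?thesis by blast
qed

abbreviation (input) "Aut \<equiv> lie_aut cplx J br"

lemma nontrivial: "\<exists>x::'a. x \<noteq> 0"
  using simple br.zero_left unfolding simple_lie_def by metis

lemma aut_bij: "f \<in> Aut \<Longrightarrow> bij f" and aut_linear: "f \<in> Aut \<Longrightarrow> linear f"
  and aut_J: "f \<in> Aut \<Longrightarrow> cplx \<Longrightarrow> f (J x) = J (f x)" and aut_br: "f \<in> Aut \<Longrightarrow> f (br x y) = br (f x) (f y)"
  by (simp_all add: lie_aut_def flin_def)

lemma loop_add: "\<sigma> \<in> Aut \<Longrightarrow> u \<in> loop_alg \<sigma> \<Longrightarrow> v \<in> loop_alg \<sigma> \<Longrightarrow> (\<lambda>t. u t + v t) \<in> loop_alg \<sigma>"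
  by (auto simp: loop_alg_def smooth_add linear_add aut_linear)

lemma loop_scaleR: "\<sigma> \<in> Aut \<Longrightarrow> u \<in> loop_alg \<sigma> \<Longrightarrow> (\<lambda>t. c *\<^sub>R u t) \<in> loop_alg \<sigma>"
  by (auto simp: loop_alg_def smooth_scaleR linear_scale aut_linear)

lemma loop_zero: "\<sigma> \<in> Aut \<Longrightarrow> (\<lambda>t. 0) \<in> loop_alg \<sigma>"
  by (auto simp: loop_alg_def linear_0 aut_linear)

lemma loop_J: "\<sigma> \<in> Aut \<Longrightarrow> cplx \<Longrightarrow> u \<in> loop_alg \<sigma> \<Longrightarrow> (\<lambda>t. J (u t)) \<in> loop_alg \<sigma>"
  using J_linear by (auto simp: loop_alg_def aut_J linear_conv_bounded_linear intro: smooth_linear)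

lemma loop_br: "\<sigma> \<in> Aut \<Longrightarrow> u \<in> loop_alg \<sigma> \<Longrightarrow> v \<in> loop_alg \<sigma> \<Longrightarrow> (\<lambda>t. br (u t) (v t)) \<in> loop_alg \<sigma>"
  by (auto simp: loop_alg_def aut_br intro: smooth_bilinear[OF bilin])

lemma loop_mult:
  "\<sigma> \<in> Aut \<Longrightarrow> f \<in> loop_alg (\<lambda>x::real. x) \<Longrightarrow> u \<in> loop_alg \<sigma> \<Longrightarrow> (\<lambda>t. f t *\<^sub>R u t) \<in> loop_alg \<sigma>"
  by (auto simp: loop_alg_def smooth_scaleR linear_scale aut_linear)

lemma loop_sum:
  "\<sigma> \<in> Aut \<Longrightarrow> (\<And>i. i \<in> I \<Longrightarrow> u i \<in> loop_alg \<sigma>) \<Longrightarrow> (\<lambda>t. \<Sum>i\<in>I. u i t) \<in> loop_alg \<sigma>"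
  by (induction I rule: infinite_finite_induct) (auto intro: loop_zero loop_add)

end

section \<open>Periodic functions acting through a point evaluation\<close>

abbreviation periodic :: "(real \<Rightarrow> real) set" where
  "periodic \<equiv> loop_alg (\<lambda>x. x)"

lemma periodic_const: "(\<lambda>t. c) \<in> periodic"
  by (simp add: loop_alg_def)

lemma periodic_mult: "f \<in> periodic \<Longrightarrow> g \<in> periodic \<Longrightarrow> (\<lambda>t. f t * g t) \<in> periodic"
  by (simp add: loop_alg_def smooth_mult)

lemma periodic_add: "f \<in> periodic \<Longrightarrow> g \<in> periodic \<Longrightarrow> (\<lambda>t. f t + g t) \<in> periodic"
  by (simp add: loop_alg_def smooth_add)

lemma periodic_sum: "(\<And>i. i \<in> I \<Longrightarrow> f i \<in> periodic) \<Longrightarrow> (\<lambda>t. \<Sum>i\<in>I. f i t) \<in> periodic"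
  by (induction I rule: infinite_finite_induct) (auto intro: periodic_const periodic_add)

lemma periodic_power: "f \<in> periodic \<Longrightarrow> (\<lambda>t. f t ^ n) \<in> periodic"
  by (simp add: loop_alg_def smooth_power)

lemma periodic_shift:
  assumes "f \<in> periodic"
  shows "f (t + 2 * pi * of_int k) = f t"
proof -
  have "zpow (\<lambda>x::real. x) k (f t) = f t" by (rule zpow_invariant) (auto simp: inv_f_eq)
  then show ?thesis using loop_alg_zpow[OF _ assms, of t k] by (simp add: bij_id[unfolded id_def])
qed

text \<open>A point evaluation of a loop algebra isomorphism, before it is known to be one.\<close>
locale loop_evaluation = simple_lie_algebra +
  fixes \<sigma> :: "'a \<Rightarrow> 'a" and \<rho> :: "(real \<Rightarrow> 'a) \<Rightarrow> 'a"
  assumes \<sigma>: "\<sigma> \<in> Aut"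
    and \<rho>_add: "\<And>u v. u \<in> loop_alg \<sigma> \<Longrightarrow> v \<in> loop_alg \<sigma> \<Longrightarrow> \<rho> (\<lambda>t. u t + v t) = \<rho> u + \<rho> v"
    and \<rho>_scaleR: "\<And>c u. u \<in> loop_alg \<sigma> \<Longrightarrow> \<rho> (\<lambda>t. c *\<^sub>R u t) = c *\<^sub>R \<rho> u"
    and \<rho>_J: "\<And>u. cplx \<Longrightarrow> u \<in> loop_alg \<sigma> \<Longrightarrow> \<rho> (\<lambda>t. J (u t)) = J (\<rho> u)"
    and \<rho>_br: "\<And>u v. u \<in> loop_alg \<sigma> \<Longrightarrow> v \<in> loop_alg \<sigma> \<Longrightarrow> \<rho> (\<lambda>t. br (u t) (v t)) = br (\<rho> u) (\<rho> v)"
    and \<rho>_surj: "\<And>x. \<exists>u\<in>loop_alg \<sigma>. \<rho> u = x"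
begin

lemma \<rho>_zero: "\<rho> (\<lambda>t. 0) = 0"
  using \<rho>_scaleR[OF loop_zero[OF \<sigma>], of 0] by simp

lemma \<rho>_diff: "u \<in> loop_alg \<sigma> \<Longrightarrow> v \<in> loop_alg \<sigma> \<Longrightarrow> \<rho> (\<lambda>t. u t - v t) = \<rho> u - \<rho> v"
  using \<rho>_add[of u "\<lambda>t. (-1) *\<^sub>R v t"] \<rho>_scaleR[of v "-1"] loop_scaleR[OF \<sigma>, of v "-1"] by simp

lemma loop_diff: "u \<in> loop_alg \<sigma> \<Longrightarrow> v \<in> loop_alg \<sigma> \<Longrightarrow> (\<lambda>t. u t - v t) \<in> loop_alg \<sigma>"
  using loop_add[OF \<sigma>, of u "\<lambda>t. (-1) *\<^sub>R v t"] loop_scaleR[OF \<sigma>, of v "-1"] by simp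

lemma \<rho>_sum: "(\<And>i. i \<in> I \<Longrightarrow> u i \<in> loop_alg \<sigma>) \<Longrightarrow> \<rho> (\<lambda>t. \<Sum>i\<in>I. u i t) = (\<Sum>i\<in>I. \<rho> (u i))"
proof (induction I rule: infinite_finite_induct)
  case (insert i I)
  then show ?case using \<rho>_add[of "u i" "\<lambda>t. \<Sum>i\<in>I. u i t"] loop_sum[OF \<sigma>, of I u] by simp
qed (simp_all add: \<rho>_zero)

text \<open>The annihilator of the action of periodic functions that sends \<open>\<rho> u\<close>
  to the value of \<open>\<rho>\<close> at the product of \<open>f\<close> and \<open>u\<close>. It
  turns out to be the ideal of functions vanishing at one point, the point of evaluation.\<close>

definition \<I> :: "(real \<Rightarrow> real) set" where
  "\<I> = {f \<in> periodic. \<forall>u\<in>loop_alg \<sigma>. \<rho> (\<lambda>t. f t *\<^sub>R u t) = 0}"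

text \<open>Makes the action well defined. In a bracket the scalar \<open>f\<close> can be moved
  from \<open>u\<close> to \<open>v\<close>, so the element in question brackets to 0 with
  everything.\<close>

lemma kernel_module:
  assumes u: "u \<in> loop_alg \<sigma>" "\<rho> u = 0" and f: "f \<in> periodic"
  shows "\<rho> (\<lambda>t. f t *\<^sub>R u t) = 0"
proof (rule center_trivial)
  fix y
  obtain v where v: "v \<in> loop_alg \<sigma>" "\<rho> v = y" using \<rho>_surj by blast
  have "br (\<rho> (\<lambda>t. f t *\<^sub>R u t)) y = \<rho> (\<lambda>t. br (f t *\<^sub>R u t) (v t))"
    using \<rho>_br[OF loop_mult[OF \<sigma> f u(1)] v(1)] v(2) by simp
  also have "(\<lambda>t. br (f t *\<^sub>R u t) (v t)) = (\<lambda>t. br (u t) (f t *\<^sub>R v t))"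
    by (simp add: br.scaleR_left br.scaleR_right)
  also have "\<rho> \<dots> = 0"
    using \<rho>_br[OF u(1) loop_mult[OF \<sigma> f v(1)]] u(2) by (simp add: br.zero_left)
  finally show "br (\<rho> (\<lambda>t. f t *\<^sub>R u t)) y = 0" .
qed

text \<open>\<open>?K\<close> is the kernel of the action of \<open>f\<close>. The action commutes
  with brackets, so \<open>?K\<close> is an ideal; it is proper because \<open>f\<close> is not in
  \<open>\<I>\<close>.\<close>

lemma kernel_cancel:
  assumes f: "f \<in> periodic" "f \<notin> \<I>" and u: "u \<in> loop_alg \<sigma>" "\<rho> (\<lambda>t. f t *\<^sub>R u t) = 0"
  shows "\<rho> u = 0"
proof -
  let ?K = "{\<rho> u |u. u \<in> loop_alg \<sigma> \<and> \<rho> (\<lambda>t. f t *\<^sub>R u t) = 0}"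
  have "lie_ideal cplx J br ?K"
    unfolding lie_ideal_def F_subspace_def
  proof (intro conjI impI allI)
    show "subspace ?K"
    proof (rule subspaceI)
      show "0 \<in> ?K"
        using loop_zero[OF \<sigma>] \<rho>_zero by (auto intro!: exI[of _ "\<lambda>t. 0"])
    next
      fix x y assume "x \<in> ?K" "y \<in> ?K"
      then obtain u v where u: "x = \<rho> u" "u \<in> loop_alg \<sigma>" "\<rho> (\<lambda>t. f t *\<^sub>R u t) = 0"
        and v: "y = \<rho> v" "v \<in> loop_alg \<sigma>" "\<rho> (\<lambda>t. f t *\<^sub>R v t) = 0" by blast
      have "\<rho> (\<lambda>t. f t *\<^sub>R (u t + v t)) = 0"
        using \<rho>_add[OF loop_mult[OF \<sigma> f(1) u(2)] loop_mult[OF \<sigma> f(1) v(2)]] u v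
        by (simp add: scaleR_add_right)
      moreover have "x + y = \<rho> (\<lambda>t. u t + v t)" using u v \<rho>_add by simp
      ultimately show "x + y \<in> ?K" using loop_add[OF \<sigma> u(2) v(2)] by blast
    next
      fix c x assume "x \<in> ?K"
      then obtain u where u: "x = \<rho> u" "u \<in> loop_alg \<sigma>" "\<rho> (\<lambda>t. f t *\<^sub>R u t) = 0" by blast
      have "(\<lambda>t. f t *\<^sub>R c *\<^sub>R u t) = (\<lambda>t. c *\<^sub>R f t *\<^sub>R u t)" by (simp add: mult.commute)
      then have "\<rho> (\<lambda>t. f t *\<^sub>R c *\<^sub>R u t) = 0"
        using \<rho>_scaleR[OF loop_mult[OF \<sigma> f(1) u(2)], of c] u(3) by simp
      moreover have "c *\<^sub>R x = \<rho> (\<lambda>t. c *\<^sub>R u t)" using u \<rho>_scaleR by simp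
      ultimately show "c *\<^sub>R x \<in> ?K" using loop_scaleR[OF \<sigma> u(2)] by blast
    qed
    show "J ` ?K \<subseteq> ?K" if cplx
    proof
      fix y assume "y \<in> J ` ?K"
      then obtain u where u: "y = J (\<rho> u)" "u \<in> loop_alg \<sigma>" "\<rho> (\<lambda>t. f t *\<^sub>R u t) = 0" by blast
      have "\<rho> (\<lambda>t. f t *\<^sub>R J (u t)) = 0"
        using \<rho>_J[OF that loop_mult[OF \<sigma> f(1) u(2)]] u(3) J_linear[OF that]
        by (simp add: linear_scale linear_0)
      moreover have "y = \<rho> (\<lambda>t. J (u t))" using u \<rho>_J[OF that] by simp
      ultimately show "y \<in> ?K" using loop_J[OF \<sigma> that u(2)] by blast
    qed
    fix x y assume "y \<in> ?K"
    then obtain u where u: "y = \<rho> u" "u \<in> loop_alg \<sigma>" "\<rho> (\<lambda>t. f t *\<^sub>R u t) = 0" by blast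
    obtain v where v: "v \<in> loop_alg \<sigma>" "\<rho> v = x" using \<rho>_surj by blast
    have "\<rho> (\<lambda>t. f t *\<^sub>R br (v t) (u t)) = 0"
      using \<rho>_br[OF v(1) loop_mult[OF \<sigma> f(1) u(2)]] u(3) by (simp add: br.scaleR_right br.zero_right)
    moreover have "br x y = \<rho> (\<lambda>t. br (v t) (u t))" using u v \<rho>_br by simp
    ultimately show "br x y \<in> ?K" using loop_br[OF \<sigma> v(1) u(2)] by blast
  qed
  moreover have "?K \<noteq> UNIV"
  proof
    assume K: "?K = UNIV"
    have "\<rho> (\<lambda>t. f t *\<^sub>R w t) = 0" if w: "w \<in> loop_alg \<sigma>" for w
    proof -
      have "\<rho> w \<in> ?K" by (simp only: K UNIV_I)
      then obtain v where v: "\<rho> w = \<rho> v" "v \<in> loop_alg \<sigma>" "\<rho> (\<lambda>t. f t *\<^sub>R v t) = 0" by blast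
      have "\<rho> (\<lambda>t. f t *\<^sub>R (w t - v t)) = 0"
        by (rule kernel_module[OF loop_diff[OF w v(2)] _ f(1)]) (simp add: \<rho>_diff w v)
      then show ?thesis
        using \<rho>_diff[OF loop_mult[OF \<sigma> f(1) w] loop_mult[OF \<sigma> f(1) v(2)]] v(3)
        by (simp add: scaleR_diff_right)
    qed
    then show False using f by (simp add: \<I>_def)
  qed
  ultimately have "?K = {0}" using ideal_trivial by blast
  then show ?thesis using u by blast
qed

lemma \<I>_mult: "f \<in> \<I> \<Longrightarrow> g \<in> periodic \<Longrightarrow> (\<lambda>t. f t * g t) \<in> \<I>"
  using periodic_mult loop_mult[OF \<sigma>, of g] by (auto simp: \<I>_def scaleR_scaleR[symmetric] simp del: scaleR_scaleR)

text \<open>Otherwise finitely many squares of members of \<open>\<I>\<close> add up to a periodic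
  \<open>G\<close> without zeros. Then every loop \<open>u\<close> is the sum of these squares times
  the loop \<open>inverse (G t) *\<^sub>R u t\<close>, and \<open>\<rho>\<close> would vanish
  identically.\<close>

lemma \<I>_common_zero: "\<exists>s. \<forall>f\<in>\<I>. f s = 0"
proof (rule ccontr)
  assume "\<nexists>s. \<forall>f\<in>\<I>. f s = 0"
  then obtain F where F: "\<And>s. F s \<in> \<I>" "\<And>s. F s s \<noteq> 0" by metis
  have FP: "F s \<in> periodic" for s using F by (simp add: \<I>_def)
  have "compact {- pi..pi}" by simp
  moreover have "open {t. F s t \<noteq> 0}" for s
    using open_Collect_neq[OF smooth_continuous[OF loop_alg_smooth[OF FP]] continuous_on_const] by simp
  moreover have "{- pi..pi} \<subseteq> (\<Union>s\<in>UNIV. {t. F s t \<noteq> 0})" using F by auto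
  ultimately obtain C where C: "finite C" "{- pi..pi} \<subseteq> (\<Union>s\<in>C. {t. F s t \<noteq> 0})"
    by (rule compactE_image) blast+
  define G where "G t = (\<Sum>s\<in>C. F s t * F s t)" for t
  have GP: "G \<in> periodic" unfolding G_def by (intro periodic_sum periodic_mult FP)
  have pos: "G t \<noteq> 0" for t
  proof -
    obtain r k where r: "t = r + 2 * pi * of_int k" "\<bar>r - 0\<bar> \<le> pi" by (rule real_mod_2pi)
    then have "r \<in> {- pi..pi}" by auto
    with C obtain s where "s \<in> C" "F s r \<noteq> 0" by blast
    then have "0 < G r" unfolding G_def
      by (intro sum_pos2[OF C(1)]) (auto simp: zero_less_mult_iff)
    then show ?thesis using periodic_shift[OF GP, of r k] r by simp
  qed
  have inv: "(\<lambda>t. inverse (G t)) \<in> periodic"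
    using GP pos by (auto simp: loop_alg_def intro: smooth_inverse)
  obtain u where u: "u \<in> loop_alg \<sigma>" "\<rho> u \<noteq> 0" using \<rho>_surj nontrivial by metis
  let ?w = "\<lambda>t. inverse (G t) *\<^sub>R u t"
  have w: "?w \<in> loop_alg \<sigma>" by (rule loop_mult[OF \<sigma> inv u(1)])
  have "(\<Sum>s\<in>C. (F s t * F s t) *\<^sub>R ?w t) = u t" for t
  proof -
    have "(\<Sum>s\<in>C. (F s t * F s t) *\<^sub>R ?w t) = G t *\<^sub>R ?w t" by (simp only: scaleR_sum_left G_def)
    then show ?thesis using pos[of t] by simp
  qed
  then have "\<rho> u = \<rho> (\<lambda>t. \<Sum>s\<in>C. (F s t * F s t) *\<^sub>R ?w t)" by simp
  also have "\<dots> = (\<Sum>s\<in>C. \<rho> (\<lambda>t. (F s t * F s t) *\<^sub>R ?w t))"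
    by (intro \<rho>_sum loop_mult[OF \<sigma>] periodic_mult FP w)
  also have "\<dots> = 0"
  proof (intro sum.neutral ballI)
    fix s
    have "(\<lambda>t. F s t * F s t) \<in> \<I>" by (rule \<I>_mult[OF F(1) FP])
    then have "\<forall>v\<in>loop_alg \<sigma>. \<rho> (\<lambda>t. (F s t * F s t) *\<^sub>R v t) = 0" by (simp add: \<I>_def)
    from bspec[OF this w] show "\<rho> (\<lambda>t. (F s t * F s t) *\<^sub>R ?w t) = 0" .
  qed
  finally show False using u by simp
qed

text \<open>If \<open>f\<close> vanishes at \<open>s\<close> but is not in \<open>\<I>\<close>, the
  vectors \<open>w k\<close> are linearly independent: a relation is a polynomial in
  \<open>f\<close> lying in \<open>\<I>\<close>, evaluation at \<open>s\<close> kills its constant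
  term, and a factor \<open>f\<close> cancels. This contradicts finite dimension.\<close>

lemma \<I>_maximal:
  assumes zero: "\<And>f. f \<in> \<I> \<Longrightarrow> f s = 0" and f: "f \<in> periodic" "f s = 0"
  shows "f \<in> \<I>"
proof (rule ccontr)
  assume fI: "f \<notin> \<I>"
  obtain u where u: "u \<in> loop_alg \<sigma>" "\<rho> u \<noteq> 0" using \<rho>_surj nontrivial by metis
  define w where "w k = \<rho> (\<lambda>t. f t ^ k *\<^sub>R u t)" for k
  have lc: "(\<Sum>k<n. c k *\<^sub>R w k) = \<rho> (\<lambda>t. (\<Sum>k<n. c k * f t ^ k) *\<^sub>R u t)" for n and c :: "nat \<Rightarrow> real"
  proof -
    have "\<rho> (\<lambda>t. (\<Sum>k<n. c k * f t ^ k) *\<^sub>R u t) = \<rho> (\<lambda>t. \<Sum>k<n. c k *\<^sub>R f t ^ k *\<^sub>R u t)"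
      by (simp add: scaleR_sum_left)
    also have "\<dots> = (\<Sum>k<n. \<rho> (\<lambda>t. c k *\<^sub>R f t ^ k *\<^sub>R u t))"
      by (intro \<rho>_sum loop_scaleR[OF \<sigma>] loop_mult[OF \<sigma>] periodic_power f u)
    also have "\<dots> = (\<Sum>k<n. c k *\<^sub>R w k)"
      unfolding w_def by (intro sum.cong refl \<rho>_scaleR loop_mult[OF \<sigma>] periodic_power f u)
    finally show ?thesis ..
  qed
  have pol: "(\<lambda>t. \<Sum>k<n. c k * f t ^ k) \<in> periodic" for n and c :: "nat \<Rightarrow> real"
    by (intro periodic_sum periodic_mult periodic_const periodic_power f)
  have indep: "(\<Sum>k<n. c k *\<^sub>R w k) = 0 \<Longrightarrow> k < n \<Longrightarrow> c k = 0" for n k and c :: "nat \<Rightarrow> real"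
  proof (induction n arbitrary: c k)
    case (Suc n)
    have g: "(\<lambda>t. \<Sum>k<Suc n. c k * f t ^ k) \<in> \<I>"
      using kernel_cancel[OF pol[where n = "Suc n" and c = c] _ u(1)] Suc.prems(1)
        lc[where n = "Suc n" and c = c] u(2) by auto
    have split: "(\<Sum>k<Suc n. c k * f t ^ k) = c 0 + f t * (\<Sum>k<n. c (Suc k) * f t ^ k)" for t
      by (simp add: sum.lessThan_Suc_shift sum_distrib_left mult_ac del: sum.lessThan_Suc)
    have c0: "c 0 = 0" using zero[OF g] f(2) unfolding split by simp
    have "\<rho> (\<lambda>t. f t *\<^sub>R (\<Sum>k<n. c (Suc k) * f t ^ k) *\<^sub>R u t) = 0"
      using Suc.prems(1) unfolding lc split c0 by simp
    from kernel_cancel[OF f(1) fI loop_mult[OF \<sigma> pol u(1)] this]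
    have "(\<Sum>k<n. c (Suc k) *\<^sub>R w k) = 0" by (simp only: lc)
    from Suc.IH[OF this] have "c (Suc k) = 0" if "k < n" for k using that by simp
    then show ?case using c0 Suc.prems(2) by (cases k) auto
  qed simp
  define n where "n = Suc DIM('a)"
  have inj: "inj_on w {..<n}"
  proof (rule inj_onI, rule ccontr)
    fix i j assume ij: "i \<in> {..<n}" "j \<in> {..<n}" "w i = w j" "i \<noteq> j"
    let ?c = "\<lambda>k. (if k = i then 1 else 0) - (if k = j then 1 else (0::real))"
    have "(\<Sum>k<n. ?c k *\<^sub>R w k) = (\<Sum>k<n. if k = i then w k else 0) - (\<Sum>k<n. if k = j then w k else 0)"
      unfolding sum_subtractf[symmetric] by (intro sum.cong refl) auto
    also have "\<dots> = 0" using ij by (simp add: sum.delta)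
    finally have "?c i = 0" by (rule indep) (use ij in simp)
    with ij show False by simp
  qed
  have "independent (w ` {..<n})"
  proof (rule ccontr)
    assume "\<not> independent (w ` {..<n})"
    then obtain c v where c: "v \<in> w ` {..<n}" "c v \<noteq> 0" "(\<Sum>v\<in>w ` {..<n}. c v *\<^sub>R v) = 0"
      by (auto simp: dependent_finite)
    have "(\<Sum>k<n. c (w k) *\<^sub>R w k) = 0" using c(3) by (simp add: sum.reindex[OF inj])
    then have "c (w k) = 0" if "k < n" for k using indep[of "\<lambda>k. c (w k)" n k] that by simp
    with c(1,2) show False by auto
  qed
  then have "card (w ` {..<n}) \<le> DIM('a)" using independent_bound by blast
  then have "n \<le> DIM('a)" by (simp only: card_image[OF inj] card_lessThan)
  then show False by (simp add: n_def)
qed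

text \<open>Near \<open>s\<close> the loop is a combination of locally constant loops with
  coefficients vanishing at \<open>s\<close>; the rest is \<open>u\<close> times a function
  vanishing at \<open>s\<close>. All these coefficients lie in \<open>\<I>\<close>.\<close>

lemma evaluation_factors:
  assumes max: "\<And>f. f \<in> periodic \<Longrightarrow> f s = 0 \<Longrightarrow> f \<in> \<I>" and u: "u \<in> loop_alg \<sigma>" "u s = 0"
  shows "\<rho> u = 0"
proof -
  obtain \<beta> :: "real \<Rightarrow> real" where \<beta>: "smooth \<beta>" "\<And>t. \<bar>t - s\<bar> \<le> 1/2 \<Longrightarrow> \<beta> t = 1"
    "\<And>t. 2 * (1/2) \<le> \<bar>t - s\<bar> \<Longrightarrow> \<beta> t = 0"
    by (rule smooth_bump_exists[of "1/2" s]) auto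
  have id: "bij (\<lambda>x::real. x)" "linear (\<lambda>x::real. x)" by (rule bij_id[unfolded id_def], rule linear_id[unfolded id_def])
  have pi: "1 < pi" using pi_gt3 by simp
  have loc: "\<exists>f\<in>periodic. \<forall>t. \<bar>t - s\<bar> \<le> pi \<longrightarrow> f t = \<beta> t * g t" if "smooth g" for g
    by (rule loop_extension[OF id _ pi]) (use \<beta>(1,3) that in \<open>auto intro: smooth_mult\<close>)
  obtain B where B: "B \<in> periodic" "\<And>t. \<bar>t - s\<bar> \<le> pi \<Longrightarrow> B t = \<beta> t"
    using loc[OF smooth_const[of 1]] by auto
  have "\<exists>f\<in>periodic. \<forall>t. \<bar>t - s\<bar> \<le> pi \<longrightarrow> f t = \<beta> t * (u t \<bullet> b)" for b
    by (rule loc[OF smooth_linear[OF bounded_linear_inner_left loop_alg_smooth[OF u(1)]]])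
  then obtain f where f: "\<And>b. f b \<in> periodic" "\<And>b t. \<bar>t - s\<bar> \<le> pi \<Longrightarrow> f b t = \<beta> t * (u t \<bullet> b)"
    by metis
  have "\<exists>e\<in>loop_alg \<sigma>. \<forall>t. \<bar>t - s\<bar> \<le> 1 \<longrightarrow> e t = b" for b
    using loop_locally_constant[OF aut_bij[OF \<sigma>] aut_linear[OF \<sigma>], of 1 s b] by auto
  then obtain E where E: "\<And>b. E b \<in> loop_alg \<sigma>" "\<And>b t. \<bar>t - s\<bar> \<le> 1 \<Longrightarrow> E b t = b" by metis
  have "(\<lambda>t. B t *\<^sub>R u t) = (\<lambda>t. \<Sum>b\<in>Basis. f b t *\<^sub>R E b t)"
  proof (rule loop_alg_eqI[OF aut_bij[OF \<sigma>], where s = s])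
    fix t assume t: "\<bar>t - s\<bar> \<le> pi"
    \<comment> \<open>\<open>\<beta>\<close> vanishes from distance 1 on, which is where
      \<open>E b\<close> may cease to equal \<open>b\<close>.\<close>
    show "B t *\<^sub>R u t = (\<Sum>b\<in>Basis. f b t *\<^sub>R E b t)"
    proof (cases "\<bar>t - s\<bar> \<le> 1")
      case True
      have "(\<Sum>b\<in>Basis. f b t *\<^sub>R E b t) = (\<Sum>b\<in>Basis. \<beta> t *\<^sub>R (u t \<bullet> b) *\<^sub>R b)"
        using True t by (intro sum.cong refl) (simp add: f E)
      also have "\<dots> = \<beta> t *\<^sub>R u t" by (simp add: scaleR_sum_right[symmetric] euclidean_representation del: scaleR_scaleR)
      finally show ?thesis using t by (simp add: B)
    next
      case False
      then show ?thesis using t by (simp add: B f \<beta>(3))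
    qed
  qed (intro loop_sum[OF \<sigma>] loop_mult[OF \<sigma>] B f E u(1))+
  then have "\<rho> (\<lambda>t. B t *\<^sub>R u t) = \<rho> (\<lambda>t. \<Sum>b\<in>Basis. f b t *\<^sub>R E b t)"
    by (rule arg_cong)
  also have "\<dots> = (\<Sum>b\<in>Basis. \<rho> (\<lambda>t. f b t *\<^sub>R E b t))"
    by (intro \<rho>_sum loop_mult[OF \<sigma>] f E)
  also have "\<dots> = 0"
  proof (intro sum.neutral ballI)
    fix b
    have "f b \<in> \<I>" by (rule max[OF f(1)]) (simp add: f u)
    then show "\<rho> (\<lambda>t. f b t *\<^sub>R E b t) = 0" using E by (simp add: \<I>_def)
  qed
  finally have 1: "\<rho> (\<lambda>t. B t *\<^sub>R u t) = 0" .
  have C: "(\<lambda>t. 1 + (- 1) * B t) \<in> periodic" by (intro periodic_add periodic_mult periodic_const B)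
  have "B s = 1" by (simp add: B \<beta>)
  then have "(\<lambda>t. 1 + (- 1) * B t) \<in> \<I>" by (intro max[OF C]) simp
  then have 2: "\<rho> (\<lambda>t. (1 + (- 1) * B t) *\<^sub>R u t) = 0" using u(1) by (simp add: \<I>_def)
  have "\<rho> u = \<rho> (\<lambda>t. B t *\<^sub>R u t + (1 + (- 1) * B t) *\<^sub>R u t)"
    by (simp add: scaleR_left_diff_distrib)
  also have "\<dots> = 0" using \<rho>_add[OF loop_mult[OF \<sigma> B(1) u(1)] loop_mult[OF \<sigma> C u(1)]] 1 2 by simp
  finally show ?thesis .
qed

lemma evaluation_form:
  assumes max: "\<And>f. f \<in> periodic \<Longrightarrow> f s = 0 \<Longrightarrow> f \<in> \<I>"
  shows "\<exists>h\<in>Aut. \<forall>u\<in>loop_alg \<sigma>. \<rho> u = h (u s)"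
proof -
  obtain E where E: "\<And>x. E x \<in> loop_alg \<sigma>" "\<And>x. E x s = x"
    using loop_through[OF aut_bij[OF \<sigma>] aut_linear[OF \<sigma>]] by metis
  define h where "h x = \<rho> (E x)" for x
  have h: "\<rho> u = h (u s)" if "u \<in> loop_alg \<sigma>" for u
  proof -
    have "\<rho> (\<lambda>t. u t - E (u s) t) = 0"
    proof (rule evaluation_factors[where s = s])
      show "(\<lambda>t. u t - E (u s) t) \<in> loop_alg \<sigma>" by (rule loop_diff[OF that E(1)])
      show "u s - E (u s) s = 0" by (simp only: E(2) diff_self)
    qed (rule max)
    then show ?thesis by (simp add: \<rho>_diff that E h_def)
  qed
  have add: "h (x + y) = h x + h y" for x y
    using h[OF loop_add[OF \<sigma> E(1)[of x] E(1)[of y]]] \<rho>_add[OF E(1)[of x] E(1)[of y]] by (simp add: E h_def)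
  have scale: "h (c *\<^sub>R x) = c *\<^sub>R h x" for c x
    using h[OF loop_scaleR[OF \<sigma> E(1)[of x]], of c] \<rho>_scaleR[OF E(1)[of x], of c] by (simp add: E h_def)
  have lin: "linear h" by (rule linearI) (simp_all add: add scale)
  have "surj h" unfolding surj_def using \<rho>_surj h by metis
  then have "bij h" using linear_surjective_imp_injective[OF lin] by (simp add: bij_def)
  moreover have "h (J x) = J (h x)" if cplx for x
    using h[OF loop_J[OF \<sigma> that E(1)[of x]]] \<rho>_J[OF that E(1)[of x]] by (simp add: E h_def)
  moreover have "h (br x y) = br (h x) (h y)" for x y
    using h[OF loop_br[OF \<sigma> E(1)[of x] E(1)[of y]]] \<rho>_br[OF E(1)[of x] E(1)[of y]] by (simp add: E h_def)
  ultimately have "h \<in> Aut" using lin by (simp add: lie_aut_def flin_def)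
  with h show ?thesis by blast
qed

text \<open>The point is determined only modulo 2 pi. Every representative is recorded, so that a
  continuous choice can be made when the evaluation varies.\<close>

lemma evaluation_point: "\<exists>s. \<forall>k::int. \<exists>h\<in>Aut. \<forall>u\<in>loop_alg \<sigma>. \<rho> u = h (u (s + 2 * pi * of_int k))"
proof -
  obtain s where s: "\<And>f. f \<in> \<I> \<Longrightarrow> f s = 0" using \<I>_common_zero by blast
  have "\<exists>h\<in>Aut. \<forall>u\<in>loop_alg \<sigma>. \<rho> u = h (u (s + 2 * pi * of_int k))" for k :: int
    by (rule evaluation_form, rule \<I>_maximal[OF s]) (simp_all add: periodic_shift)
  then show ?thesis by blast
qed

end

section \<open>The continuous form of an isomorphism of loop algebras\<close>

context simple_lie_algebra
begin

text \<open>The points \<open>s t\<close> come without continuity. For periodic \<open>f\<close>,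
  however, \<open>f (s t)\<close> is a quotient of inner products of values of
  \<open>\<psi>\<close>, hence continuous; cosine and sine give a continuous curve on the unit
  circle, and its logarithm provides the lift \<open>\<mu>\<close>.\<close>

lemma loop_iso_form:
  assumes \<sigma>: "\<sigma> \<in> Aut" "\<sigma>' \<in> Aut" and iso: "loop_iso cplx J br \<sigma> \<sigma>' \<psi>"
  obtains \<mu> h where "continuous_on UNIV \<mu>" "0 \<le> \<mu> 0" "\<mu> 0 < 2 * pi" "\<And>t. h t \<in> Aut" "continuous_on UNIV (\<lambda>t. endo_of (h t))"
    "\<And>u t. u \<in> loop_alg \<sigma> \<Longrightarrow> \<psi> u t = h t (u (\<mu> t))"
proof -
  have bij: "bij_betw \<psi> (loop_alg \<sigma>) (loop_alg \<sigma>')" using iso by (simp add: loop_iso_def)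
  have surj: "\<exists>u\<in>loop_alg \<sigma>. \<psi> u t = x" for t x
    using loop_through[OF aut_bij[OF \<sigma>(2)] aut_linear[OF \<sigma>(2)], of t x] bij
    by (metis bij_betw_def imageE)
  have ev: "loop_evaluation cplx J br \<sigma> (\<lambda>u. \<psi> u t)" for t
    using iso \<sigma>(1) surj by unfold_locales (auto simp: loop_iso_def)
  obtain s where s: "\<And>t k. \<exists>h\<in>Aut. \<forall>u\<in>loop_alg \<sigma>. \<psi> u t = h (u (s t + 2 * pi * of_int (k::int)))"
    using loop_evaluation.evaluation_point[OF ev] by metis
  have cont: "isCont (\<lambda>t. f (s t)) t0" if f: "f \<in> periodic" for f t0
  proof -
    obtain x :: 'a where "x \<noteq> 0" using nontrivial by blast
    then obtain u where u: "u \<in> loop_alg \<sigma>" "\<psi> u t0 \<noteq> 0" using surj[of t0 x] by auto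
    let ?f = "\<lambda>t. f t *\<^sub>R u t"
    have fu: "?f \<in> loop_alg \<sigma>" by (rule loop_mult[OF \<sigma>(1) f u(1)])
    have eq: "\<psi> ?f t = f (s t) *\<^sub>R \<psi> u t" for t
    proof -
      obtain h where "h \<in> Aut" "\<forall>u\<in>loop_alg \<sigma>. \<psi> u t = h (u (s t))" using s[of t 0] by auto
      then show ?thesis using fu u by (simp add: linear_scale aut_linear)
    qed
    have ct: "isCont (\<psi> v) t0" if "v \<in> loop_alg \<sigma>" for v
      using bij that by (intro smooth_isCont loop_alg_smooth[of _ \<sigma>']) (auto simp: bij_betw_def)
    have "\<forall>\<^sub>F t in nhds t0. \<psi> u t \<noteq> 0"
      using eventually_nhds_conv_at[THEN iffD2] tendsto_imp_eventually_ne[OF ct[OF u(1), unfolded isCont_def] u(2)] u(2)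
      by blast
    then have "\<forall>\<^sub>F t in nhds t0. f (s t) = (\<psi> ?f t \<bullet> \<psi> u t) / (\<psi> u t \<bullet> \<psi> u t)"
      by eventually_elim (simp add: eq)
    moreover have "isCont (\<lambda>t. (\<psi> ?f t \<bullet> \<psi> u t) / (\<psi> u t \<bullet> \<psi> u t)) t0"
      using u(2) by (intro continuous_intros ct fu u(1)) simp
    ultimately show ?thesis using isCont_cong by fastforce
  qed
  have "cos \<in> periodic" "sin \<in> periodic" by (simp_all add: loop_alg_def smooth_cos smooth_sin)
  then have "continuous_on UNIV (\<lambda>t. Complex (cos (s t)) (sin (s t)))"
    by (intro continuous_at_imp_continuous_on ballI)
      (simp add: isCont_def tendsto_Complex cont[unfolded isCont_def])
  then obtain g where g: "continuous_on UNIV g" "\<And>t. Complex (cos (s t)) (sin (s t)) = exp (g t)"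
  proof (rule continuous_logarithm_on_contractible)
    fix t
    have "cmod (Complex (cos (s t)) (sin (s t))) = 1" by (simp add: cmod_def)
    then show "Complex (cos (s t)) (sin (s t)) \<noteq> 0" by force
  qed (auto intro: convex_imp_contractible)
  \<comment> \<open>Shifts the lift so that \<open>\<mu> 0\<close> lies in [0, 2 pi); for an
    intertwining isomorphism this leaves only the values 0 and pi.\<close>
  define l where "l = \<lfloor>Im (g 0) / (2 * pi)\<rfloor>"
  define \<mu> where "\<mu> t = Im (g t) - 2 * pi * of_int l" for t
  have \<mu>: "continuous_on UNIV \<mu>" unfolding \<mu>_def by (intro continuous_intros g)
  have "of_int l \<le> Im (g 0) / (2 * pi)" "Im (g 0) / (2 * pi) < of_int l + 1"
    by (simp_all add: l_def)
  then have \<mu>0: "0 \<le> \<mu> 0" "\<mu> 0 < 2 * pi" by (simp_all add: \<mu>_def field_simps)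
  have "\<exists>k::int. \<mu> t = s t + 2 * pi * of_int k" for t
  proof -
    have "cmod (Complex (cos (s t)) (sin (s t))) = 1" by (simp add: cmod_def)
    then have "Re (g t) = 0" unfolding g by (simp add: norm_exp_eq_Re)
    then have "sin (Im (g t)) = sin (s t) \<and> cos (Im (g t)) = cos (s t)"
      using g(2)[of t] by (simp add: complex_eq_iff Re_exp Im_exp)
    then obtain n :: int where "Im (g t) = s t + 2 * pi * of_int n"
      unfolding sin_cos_eq_iff by (auto simp: mult_ac)
    then have "\<mu> t = s t + 2 * pi * of_int (n - l)" by (simp add: \<mu>_def algebra_simps)
    then show ?thesis by blast
  qed
  then have "\<exists>h\<in>Aut. \<forall>u\<in>loop_alg \<sigma>. \<psi> u t = h (u (\<mu> t))" for t
    using s[of t] by metis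
  then obtain h where h: "\<And>t. h t \<in> Aut" "\<And>u t. u \<in> loop_alg \<sigma> \<Longrightarrow> \<psi> u t = h t (u (\<mu> t))" by metis
  \<comment> \<open>A loop that equals \<open>x\<close> near \<open>\<mu> t0\<close> makes
    \<open>h t x\<close> coincide near \<open>t0\<close> with the smooth curve
    \<open>\<psi> u\<close>.\<close>
  have conth: "isCont (\<lambda>t. h t x) t0" for x t0
  proof -
    obtain u where u: "u \<in> loop_alg \<sigma>" "\<And>r. \<bar>r - \<mu> t0\<bar> \<le> 1 \<Longrightarrow> u r = x"
      using loop_locally_constant[OF aut_bij[OF \<sigma>(1)] aut_linear[OF \<sigma>(1)], of 1 "\<mu> t0" x] by auto
    have "isCont \<mu> t0" using \<mu> by (simp add: continuous_on_eq_continuous_at)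
    then have "\<forall>\<^sub>F t in nhds t0. dist (\<mu> t) (\<mu> t0) < 1"
      using tendstoD[of \<mu> "\<mu> t0" "nhds t0" 1] by (simp add: isCont_def tendsto_at_iff_tendsto_nhds)
    then have "\<forall>\<^sub>F t in nhds t0. h t x = \<psi> u t"
      by eventually_elim (simp add: h(2)[OF u(1)] u(2) dist_real_def)
    moreover have "isCont (\<psi> u) t0"
      using bij u(1) by (intro smooth_isCont loop_alg_smooth[of _ \<sigma>']) (auto simp: bij_betw_def)
    ultimately show ?thesis using isCont_cong by fastforce
  qed
  have "isCont (\<lambda>t. endo_of (h t)) t0" for t0
    unfolding isCont_def
  proof (subst Lim_null, rule Lim_null_comparison)
    show "((\<lambda>t. \<Sum>b\<in>Basis. norm (h t b - h t0 b)) \<longlongrightarrow> 0) (at t0)"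
      using conth by (intro tendsto_null_sum tendsto_norm_zero) (simp add: isCont_def LIM_zero)
    show "\<forall>\<^sub>F t in at t0. norm (endo_of (h t) - endo_of (h t0)) \<le> (\<Sum>b\<in>Basis. norm (h t b - h t0 b))"
    proof (intro always_eventually allI norm_endo_bound sum_nonneg norm_ge_zero)
      fix t and x :: 'a
      let ?F = "endo_of (h t) - endo_of (h t0)"
      have F: "app ?F b = h t b - h t0 b" for b
        by (simp add: app.diff_left app_endo_of aut_linear h)
      have "app ?F x = app ?F (\<Sum>b\<in>Basis. (x \<bullet> b) *\<^sub>R b)" by (simp only: euclidean_representation)
      also have "\<dots> = (\<Sum>b\<in>Basis. (x \<bullet> b) *\<^sub>R (h t b - h t0 b))"
        by (simp only: app.sum_right app.scaleR_right F)
      also have "norm \<dots> \<le> (\<Sum>b\<in>Basis. norm (h t b - h t0 b) * norm x)"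
        by (intro sum_norm_le) (simp add: mult.commute mult_right_mono Basis_le_norm)
      finally show "norm (app ?F x) \<le> (\<Sum>b\<in>Basis. norm (h t b - h t0 b)) * norm x"
        by (simp add: sum_distrib_right)
    qed
  qed
  then have "continuous_on UNIV (\<lambda>t. endo_of (h t))" by (simp add: continuous_on_eq_continuous_at)
  from that[OF \<mu> \<mu>0 h(1) this h(2)] show ?thesis .
qed

end

section \<open>Gauge transformations\<close>

lemma smooth_linear_ode:
  fixes h B :: "real \<Rightarrow> 'b::real_normed_algebra_1"
  assumes B: "smooth B" and h: "\<And>t. (h has_vector_derivative B t * h t) (at t)"
  shows "smooth h"
proof -
  have "ndiff k h" for k
  proof (induction k)
    case (Suc k)
    have "ndiff k (\<lambda>t. B t * h t)"
      using B by (intro ndiff_bilinear[OF bounded_bilinear_mult] Suc) (simp add: smooth_iff_ndiff)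
    with h show ?case by (rule ndiff_SucI)
  qed simp
  then show ?thesis by (simp add: smooth_iff_ndiff)
qed

lemma has_vector_derivative_shift:
  fixes f :: "real \<Rightarrow> 'b::real_normed_vector"
  assumes "(f has_vector_derivative D) (at (t + c))"
  shows "((\<lambda>t. f (t + c)) has_vector_derivative D) (at t)"
proof -
  have "((\<lambda>t. t + c) has_vector_derivative 1) (at t)"
    unfolding has_real_derivative_iff_has_vector_derivative[symmetric]
    by (auto intro!: derivative_eq_intros)
  from vector_diff_chain_at[OF this assms] show ?thesis by (simp add: o_def)
qed

lemma has_vector_derivative_conj:
  fixes f :: "real \<Rightarrow> 'b::real_normed_algebra"
  assumes "(f has_vector_derivative D) (at t)"
  shows "((\<lambda>t. a * f t * b) has_vector_derivative a * D * b) (at t)"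
  by (rule bounded_linear.has_vector_derivative[OF bounded_linear_mult_left
    bounded_linear.has_vector_derivative[OF bounded_linear_mult_right assms]])

lemma derivative_twisted:
  fixes c :: "real \<Rightarrow> 'b::real_normed_algebra"
  assumes c: "\<And>t. (c has_vector_derivative c' t) (at t)" and tw: "\<And>t. c (t + p) = a * c t * b"
  shows "c' (t + p) = a * c' t * b"
proof -
  have "((\<lambda>t. c (t + p)) has_vector_derivative c' (t + p)) (at t)"
    by (rule has_vector_derivative_shift[OF c])
  moreover have "((\<lambda>t. c (t + p)) has_vector_derivative a * c' t * b) (at t)"
    unfolding tw by (rule has_vector_derivative_conj[OF c])
  ultimately show ?thesis by (rule vector_derivative_unique_at)
qed

lemma einv_mult:
  assumes "c \<in> aut_grp br S" "d \<in> aut_grp br S"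
  shows "einv (c * d) = einv d * einv c"
  by (rule einv_unique) (simp add: mult.assoc aut_grp_inverse[OF assms(1)] aut_grp_inverse[OF assms(2)])

lemma einv_einv: "c \<in> aut_grp br S \<Longrightarrow> einv (einv c) = c"
  by (rule einv_unique) (simp add: aut_grp_inverse)

context
  fixes br :: "'a::euclidean_space \<Rightarrow> 'a \<Rightarrow> 'a" and S :: "'a endo set" and p :: real
    and P P' :: "real \<Rightarrow> 'a endo" and s :: "'a endo" and m :: nat
  assumes bilin: "bounded_bilinear br"
    and P: "\<And>t. P t \<in> aut_grp br S" and smP: "smooth P"
    and P': "\<And>t. (P has_vector_derivative P' t) (at t)" and smP': "smooth P'"
    and s: "s \<in> aut_grp br S" and tw: "\<And>t. P (t + p) = s * P t * s"
    and m: "0 < m" and fin: "\<And>t. (P t * P (- t)) ^ m = 1"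
begin

text \<open>The square of the automorphism
  \<open>u \<mapsto> (\<lambda>t. app (P t) (u (- t)))\<close> leaves the parameter alone and acts
  by \<open>R t\<close>.\<close>

private definition R where "R t = P t * P (- t)"

private lemma R: "R t \<in> aut_grp br S"
  unfolding R_def by (intro aut_grp_mult P)

private lemma smR: "smooth R"
  unfolding R_def[abs_def] by (intro smooth_mult smP smooth_compose[OF smP] smooth_minus smooth_ident)

private lemma P_minus: "P (- (t + p)) = einv s * P (- t) * einv s"
proof -
  have "P (- t) = s * P (- (t + p)) * s" using tw[of "- (t + p)"] by simp
  then show ?thesis by (simp add: mult.assoc aut_grp_inverse[OF s])
qed

private lemma R_shift: "R (t + p) = s * R t * einv s"
  unfolding R_def P_minus tw by (simp add: mult.assoc aut_grp_inverse[OF s])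

private definition D where "D j t = vector_derivative (\<lambda>t. R t ^ j) (at t)"

private lemma D: "((\<lambda>t. R t ^ j) has_vector_derivative D j t) (at t)" and smD: "smooth (D j)"
proof -
  obtain f' where f': "\<And>t. ((\<lambda>t. R t ^ j) has_vector_derivative f' t) (at t)" "smooth f'"
    using smoothE[OF smooth_power[OF smR]] by blast
  have "D j = f'" unfolding D_def using vector_derivative_at[OF f'(1)] by (simp add: fun_eq_iff)
  with f' show "((\<lambda>t. R t ^ j) has_vector_derivative D j t) (at t)" "smooth (D j)" by simp_all
qed

private definition A where "A t = (1 / real m) *\<^sub>R (\<Sum>j<m. D j t * einv (R t ^ j))"

private definition W where "W t = P' t * einv (P t)"

text \<open>A coefficient \<open>A\<close> stands for the equation u' = A u. If \<open>u\<close>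
  solves it, then \<open>app (P t) (u (- t))\<close> solves the equation with coefficient
  \<open>W t - P t * A (- t) * einv (P t)\<close>; \<open>B\<close> is the mean of the two.\<close>

private definition B where "B t = (1/2) *\<^sub>R (A t + W t - P t * A (- t) * einv (P t))"

private lemma A_der: "A t \<in> derivations br S"
  unfolding A_def
  by (intro derivations_scaleR[OF bilin] derivations_sum[OF bilin]
    log_derivative_in_derivations[OF bilin aut_grp_power[OF R] D])

private lemma W_der: "W t \<in> derivations br S"
  unfolding W_def by (rule log_derivative_in_derivations[OF bilin P P'])

private lemma B_der: "B t \<in> derivations br S"
  unfolding B_def
  by (intro derivations_scaleR[OF bilin] derivations_diff[OF bilin] derivations_add[OF bilin]
    derivations_conj[OF bilin _ P] A_der W_der)

private lemma smA: "smooth A"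
  unfolding A_def[abs_def]
  by (intro smooth_scaleR smooth_const smooth_sum smooth_mult smD
    smooth_einv[OF smooth_power[OF smR] aut_grp_power[OF R]])

private lemma smB: "smooth B"
  unfolding B_def[abs_def] W_def
  by (intro smooth_scaleR smooth_const smooth_diff smooth_add smooth_mult smA smP smP'
    smooth_einv[OF smP P] smooth_compose[OF smA] smooth_minus smooth_ident)

text \<open>\<open>A\<close> is the average of the pullbacks of the trivial connection under the powers of the gauge
  transformation \<open>R\<close> of order \<open>m\<close>, hence invariant under \<open>R\<close>.\<close>
private lemma A_invariant: "R t * A t * einv (R t) = A t - D 1 t * einv (R t)"
proof -
  have Dsuc: "D (Suc j) t = R t * D j t + D 1 t * R t ^ j" for j
  proof -
    have "((\<lambda>t. R t * R t ^ j) has_vector_derivative R t * D j t + D 1 t * R t ^ j) (at t)"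
      using bounded_bilinear.has_vector_derivative[OF bounded_bilinear_mult D[of 1 t] D[of j t]] by simp
    then have "((\<lambda>t. R t ^ Suc j) has_vector_derivative R t * D j t + D 1 t * R t ^ j) (at t)" by simp
    with D show ?thesis by (rule vector_derivative_unique_at)
  qed
  have step: "R t * (D j t * einv (R t ^ j)) * einv (R t) + D 1 t * einv (R t) =
      D (Suc j) t * einv (R t ^ Suc j)" for j
  proof -
    have e: "einv (R t ^ Suc j) = einv (R t ^ j) * einv (R t)"
      using einv_mult[OF R aut_grp_power[OF R]] by simp
    have "R t ^ j * (einv (R t ^ j) * X) = X" for X
      by (rule aut_grp_inverse(5)[OF aut_grp_power[OF R]])
    then show ?thesis by (simp only: Dsuc e distrib_right mult.assoc)
  qed
  have const: "D j t = 0" if "\<And>t. R t ^ j = 1" for j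
    using vector_derivative_unique_at[OF D[of j t], of 0] that by simp
  have "(\<Sum>j<m. R t * (D j t * einv (R t ^ j)) * einv (R t) + D 1 t * einv (R t)) =
      (\<Sum>j<m. D (Suc j) t * einv (R t ^ Suc j))"
    by (simp only: step)
  also have "\<dots> = (\<Sum>j<Suc m. D j t * einv (R t ^ j)) - D 0 t * einv (R t ^ 0)"
    by (simp only: sum.lessThan_Suc_shift) simp
  also have "\<dots> = (\<Sum>j<m. D j t * einv (R t ^ j))"
    using const[of 0] const[of m] fin by (simp add: R_def)
  finally have *: "R t * (\<Sum>j<m. D j t * einv (R t ^ j)) * einv (R t) + real m *\<^sub>R (D 1 t * einv (R t)) =
      (\<Sum>j<m. D j t * einv (R t ^ j))"
    by (simp add: sum.distrib sum_distrib_left sum_distrib_right scaleR_conv_of_real)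
  have "A t = (1 / real m) *\<^sub>R (R t * (\<Sum>j<m. D j t * einv (R t ^ j)) * einv (R t)
      + real m *\<^sub>R (D 1 t * einv (R t)))"
    unfolding * A_def ..
  also have "\<dots> = R t * A t * einv (R t) + D 1 t * einv (R t)"
    using m by (simp add: A_def scaleR_add_right)
  finally have "R t * A t * einv (R t) + D 1 t * einv (R t) = A t" by (rule sym)
  then show ?thesis by (rule eq_diff_eq[THEN iffD2])
qed

private lemma D1: "D 1 t * einv (R t) = W t - P t * W (- t) * einv (P t)"
proof -
  have "((\<lambda>t. P (- t)) has_vector_derivative - P' (- t)) (at t)"
    by (rule has_vector_derivative_reflect[OF P'])
  from bounded_bilinear.has_vector_derivative[OF bounded_bilinear_mult P' this]
  have "((\<lambda>t. R t ^ 1) has_vector_derivative P t * - P' (- t) + P' t * P (- t)) (at t)"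
    by (simp add: R_def[abs_def])
  from vector_derivative_unique_at[OF D this] have "D 1 t = P' t * P (- t) - P t * P' (- t)" by simp
  moreover have "einv (R t) = einv (P (- t)) * einv (P t)"
    unfolding R_def by (rule einv_mult[OF P P])
  ultimately have "D 1 t * einv (R t) =
      (P' t * P (- t) - P t * P' (- t)) * (einv (P (- t)) * einv (P t))" by (simp only:)
  then show ?thesis by (simp add: W_def algebra_simps aut_grp_inverse[OF P])
qed

text \<open>Transforming twice by the reflection is the gauge transformation by \<open>R\<close>,
  which fixes \<open>A\<close>; so the reflection exchanges the two coefficients averaged in
  \<open>B\<close>.\<close>

private lemma B_invariant: "B t = W t - P t * B (- t) * einv (P t)"
proof -
  have "P t * (P (- t) * A t * einv (P (- t))) * einv (P t) = R t * A t * einv (R t)"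
    unfolding R_def einv_mult[OF P P] by (simp add: mult.assoc)
  also have "\<dots> = A t - W t + P t * W (- t) * einv (P t)" unfolding A_invariant D1 by simp
  finally have "2 *\<^sub>R (W t - P t * B (- t) * einv (P t)) = 2 *\<^sub>R B t"
    unfolding B_def by (simp add: algebra_simps scaleR_2)
  then show ?thesis by simp
qed

private lemma A_shift: "A (t + p) = s * A t * einv s"
proof -
  have pow: "R (t + p) ^ j = s * R t ^ j * einv s" for j t
    by (induction j) (simp_all add: R_shift mult.assoc aut_grp_inverse[OF s])
  have "D j (t + p) = s * D j t * einv s" for j
    by (rule derivative_twisted[OF D pow])
  moreover have "einv (R (t + p) ^ j) = s * einv (R t ^ j) * einv s" for j
    unfolding pow by (rule einv_unique)
      (simp add: mult.assoc aut_grp_inverse[OF s] aut_grp_inverse[OF aut_grp_power[OF R]])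
  ultimately show ?thesis
    by (simp add: A_def mult.assoc aut_grp_inverse[OF s] sum_distrib_left sum_distrib_right)
qed

private lemma B_shift: "B (t + p) = s * B t * einv s"
proof -
  have einvP: "einv (P (t + p)) = einv s * einv (P t) * einv s"
    unfolding tw by (rule einv_unique) (simp add: mult.assoc aut_grp_inverse[OF s] aut_grp_inverse[OF P])
  have "W (t + p) = s * W t * einv s"
    unfolding W_def einvP derivative_twisted[OF P' tw] by (simp add: mult.assoc aut_grp_inverse[OF s])
  moreover have "A (- (t + p)) = einv s * A (- t) * s"
  proof -
    have "A (- t) = s * A (- (t + p)) * einv s" using A_shift[of "- (t + p)"] by simp
    then show ?thesis by (simp add: mult.assoc aut_grp_inverse[OF s])
  qed
  then have "P (t + p) * A (- (t + p)) * einv (P (t + p)) = s * (P t * A (- t) * einv (P t)) * einv s"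
    unfolding einvP by (simp add: tw mult.assoc aut_grp_inverse[OF s])
  ultimately show ?thesis
    by (simp only: B_def A_shift) (simp add: algebra_simps)
qed

text \<open>\<open>h\<close> is the transport of \<open>B\<close>. By \<open>B_invariant\<close> and
  \<open>B_shift\<close> the curves \<open>P t * h (- t)\<close> and
  \<open>einv s * h (t + p)\<close> satisfy the same equation as \<open>h\<close>, so they are
  \<open>h t\<close> times constants, read off at 0.\<close>

lemma gauge_normal_form:
  obtains h where "smooth h" "\<And>t. h t \<in> aut_grp br S" "h 0 = 1"
    "\<And>t. P t * h (- t) = h t * P 0" "\<And>t. h (t + p) = s * h t * (einv s * h p)"
proof -
  obtain h where h: "h 0 = 1" "\<And>t. (h has_vector_derivative B t * h t) (at t)" "\<And>t. \<exists>d. h t * d = 1"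
    "\<And>z t. (\<And>t. (z has_vector_derivative app (B t) (z t)) (at t)) \<Longrightarrow> z t = app (h t) (z 0)"
    using evolution_exists[OF smooth_continuous[OF smB]] by blast
  have hG: "h t \<in> aut_grp br S" for t
    by (rule evolution_in_aut_grp[OF bilin h B_der])
  have uniq: "k t = h t * k 0" if k: "\<And>t. (k has_vector_derivative B t * k t) (at t)" for k t
  proof (rule endo_eqI)
    fix x
    have "((\<lambda>t. app (k t) x) has_vector_derivative app (B t) (app (k t) x)) (at t)" for t
      using bounded_linear.has_vector_derivative[OF app.bounded_linear_left k, of x t] by simp
    from h(4)[OF this, of t] show "app (k t) x = app (h t * k 0) x" by simp
  qed
  show ?thesis
  proof (rule that[OF smooth_linear_ode[OF smB h(2)] hG h(1)])
    fix t
    have "((\<lambda>t. P t * h (- t)) has_vector_derivative B t * (P t * h (- t))) (at t)" for t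
    proof -
      have "((\<lambda>t. h (- t)) has_vector_derivative - (B (- t) * h (- t))) (at t)"
        by (rule has_vector_derivative_reflect[OF h(2)])
      from bounded_bilinear.has_vector_derivative[OF bounded_bilinear_mult P' this]
      have "((\<lambda>t. P t * h (- t)) has_vector_derivative P' t * h (- t) - P t * (B (- t) * h (- t))) (at t)"
        by simp
      moreover have "B t * (P t * h (- t)) = P' t * h (- t) - P t * (B (- t) * h (- t))"
        by (subst B_invariant) (simp add: W_def algebra_simps aut_grp_inverse[OF P])
      ultimately show ?thesis by simp
    qed
    from uniq[OF this, of t] show "P t * h (- t) = h t * P 0" by (simp add: h(1))
    have "((\<lambda>t. einv s * h (t + p)) has_vector_derivative B t * (einv s * h (t + p))) (at t)" for t
    proof -
      have "((\<lambda>t. einv s * h (t + p)) has_vector_derivative einv s * (B (t + p) * h (t + p))) (at t)"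
        by (rule bounded_linear.has_vector_derivative[OF bounded_linear_mult_right
          has_vector_derivative_shift[OF h(2)]])
      then show ?thesis unfolding B_shift by (simp add: mult.assoc aut_grp_inverse[OF s])
    qed
    from uniq[OF this, of t] have "s * (einv s * h (t + p)) = s * (h t * (einv s * h p))" by simp
    then show "h (t + p) = s * h t * (einv s * h p)"
      by (simp add: mult.assoc aut_grp_inverse[OF s])
  qed
qed

end

section \<open>Quasiconjugacy\<close>

context simple_lie_algebra
begin

definition commutant :: "'a endo set" where
  "commutant = (if cplx then {endo_of J} else {})"

abbreviation (input) "G \<equiv> aut_grp br commutant"

lemma endo_of_comp: "linear f \<Longrightarrow> linear g \<Longrightarrow> endo_of (f \<circ> g) = endo_of f * endo_of g"
  by (rule endo_eqI) (simp add: app_endo_of linear_compose)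

lemma endo_of_id: "endo_of id = (1 :: 'a endo)"
  by (rule endo_eqI) (simp add: app_endo_of linear_id)

lemma linear_inv_aut: "f \<in> Aut \<Longrightarrow> linear (inv f)"
  by (metis aut_bij aut_linear bij_betw_def inj_linear_imp_inv_linear)

lemma endo_of_aut:
  assumes f: "f \<in> Aut"
  shows "endo_of f \<in> G" "app (endo_of f) = f" "endo_of (inv f) = einv (endo_of f)"
proof -
  have app: "app (endo_of f) = f" by (rule ext) (rule app_endo_of[OF aut_linear[OF f]])
  then show "app (endo_of f) = f" .
  have "f \<circ> inv f = id" using bij_is_surj[OF aut_bij[OF f]] surj_iff[of f] by blast
  then have inv: "endo_of f * endo_of (inv f) = 1"
    using endo_of_comp[OF aut_linear[OF f] linear_inv_aut[OF f]] by (simp add: endo_of_id)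
  then show "endo_of (inv f) = einv (endo_of f)" by (rule einv_unique[symmetric])
  have "endo_of f * X = X * endo_of f" if "X \<in> commutant" for X
    using that by (intro endo_eqI) (auto simp: commutant_def app app_endo_of J_linear aut_J[OF f] split: if_splits)
  with inv show "endo_of f \<in> G" by (auto simp: aut_grp_def app aut_br[OF f])
qed

lemma app_aut:
  assumes c: "c \<in> G"
  shows "app c \<in> Aut"
proof -
  have "bij (app c)"
    by (rule o_bij[of "app (einv c)"]) (simp_all add: fun_eq_iff aut_grp_inverse[OF c])
  moreover have "app c (J x) = J (app c x)" if cplx for x
  proof -
    have "endo_of J \<in> commutant" using that unfolding commutant_def by simp
    from aut_grp_comm[OF c this] have "app (c * endo_of J) x = app (endo_of J * c) x" by simp
    then show ?thesis using J_linear[OF that] by (simp add: app_endo_of)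
  qed
  ultimately show ?thesis by (simp add: lie_aut_def flin_def linear_app aut_grp_br[OF c])
qed

lemma inv_app: "c \<in> G \<Longrightarrow> inv (app c) = app (einv c)"
  using endo_of_aut(3)[OF app_aut] app_endo_of[OF linear_inv_aut[OF app_aut]] by (metis endo_of_app ext)

lemma loop_isoI:
  assumes h: "\<And>t. h t \<in> Aut" and \<psi>: "\<And>u t. \<psi> u t = h t (u (\<nu> t))"
    and "\<And>u. u \<in> loop_alg \<sigma> \<Longrightarrow> \<psi> u \<in> loop_alg \<sigma>'" "\<And>v. v \<in> loop_alg \<sigma>' \<Longrightarrow> \<xi> v \<in> loop_alg \<sigma>"
    and "\<And>u. u \<in> loop_alg \<sigma> \<Longrightarrow> \<xi> (\<psi> u) = u" "\<And>v. v \<in> loop_alg \<sigma>' \<Longrightarrow> \<psi> (\<xi> v) = v"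
  shows "loop_iso cplx J br \<sigma> \<sigma>' \<psi>"
  unfolding loop_iso_def
proof (intro conjI ballI allI impI)
  show "bij_betw \<psi> (loop_alg \<sigma>) (loop_alg \<sigma>')"
    by (rule bij_betw_byWitness[of _ \<xi>]) (use assms(3-6) in auto)
qed (auto simp: fun_eq_iff \<psi> linear_add[OF aut_linear[OF h]] linear_scale[OF aut_linear[OF h]]
  aut_J[OF h] aut_br[OF h])

lemma smooth_app: "smooth c \<Longrightarrow> smooth u \<Longrightarrow> smooth (\<lambda>t. app (c t) (u t))"
  by (rule smooth_bilinear[OF bounded_bilinear_app])

lemma loop_iso_orientation_preserving:
  assumes h: "smooth h" "\<And>t. h t \<in> G" and \<nu>: "smooth \<nu>" and \<kappa>: "smooth \<kappa>"
    and inv: "\<And>t. \<nu> (\<kappa> t) = t" "\<And>t. \<kappa> (\<nu> t) = t" and sh: "\<And>t. \<nu> (t + 2 * pi) = \<nu> t + 2 * pi"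
    and s: "s \<in> G" "s' \<in> G" and tw: "\<And>t. h (t + 2 * pi) * s = s' * h t"
  shows "loop_iso cplx J br (app s) (app s') (\<lambda>u t. app (h t) (u (\<nu> t)))"
proof (rule loop_isoI[where \<xi> = "\<lambda>v t. app (einv (h (\<kappa> t))) (v (\<kappa> t))"])
  fix u assume u: "u \<in> loop_alg (app s)"
  show "(\<lambda>t. app (h t) (u (\<nu> t))) \<in> loop_alg (app s')"
  proof (rule loop_algI)
    fix t show "app (h (t + 2 * pi)) (u (\<nu> (t + 2 * pi))) = app s' (app (h t) (u (\<nu> t)))"
      using tw[of t] loop_alg_shift[OF u] by (simp add: sh) (metis app_mult)
  qed (intro smooth_app h smooth_compose[OF loop_alg_smooth[OF u]] \<nu>)
next
  fix v assume v: "v \<in> loop_alg (app s')"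
  show "(\<lambda>t. app (einv (h (\<kappa> t))) (v (\<kappa> t))) \<in> loop_alg (app s)"
  proof (rule loop_algI)
    fix t
    have k: "\<kappa> (t + 2 * pi) = \<kappa> t + 2 * pi" using sh[of "\<kappa> t"] inv by metis
    have "einv (h (\<kappa> t + 2 * pi)) * (h (\<kappa> t + 2 * pi) * s) * einv (h (\<kappa> t)) =
      einv (h (\<kappa> t + 2 * pi)) * (s' * h (\<kappa> t)) * einv (h (\<kappa> t))" by (simp only: tw)
    then have "s * einv (h (\<kappa> t)) = einv (h (\<kappa> t + 2 * pi)) * s'"
      by (simp add: mult.assoc aut_grp_inverse[OF h(2)])
    then show "app (einv (h (\<kappa> (t + 2 * pi)))) (v (\<kappa> (t + 2 * pi))) =
        app s (app (einv (h (\<kappa> t))) (v (\<kappa> t)))"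
      using loop_alg_shift[OF v] by (simp add: k) (metis app_mult)
  qed (intro smooth_app smooth_compose[OF smooth_einv[OF h]] smooth_compose[OF loop_alg_smooth[OF v]] \<kappa>)
qed (auto simp: inv aut_grp_inverse[OF h(2)] intro: app_aut h)

lemma loop_iso_inverse:
  assumes \<sigma>: "\<sigma> \<in> Aut" "\<sigma>' \<in> Aut" and iso: "loop_iso cplx J br \<sigma> \<sigma>' \<psi>"
  shows "loop_iso cplx J br \<sigma>' \<sigma> (inv_into (loop_alg \<sigma>) \<psi>)"
proof -
  let ?\<xi> = "inv_into (loop_alg \<sigma>) \<psi>"
  note iso = iso[unfolded loop_iso_def]
  have bij: "bij_betw \<psi> (loop_alg \<sigma>) (loop_alg \<sigma>')" using iso by blast
  have inj: "inj_on \<psi> (loop_alg \<sigma>)" using bij by (simp add: bij_betw_def)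
  have \<xi>: "?\<xi> v \<in> loop_alg \<sigma>" "\<psi> (?\<xi> v) = v" if "v \<in> loop_alg \<sigma>'" for v
    using bij that by (auto simp: bij_betw_def inv_into_into f_inv_into_f)
  have eq: "?\<xi> v = w" if "w \<in> loop_alg \<sigma>" "\<psi> w = v" for v w
    using inv_into_f_f[OF inj that(1)] that(2) by simp
  show ?thesis unfolding loop_iso_def
  proof (intro conjI ballI allI impI)
    show "bij_betw ?\<xi> (loop_alg \<sigma>') (loop_alg \<sigma>)" by (rule bij_betw_inv_into[OF bij])
    fix u assume u: "u \<in> loop_alg \<sigma>'"
    show "?\<xi> (\<lambda>t. c *\<^sub>R u t) = (\<lambda>t. c *\<^sub>R ?\<xi> u t)" for c
      using iso \<xi>[OF u] by (intro eq loop_scaleR \<sigma>) auto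
    show "?\<xi> (\<lambda>t. J (u t)) = (\<lambda>t. J (?\<xi> u t))" if cplx
      using iso \<xi>[OF u] that by (intro eq loop_J \<sigma>) auto
    fix v assume v: "v \<in> loop_alg \<sigma>'"
    show "?\<xi> (\<lambda>t. u t + v t) = (\<lambda>t. ?\<xi> u t + ?\<xi> v t)"
      using iso \<xi>[OF u] \<xi>[OF v] by (intro eq loop_add \<sigma>) auto
    show "?\<xi> (\<lambda>t. br (u t) (v t)) = (\<lambda>t. br (?\<xi> u t) (?\<xi> v t))"
      using iso \<xi>[OF u] \<xi>[OF v] by (intro eq loop_br \<sigma>) auto
  qed
qed

lemma loop_iso_comp:
  assumes 1: "loop_iso cplx J br \<sigma>1 \<sigma>2 \<psi>1" and 2: "loop_iso cplx J br \<sigma>2 \<sigma>3 \<psi>2"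
  shows "loop_iso cplx J br \<sigma>1 \<sigma>3 (\<psi>2 \<circ> \<psi>1)"
proof -
  note iso = 1[unfolded loop_iso_def] 2[unfolded loop_iso_def]
  have "\<psi>1 u \<in> loop_alg \<sigma>2" if "u \<in> loop_alg \<sigma>1" for u
    using iso(1) that by (auto simp: bij_betw_def)
  moreover have "bij_betw (\<psi>2 \<circ> \<psi>1) (loop_alg \<sigma>1) (loop_alg \<sigma>3)"
    by (rule bij_betw_trans) (use iso in blast)+
  ultimately show ?thesis using iso unfolding loop_iso_def by auto
qed

lemma loop_iso_in: "loop_iso cplx J br \<sigma> \<sigma>' \<psi> \<Longrightarrow> u \<in> loop_alg \<sigma> \<Longrightarrow> \<psi> u \<in> loop_alg \<sigma>'"
  by (auto simp: loop_iso_def bij_betw_def)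

lemma quasiconj_trans:
  "quasiconj cplx J br x y \<Longrightarrow> quasiconj cplx J br y z \<Longrightarrow> quasiconj cplx J br x z"
proof -
  assume "quasiconj cplx J br x y" "quasiconj cplx J br y z"
  then obtain \<psi> \<xi> where \<psi>: "loop_iso cplx J br (fst x) (fst y) \<psi>"
      "\<forall>u\<in>loop_alg (fst x). snd y (\<psi> u) = \<psi> (snd x u)"
    and \<xi>: "loop_iso cplx J br (fst y) (fst z) \<xi>" "\<forall>u\<in>loop_alg (fst y). snd z (\<xi> u) = \<xi> (snd y u)"
    by (auto simp: quasiconj_def)
  then show ?thesis unfolding quasiconj_def
    by (intro exI[of _ "\<xi> \<circ> \<psi>"]) (auto intro: loop_iso_comp simp: loop_iso_in)
qed

lemma quasiconj_sym:
  assumes \<sigma>: "fst x \<in> Aut" "fst y \<in> Aut"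
    and stable: "\<And>u. u \<in> loop_alg (fst x) \<Longrightarrow> snd x u \<in> loop_alg (fst x)"
    and q: "quasiconj cplx J br x y"
  shows "quasiconj cplx J br y x"
proof -
  obtain \<psi> where \<psi>: "loop_iso cplx J br (fst x) (fst y) \<psi>"
    "\<forall>u\<in>loop_alg (fst x). snd y (\<psi> u) = \<psi> (snd x u)" using q by (auto simp: quasiconj_def)
  let ?\<xi> = "inv_into (loop_alg (fst x)) \<psi>"
  have bij: "bij_betw \<psi> (loop_alg (fst x)) (loop_alg (fst y))" using \<psi>(1) by (simp add: loop_iso_def)
  have "snd x (?\<xi> v) = ?\<xi> (snd y v)" if v: "v \<in> loop_alg (fst y)" for v
  proof -
    have w: "?\<xi> v \<in> loop_alg (fst x)" "\<psi> (?\<xi> v) = v"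
      using bij v by (auto simp: bij_betw_def inv_into_into f_inv_into_f)
    have "?\<xi> (snd y v) = ?\<xi> (\<psi> (snd x (?\<xi> v)))" using \<psi>(2) w by auto
    also have "\<dots> = snd x (?\<xi> v)"
      using bij stable[OF w(1)] by (intro inv_into_f_f) (auto simp: bij_betw_def)
    finally show ?thesis ..
  qed
  then show ?thesis using loop_iso_inverse[OF \<sigma> \<psi>(1)] by (auto simp: quasiconj_def)
qed

lemma quasiconj_refl: "fst x \<in> Aut \<Longrightarrow> quasiconj cplx J br x x"
  unfolding quasiconj_def by (intro exI[of _ id]) (auto simp: loop_iso_def)

end

section \<open>Pairs of automorphisms\<close>

text \<open>Turns pointwise congruences modulo 2 pi into an equation with a single integer.\<close>

lemma continuous_int_multiple_const:
  fixes f :: "real \<Rightarrow> real"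
  assumes f: "continuous_on UNIV f" and int: "\<And>t. \<exists>k::int. f t = 2 * pi * of_int k"
  shows "\<exists>k::int. \<forall>t. f t = 2 * pi * of_int k"
proof -
  have "f constant_on UNIV"
  proof (rule continuous_discrete_range_constant[OF connected_UNIV f])
    fix x
    have "2 * pi \<le> norm (f y - f x)" if ne: "f y \<noteq> f x" for y
    proof -
      obtain k l :: int where kl: "f y = 2 * pi * of_int k" "f x = 2 * pi * of_int l" using int by metis
      then have "1 \<le> \<bar>k - l\<bar>" using ne by auto
      then have "2 * pi * 1 \<le> 2 * pi * of_int \<bar>k - l\<bar>" by (intro mult_left_mono) (simp_all del: of_int_abs)
      also have "\<dots> = norm (f y - f x)"
        by (simp add: kl right_diff_distrib[symmetric] abs_mult)
      finally show ?thesis by simp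
    qed
    then show "\<exists>e>0. \<forall>y. y \<in> UNIV \<and> f y \<noteq> f x \<longrightarrow> e \<le> norm (f y - f x)"
      by (intro exI[of _ "2 * pi"]) simp
  qed
  then obtain c where "\<And>t. f t = c" by (auto simp: constant_on_def)
  with int show ?thesis by metis
qed

context simple_lie_algebra
begin

lemma app_eq_iff: "app A = app B \<longleftrightarrow> A = B"
  by (metis endo_of_app)

lemma app_funpow: "app A ^^ n = app (A ^ n)"
  by (induction n) (auto simp: fun_eq_iff)

lemma has_order_on_app:
  "has_order_on UNIV (app A) n \<longleftrightarrow> 0 < n \<and> A ^ n = 1 \<and> (\<forall>m. 0 < m \<and> m < n \<longrightarrow> A ^ m \<noteq> 1)"
proof -
  have "(\<forall>u\<in>UNIV. (app A ^^ m) u = u) \<longleftrightarrow> A ^ m = 1" for m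
    using app_eq_iff[of "A ^ m" 1] by (auto simp: app_funpow fun_eq_iff)
  then show ?thesis by (simp add: has_order_on_def)
qed

lemma app_comp: "app A \<circ> app B = app (A * B)"
  by (simp add: fun_eq_iff)

lemma explicit_aut_app:
  "B \<in> G \<Longrightarrow> explicit_aut (app A, app B) = (app (einv B * A), \<lambda>u t. app A (u (- t)))"
  by (simp add: explicit_aut_def inv_app app_comp)

lemma Jpairs_app:
  "(app A, app B) \<in> Jpairs cplx J br q \<longleftrightarrow> A \<in> G \<and> B \<in> G \<and> A * A = B * B \<and>
    has_order_on UNIV (app (A * A)) (q div 2)"
  using app_aut endo_of_aut(1)[of "app A"] endo_of_aut(1)[of "app B"]
  by (auto simp: Jpairs_def app_comp app_eq_iff)

lemma aut_pairE:
  assumes "fst p \<in> Aut" "snd p \<in> Aut"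
  obtains A B where "p = (app A, app B)" "A \<in> G" "B \<in> G"
  using assms that[of "endo_of (fst p)" "endo_of (snd p)"] endo_of_aut by (metis prod.collapse)

lemma JpairsE:
  assumes "p \<in> Jpairs cplx J br q"
  obtains A B where "p = (app A, app B)" "A \<in> G" "B \<in> G" "A * A = B * B"
    "has_order_on UNIV (app (A * A)) (q div 2)"
proof -
  have "fst p \<in> Aut" "snd p \<in> Aut" using assms by (auto simp: Jpairs_def)
  then obtain A B where "p = (app A, app B)" by (rule aut_pairE)
  with assms that show ?thesis by (auto simp: Jpairs_app)
qed

text \<open>\<open>s\<close> is the twist of the explicit automorphism. The reflection inverts it,
  \<open>A * s = einv s * A\<close>, and \<open>B = A * einv s\<close> is the operator by which the
  automorphism acts around pi.\<close>

lemma pair_relations: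
  assumes A: "A \<in> G" and B: "B \<in> G" and AB: "A * A = B * B"
  defines "s \<equiv> einv B * A"
  shows "s \<in> G" "s * A = B" "A * einv s = B" "s * (A * s) = A" "A * s = einv s * A" "A * einv s = s * A"
    "B * s = A" "s * (A * (s * X)) = A * X"
proof -
  note iA = aut_grp_inverse[OF A] and iB = aut_grp_inverse[OF B]
  show s: "s \<in> G" unfolding s_def by (intro aut_grp_mult aut_grp_einv A B)
  note is0 = aut_grp_inverse[OF s]
  show sA: "s * A = B" unfolding s_def by (simp add: mult.assoc AB iB)
  show Bs: "B * s = A" unfolding s_def by (simp add: iB)
  show "s * (A * s) = A" using sA Bs by (simp add: mult.assoc[symmetric])
  then show "s * (A * (s * X)) = A * X" by (metis mult.assoc)
  show "A * einv s = B" using Bs is0 by (metis mult.assoc mult.right_neutral)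
  then show "A * einv s = s * A" using sA by simp
  have "einv s * A = einv s * (s * (A * s))" using \<open>s * (A * s) = A\<close> by simp
  then show "A * s = einv s * A" by (simp add: is0)
qed

lemma loop_alg_back:
  assumes "s \<in> G" "u \<in> loop_alg (app s)"
  shows "u (t - 2 * pi) = app (einv s) (u t)"
  using loop_alg_shift[OF assms(2), of "t - 2 * pi"] by (simp add: aut_grp_inverse[OF assms(1)])

lemma explicit_iso:
  assumes A: "A \<in> G" and B: "B \<in> G" and AB: "A * A = B * B"
  defines "s \<equiv> einv B * A"
  shows "loop_iso cplx J br (app s) (app s) (\<lambda>u t. app A (u (- t)))"
proof (rule loop_isoI[where \<xi> = "\<lambda>v t. app (einv A) (v (- t))"])
  note rel = pair_relations[OF A B AB, folded s_def]
  note iA = aut_grp_inverse[OF A] and is0 = aut_grp_inverse[OF rel(1)]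
  fix u assume u: "u \<in> loop_alg (app s)"
  have m: "u (- (t + 2 * pi)) = app (einv s) (u (- t))" for t
    using loop_alg_back[OF rel(1) u, of "- t"] by simp
  show "(\<lambda>t. app A (u (- t))) \<in> loop_alg (app s)"
  proof (rule loop_algI)
    fix t show "app A (u (- (t + 2 * pi))) = app s (app A (u (- t)))"
      unfolding m app_mult[symmetric] rel ..
  qed (intro smooth_app smooth_const smooth_compose[OF loop_alg_smooth[OF u]] smooth_minus smooth_ident)
  show "(\<lambda>t. app (einv A) (u (- t))) \<in> loop_alg (app s)"
  proof (rule loop_algI)
    have "einv A * einv s = einv A * einv s * (A * einv A)" by (simp add: iA)
    also have "\<dots> = einv A * (einv s * A) * einv A" by (simp add: mult.assoc)
    also have "\<dots> = einv A * (A * s) * einv A" by (simp only: rel(5))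
    also have "\<dots> = s * einv A" by (simp add: iA mult.assoc[symmetric])
    finally have "einv A * einv s = s * einv A" .
    then show "app (einv A) (u (- (t + 2 * pi))) = app s (app (einv A) (u (- t)))" for t
      unfolding m app_mult[symmetric] by simp
  qed (intro smooth_app smooth_const smooth_compose[OF loop_alg_smooth[OF u]] smooth_minus smooth_ident)
qed (use app_aut[OF A] aut_grp_inverse[OF A] in auto)

text \<open>The change of parameter \<open>t \<mapsto> pi - t\<close> exchanges the fixed points 0
  and pi of the reflection; as it reverses orientation, the twist is inverted.\<close>

lemma explicit_swap_quasiconj:
  assumes A: "A \<in> G" and B: "B \<in> G" and AB: "A * A = B * B"
  shows "quasiconj cplx J br (explicit_aut (app A, app B)) (explicit_aut (app B, app A))"
proof -
  define s where "s = einv B * A"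
  note rel = pair_relations[OF A B AB, folded s_def]
  note is0 = aut_grp_inverse[OF rel(1)]
  have s': "einv A * B = einv s"
    unfolding s_def by (rule einv_unique[symmetric])
      (simp add: mult.assoc aut_grp_inverse[OF A] aut_grp_inverse[OF B])
  have si: "einv s \<in> G" by (rule aut_grp_einv[OF rel(1)])
  let ?\<psi> = "\<lambda>(u::real \<Rightarrow> 'a) t. app 1 (u (pi - t))"
  have sm: "smooth (\<lambda>t. app 1 (u (pi - t)))" if "smooth u" for u :: "real \<Rightarrow> 'a"
    by (intro smooth_app smooth_const smooth_compose[OF that] smooth_diff smooth_ident)
  have "app 1 = (\<lambda>x::'a. x)" by (rule ext) simp
  then have id: "(\<lambda>x. x) \<in> Aut" using app_aut[OF aut_grp_one] by simp
  have iso: "loop_iso cplx J br (app s) (app (einv s)) ?\<psi>"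
  proof (rule loop_isoI[where \<xi> = ?\<psi>])
    fix u assume u: "u \<in> loop_alg (app s)"
    show "?\<psi> u \<in> loop_alg (app (einv s))"
    proof (rule loop_algI)
      show "app 1 (u (pi - (t + 2 * pi))) = app (einv s) (app 1 (u (pi - t)))" for t
        using loop_alg_back[OF rel(1) u, of "pi - t"] by (simp add: algebra_simps)
    qed (intro sm loop_alg_smooth[OF u])
  next
    fix u assume u: "u \<in> loop_alg (app (einv s))"
    show "?\<psi> u \<in> loop_alg (app s)"
    proof (rule loop_algI)
      show "app 1 (u (pi - (t + 2 * pi))) = app s (app 1 (u (pi - t)))" for t
        using loop_alg_back[OF si u, of "pi - t"] by (simp add: algebra_simps einv_einv[OF rel(1)])
    qed (intro sm loop_alg_smooth[OF u])
  qed (auto intro: id)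
  have "app B (?\<psi> u (- t)) = ?\<psi> (\<lambda>t. app A (u (- t))) t" if u: "u \<in> loop_alg (app s)" for u t
  proof -
    have "u (t - pi) = app (einv s) (u (t + pi))"
      using loop_alg_back[OF rel(1) u, of "t + pi"] by (simp add: algebra_simps)
    then show ?thesis by (simp add: app_mult[symmetric] rel(3) add.commute del: app_mult)
  qed
  with iso show ?thesis
    unfolding quasiconj_def explicit_aut_app[OF A] explicit_aut_app[OF B] s'
    by (intro exI[of _ ?\<psi>]) (simp add: s_def fun_eq_iff)
qed

text \<open>Up to conjugation by \<open>E\<close> the first entry stays \<open>A\<close> and the
  second becomes \<open>b\<close>. Needed is a smooth \<open>h\<close> with values 1 at 0 and
  \<open>C\<close> at pi, \<open>h (t + 2 * pi) = s1 * h t * einv s\<close> and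
  \<open>h (- t) = einv A * h t * A\<close>. The path in the centralizer supplies it on [0, pi], the
  two symmetries elsewhere.\<close>

lemma explicit_conj_quasiconj:
  assumes A: "A \<in> G" and B: "B \<in> G" and AB: "A * A = B * B" and E: "E \<in> G" and F: "F \<in> G"
    and T: "connected T" "T \<subseteq> aut_grp br (insert (A * A) commutant)" "1 \<in> T" "einv E * F \<in> T"
  shows "quasiconj cplx J br (explicit_aut (app A, app B))
    (explicit_aut (app (E * A * einv E), app (F * B * einv F)))"
proof -
  define C where "C = einv E * F"
  have CC: "C \<in> aut_grp br (insert (A * A) commutant)" using T by (auto simp: C_def)
  then have C: "C \<in> G" "C * (A * A) = A * A * C" by (simp_all add: aut_grp_insert)
  define b where "b = C * B * einv C"
  have b: "b \<in> G" unfolding b_def by (intro aut_grp_mult aut_grp_einv C B)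
  note iA = aut_grp_inverse[OF A] and iB = aut_grp_inverse[OF B] and iC = aut_grp_inverse[OF C(1)]
    and iE = aut_grp_inverse[OF E] and iF = aut_grp_inverse[OF F] and ib = aut_grp_inverse[OF b]
  have "b * b = C * (B * B) * einv C" by (simp add: b_def mult.assoc iC)
  also have "\<dots> = A * A" using C(2) by (simp add: AB[symmetric] mult.assoc iC)
  finally have Ab: "A * A = b * b" ..
  define s where "s = einv B * A"
  define s1 where "s1 = einv b * A"
  note rel = pair_relations[OF A B AB, folded s_def] and rel1 = pair_relations[OF A b Ab, folded s1_def]
  note is0 = aut_grp_inverse[OF rel(1)] and is1 = aut_grp_inverse[OF rel1(1)]
  obtain p where p: "smooth p" "\<And>t. p t \<in> aut_grp br (insert (A * A) commutant)" "p 0 = 1" "p 1 = C"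
    using smooth_path_in_component[OF bilin T] C_def by blast
  obtain \<theta> :: "real \<Rightarrow> real" where \<theta>: "smooth \<theta>" "\<And>x. x \<le> 0 \<Longrightarrow> \<theta> x = 0" "\<And>x. 1 \<le> x \<Longrightarrow> \<theta> x = 1"
    by (rule smooth_step_exists) blast
  \<comment> \<open>Stationary before 1 and after 2, both inside (0, pi), which leaves room for a
    smooth reflection at 0 and a smooth match at pi.\<close>
  define c where "c t = p (\<theta> (t - 1))" for t
  have c: "smooth c" "\<And>t. t \<le> 1 \<Longrightarrow> c t = 1" "\<And>t. 2 \<le> t \<Longrightarrow> c t = C"
    unfolding c_def by (intro smooth_compose[OF p(1)] smooth_compose[OF \<theta>(1)] smooth_diff smooth_ident smooth_const)
      (simp_all add: \<theta> p)
  have cG: "c t \<in> G" and cA: "c t * (A * A) = A * A * c t" for t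
    using p(2) by (simp_all add: c_def aut_grp_insert)
  \<comment> \<open>On each side of 0 one factor is 1: \<open>g\<close> is \<open>c\<close> on the
    right and its reflection through \<open>A\<close> on the left, with smoothness at 0 built
    in.\<close>
  define g where "g t = c t * (einv A * c (- t) * A)" for t
  have g: "smooth g" unfolding g_def
    by (intro smooth_mult smooth_const c smooth_compose[OF c(1)] smooth_minus smooth_ident)
  have gG: "g t \<in> G" for t unfolding g_def by (intro aut_grp_mult aut_grp_einv cG A)
  have gpos: "g t = c t" if "-1 \<le> t" for t using c(2)[of "- t"] that by (simp add: g_def iA)
  have gneg: "g t = einv A * c (- t) * A" if "t \<le> 1" for t using c(2)[of t] that by (simp add: g_def)
  define \<Sigma> where "\<Sigma> X = s1 * X * einv s" for X
  have inv\<Sigma>: "inv \<Sigma> = (\<lambda>X. einv s1 * X * s)"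
    by (rule inv_equality) (simp_all add: \<Sigma>_def mult.assoc is0 is1)
  have bij: "bij \<Sigma>"
    by (rule o_bij[of "\<lambda>X. einv s1 * X * s"]) (simp_all add: \<Sigma>_def fun_eq_iff mult.assoc is0 is1)
  have lin: "bounded_linear (\<lambda>X. a * X * b)" for a b :: "'a endo"
    by (rule bounded_linear_compose[OF bounded_linear_mult_left bounded_linear_mult_right])
  have lin\<Sigma>: "bounded_linear \<Sigma>" "bounded_linear (inv \<Sigma>)"
    using lin[of s1 "einv s"] lin[of "einv s1" s] unfolding inv\<Sigma> by (simp_all add: \<Sigma>_def[abs_def])
  \<comment> \<open>Near the seam both pieces are constant, \<open>C\<close> on the side of pi and
    \<open>einv A * C * A\<close> on the side of \<open>- pi\<close>; the definition of
    \<open>b\<close> makes them correspond.\<close>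
  have match: "g (t + 2 * pi) = \<Sigma> (g t)" if "\<bar>t + pi\<bar> < 1" for t
  proof -
    have t: "t \<le> -2" "2 \<le> t + 2 * pi" using that pi_gt3 by linarith+
    have "\<Sigma> (g t) = s1 * (einv A * C * A) * einv s"
      using t gneg[of t] c(3)[of "- t"] by (simp add: \<Sigma>_def)
    also have "\<dots> = einv b * C * (A * einv s)"
      by (simp add: s1_def mult.assoc iA)
    also have "\<dots> = einv b * (C * B)" by (simp only: rel(3) mult.assoc)
    also have "C * B = b * C" by (simp add: b_def mult.assoc iC)
    also have "einv b * (b * C) = C" by (rule ib)
    finally show ?thesis using t gpos[of "t + 2 * pi"] c(3) by simp
  qed
  obtain h where h: "smooth h" "\<And>t. h (t + 2 * pi) = \<Sigma> (h t)" "\<And>t. \<bar>t\<bar> \<le> pi \<Longrightarrow> h t = g t"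
    "\<And>t. \<exists>k. h t = zpow \<Sigma> k (g (t - 2 * pi * of_int k))"
    by (rule twisted_extension[OF bij lin\<Sigma> g zero_less_one match]) blast+
  have hG: "h t \<in> G" for t
  proof -
    have "zpow \<Sigma> k (g r) \<in> G" for k r
      unfolding \<Sigma>_def[abs_def] inv\<Sigma>
      by (rule zpow_invariant)
        (auto intro!: gG aut_grp_mult aut_grp_einv rel rel1 simp: inv\<Sigma>[unfolded \<Sigma>_def[abs_def]])
    then show ?thesis using h(4)[of t] by auto
  qed
  \<comment> \<open>On the first period the rule comes from \<open>g\<close>, where commutation of
    \<open>c\<close> with \<open>A * A\<close> makes the reflection involutive. It passes from
    period to period because \<open>A\<close> inverts both twists \<open>s\<close> and
    \<open>s1\<close>.\<close>
  have "h (- (r + 2 * pi * of_int k)) = einv A * h (r + 2 * pi * of_int k) * A" if r: "\<bar>r\<bar> \<le> pi" for r and k :: int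
  proof (induction k rule: int_induct[of _ 0])
    case base
    have "g (- r) = einv A * g r * A"
    proof (cases "0 \<le> r")
      case True
      then show ?thesis by (simp add: gneg[of "- r"] gpos[of r])
    next
      case False
      then have "g (- r) = c (- r)" "g r = einv A * c (- r) * A" by (simp_all add: gneg gpos)
      moreover have "einv A * (einv A * c (- r) * A) * A = einv A * einv A * (c (- r) * (A * A))"
        by (simp add: mult.assoc)
      moreover have "\<dots> = c (- r)" unfolding cA by (simp add: mult.assoc iA)
      ultimately show ?thesis by simp
    qed
    with r show ?case by (simp add: h(3))
  next
    case (step1 i)
    let ?t = "r + 2 * pi * of_int i"
    have t: "r + 2 * pi * of_int (i + 1) = ?t + 2 * pi" by (simp add: algebra_simps)
    have "h (- ?t) = s1 * h (- (?t + 2 * pi)) * einv s" using h(2)[of "- (?t + 2 * pi)"] by (simp add: \<Sigma>_def)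
    then have "h (- (?t + 2 * pi)) = einv s1 * h (- ?t) * s" by (simp add: mult.assoc is0 is1)
    also have "\<dots> = einv s1 * einv A * h ?t * (A * s)" unfolding step1 by (simp add: mult.assoc)
    also have "A * s = einv s * A" by (rule rel)
    also have "einv s1 * einv A = einv (A * s1)" by (rule einv_mult[OF A rel1(1), symmetric])
    also have "A * s1 = einv s1 * A" by (rule rel1)
    also have "einv (einv s1 * A) = einv A * s1"
      by (simp add: einv_mult[OF aut_grp_einv[OF rel1(1)] A] einv_einv[OF rel1(1)])
    also have "einv A * s1 * h ?t * (einv s * A) = einv A * h (?t + 2 * pi) * A"
      by (simp add: h(2) \<Sigma>_def mult.assoc)
    finally show ?case by (simp only: t)
  next
    case (step2 i)
    let ?t = "r + 2 * pi * of_int (i - 1)"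
    have t: "r + 2 * pi * of_int i = ?t + 2 * pi" by (simp add: algebra_simps)
    have "h (- ?t) = s1 * h (- (?t + 2 * pi)) * einv s" using h(2)[of "- (?t + 2 * pi)"] by (simp add: \<Sigma>_def)
    also have "\<dots> = s1 * einv A * (s1 * h ?t * einv s) * (A * einv s)"
      using step2 unfolding t h(2) \<Sigma>_def by (simp add: mult.assoc)
    also have "A * einv s = s * A" by (rule rel)
    also have "s1 * einv A * (s1 * h ?t * einv s) * (s * A) = s1 * (einv A * s1) * h ?t * A"
      by (simp add: mult.assoc is0)
    also have "einv A * s1 = einv (einv s1 * A)"
      by (simp add: einv_mult[OF aut_grp_einv[OF rel1(1)] A] einv_einv[OF rel1(1)])
    also have "einv s1 * A = A * s1" by (rule rel1(5)[symmetric])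
    also have "einv (A * s1) = einv s1 * einv A" by (rule einv_mult[OF A rel1(1)])
    also have "s1 * (einv s1 * einv A) * h ?t * A = einv A * h ?t * A" by (simp add: is1)
    finally show ?case .
  qed
  then have refl: "h (- t) = einv A * h t * A" for t
    using real_mod_2pi[of t 0] by (metis diff_zero)
  define s2 where "s2 = einv (F * B * einv F) * (E * A * einv E)"
  have FEC: "F = E * C" by (simp add: C_def iE)
  have FB: "F * B * einv F \<in> G" by (intro aut_grp_mult aut_grp_einv F B)
  have EA: "E * A * einv E \<in> G" by (intro aut_grp_mult aut_grp_einv E A)
  have s2: "s2 = E * s1 * einv E"
  proof -
    have "F * B * einv F = E * b * einv E"
      unfolding FEC einv_mult[OF E C(1)] b_def by (simp add: mult.assoc)
    moreover have "einv (E * b * einv E) = E * einv b * einv E"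
      by (rule einv_unique) (simp add: mult.assoc iE ib)
    ultimately show ?thesis by (simp add: s2_def s1_def mult.assoc iE)
  qed
  have "loop_iso cplx J br (app s) (app s2) (\<lambda>u t. app (E * h t) (u t))"
  proof (rule loop_iso_orientation_preserving[where \<kappa> = "\<lambda>t. t"])
    show "E * h (t + 2 * pi) * s = s2 * (E * h t)" for t
      by (simp add: s2 h(2) \<Sigma>_def mult.assoc is0 iE)
  qed (auto intro!: smooth_mult smooth_const h hG aut_grp_mult E rel rel1 aut_grp_einv simp: s2)
  moreover have "E * A * einv E * (E * h (- t)) = E * h t * A" for t
    by (simp add: refl mult.assoc iA iE)
  then have "app (E * A * einv E) (app (E * h (- t)) x) = app (E * h t) (app A x)" for t x
    by (metis app_mult)
  ultimately show ?thesis
    unfolding quasiconj_def explicit_aut_app[OF B] explicit_aut_app[OF FB] s_def[symmetric] s2_def[symmetric]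
    by (intro exI[of _ "\<lambda>u t. app (E * h t) (u t)"]) (simp add: fun_eq_iff del: app_mult)
qed

section \<open>Identity components of centralizers and the generating steps\<close>

lemma Blinfun_app: "Blinfun (app X) = endo_blinfun X"
  by (metis Endo_inverse UNIV_I endo_of_app endo_of_def)

lemma centralizer_app:
  "C \<in> G \<Longrightarrow> {c \<in> Aut. c \<circ> app C = app C \<circ> c} = app ` aut_grp br (insert C commutant)"
proof (intro set_eqI iffI)
  fix c assume "c \<in> {c \<in> Aut. c \<circ> app C = app C \<circ> c}"
  then have c: "c \<in> Aut" "c \<circ> app C = app C \<circ> c" by auto
  have "app (endo_of c) \<circ> app C = app C \<circ> app (endo_of c)" using c endo_of_aut(2) by metis
  then have "endo_of c * C = C * endo_of c" by (simp add: app_comp app_eq_iff)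
  then show "c \<in> app ` aut_grp br (insert C commutant)"
    using endo_of_aut[OF c(1)] by (auto simp: aut_grp_insert intro!: image_eqI[of _ _ "endo_of c"])
qed (auto simp: aut_grp_insert app_comp intro: app_aut)

lemma cent_id0_app:
  assumes C: "C \<in> G"
  shows "app X \<in> cent_id0 cplx J br (app C) \<longleftrightarrow>
    (\<exists>T. connected T \<and> T \<subseteq> aut_grp br (insert C commutant) \<and> 1 \<in> T \<and> X \<in> T)"
proof -
  let ?G = "aut_grp br (insert C commutant)"
  have id: "Blinfun id = endo_blinfun (1 :: 'a endo)"
    using Blinfun_app[of "1 :: 'a endo"] by (simp add: fun_eq_iff[of "app 1" id, THEN iffD2])
  have im: "Blinfun ` app ` ?G = endo_blinfun ` ?G" by (simp add: image_image Blinfun_app)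
  have "app X \<in> cent_id0 cplx J br (app C) \<longleftrightarrow>
      app X \<in> app ` ?G \<and> connected_component (endo_blinfun ` ?G) (endo_blinfun 1) (endo_blinfun X)"
    unfolding cent_id0_def centralizer_app[OF C] Let_def id im by (simp add: Blinfun_app)
  also have "\<dots> \<longleftrightarrow> (\<exists>T. connected T \<and> T \<subseteq> ?G \<and> 1 \<in> T \<and> X \<in> T)"
  proof
    assume "app X \<in> app ` ?G \<and> connected_component (endo_blinfun ` ?G) (endo_blinfun 1) (endo_blinfun X)"
    then obtain T where T: "connected T" "T \<subseteq> endo_blinfun ` ?G" "endo_blinfun 1 \<in> T" "endo_blinfun X \<in> T"
      by (auto simp: connected_component_def)
    have "connected (Endo ` T)"
      by (rule connected_continuous_image[OF _ T(1)])
        (rule linear_continuous_on[OF bounded_linear_Endo])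
    moreover have "Endo ` T \<subseteq> ?G" using T(2) by (auto simp: endo_blinfun_inverse)
    moreover have "1 \<in> Endo ` T" "X \<in> Endo ` T" using T(3,4) by (metis endo_blinfun_inverse imageI)+
    ultimately show "\<exists>T. connected T \<and> T \<subseteq> ?G \<and> 1 \<in> T \<and> X \<in> T" by blast
  next
    assume "\<exists>T. connected T \<and> T \<subseteq> ?G \<and> 1 \<in> T \<and> X \<in> T"
    then obtain T where T: "connected T" "T \<subseteq> ?G" "1 \<in> T" "X \<in> T" by blast
    have "connected (endo_blinfun ` T)"
      by (rule connected_continuous_image[OF _ T(1)])
        (rule linear_continuous_on[OF bounded_linear_endo_blinfun])
    with T show "app X \<in> app ` ?G \<and> connected_component (endo_blinfun ` ?G) (endo_blinfun 1) (endo_blinfun X)"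
      unfolding connected_component_def by blast
  qed
  finally show ?thesis .
qed

lemma gen_step_conj:
  assumes A: "A \<in> G" and B: "B \<in> G" and E: "E \<in> G" and F: "F \<in> G"
    and T: "connected T" "T \<subseteq> aut_grp br (insert (A * A) commutant)" "1 \<in> T" "einv E * F \<in> T"
  shows "gen_step cplx J br (app A, app B) (app (E * A * einv E), app (F * B * einv F))"
  unfolding gen_step_def
proof (intro conjI disjI2 exI)
  have "app (einv E * F) \<in> cent_id0 cplx J br (app (A * A))"
    using T cent_id0_app[OF aut_grp_mult[OF A A]] by blast
  then show "inv (app E) \<circ> app F \<in> cent_id0 cplx J br (fst (app A, app B) \<circ> fst (app A, app B))"
    by (simp add: inv_app[OF E] app_comp)
qed (simp_all add: app_aut A B E F app_comp inv_app)

lemma gen_stepE: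
  assumes "gen_step cplx J br p p'"
  obtains A B where "p = (app A, app B)" "A \<in> G" "B \<in> G" "p' = (app B, app A)"
  | A B E F T where "p = (app A, app B)" "A \<in> G" "B \<in> G" "E \<in> G" "F \<in> G"
    "connected T" "T \<subseteq> aut_grp br (insert (A * A) commutant)" "1 \<in> T" "einv E * F \<in> T"
    "p' = (app (E * A * einv E), app (F * B * einv F))"
proof -
  have "fst p \<in> Aut" "snd p \<in> Aut" using assms by (auto simp: gen_step_def)
  then obtain A B where p: "p = (app A, app B)" and A: "A \<in> G" and B: "B \<in> G" by (rule aut_pairE)
  consider "p' = (snd p, fst p)" | \<alpha> \<beta> where "\<alpha> \<in> Aut" "\<beta> \<in> Aut"
    "inv \<alpha> \<circ> \<beta> \<in> cent_id0 cplx J br (fst p \<circ> fst p)" "p' = (\<alpha> \<circ> fst p \<circ> inv \<alpha>, \<beta> \<circ> snd p \<circ> inv \<beta>)"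
    using assms by (auto simp: gen_step_def)
  then show ?thesis
  proof cases
    case 1
    then show ?thesis using that(1) p A B by simp
  next
    case 2
    define E F where "E = endo_of \<alpha>" and "F = endo_of \<beta>"
    have E: "E \<in> G" "\<alpha> = app E" and F: "F \<in> G" "\<beta> = app F"
      using endo_of_aut[OF 2(1)] endo_of_aut[OF 2(2)] by (simp_all add: E_def F_def)
    have "app (einv E * F) \<in> cent_id0 cplx J br (app (A * A))"
      using 2(3) by (simp add: E F p inv_app[OF E(1)] app_comp)
    then obtain T where "connected T" "T \<subseteq> aut_grp br (insert (A * A) commutant)" "1 \<in> T" "einv E * F \<in> T"
      using cent_id0_app[OF aut_grp_mult[OF A A]] by blast
    moreover have "p' = (app (E * A * einv E), app (F * B * einv F))"
      using 2(4) by (simp add: E F p inv_app app_comp)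
    ultimately show ?thesis using that(2) p A B E F by blast
  qed
qed

text \<open>An equivalence, because \<open>Jsim\<close> runs through steps in both directions. As
  \<open>einv E * F\<close> centralizes \<open>A * A\<close>, conjugation by \<open>E\<close> and by
  \<open>F\<close> sends \<open>A * A\<close> to the same element.\<close>

lemma gen_step_Jpairs:
  assumes "gen_step cplx J br p p'"
  shows "p \<in> Jpairs cplx J br q \<longleftrightarrow> p' \<in> Jpairs cplx J br q"
  using assms
proof (cases rule: gen_stepE)
  case (1 A B)
  then show ?thesis by (auto simp: Jpairs_app)
next
  case (2 A B E F T)
  note iE = aut_grp_inverse[OF 2(4)] and iF = aut_grp_inverse[OF 2(5)]
  have "einv E * F \<in> aut_grp br (insert (A * A) commutant)" using 2 by blast
  then have comm: "einv E * F * (A * A) = A * A * (einv E * F)" by (simp add: aut_grp_insert)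
  have conj: "(E * A * einv E) * (E * A * einv E) = E * (A * A) * einv E"
    "(F * B * einv F) * (F * B * einv F) = F * (B * B) * einv F"
    by (simp_all add: mult.assoc iE iF)
  have FA: "F * (A * A) * einv F = E * (A * A) * einv E"
  proof -
    have "F * (A * A) * einv F = E * (einv E * F * (A * A)) * einv F" by (simp add: mult.assoc iE)
    also have "\<dots> = E * (A * A) * einv E" unfolding comm by (simp add: mult.assoc iF)
    finally show ?thesis .
  qed
  have "A * A = B * B \<longleftrightarrow> E * (A * A) * einv E = F * (B * B) * einv F"
  proof
    assume "E * (A * A) * einv E = F * (B * B) * einv F"
    then have "einv F * (F * (A * A) * einv F) * F = einv F * (F * (B * B) * einv F) * F"
      by (simp only: FA)
    then show "A * A = B * B" by (simp add: mult.assoc iF)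
  qed (use FA in simp)
  moreover have "(E * (A * A) * einv E) ^ n = E * (A * A) ^ n * einv E" for n
    by (induction n) (simp_all add: mult.assoc iE)
  moreover have "E * X * einv E = 1 \<longleftrightarrow> X = 1" for X
  proof
    assume "E * X * einv E = 1"
    then have "einv E * (E * X * einv E) * E = einv E * 1 * E" by simp
    then show "X = 1" by (simp add: mult.assoc iE)
  qed (simp add: iE)
  ultimately have "has_order_on UNIV (app (E * (A * A) * einv E)) n \<longleftrightarrow> has_order_on UNIV (app (A * A)) n" for n
    by (simp only: has_order_on_app)
  moreover have "E * A * einv E \<in> G" "F * B * einv F \<in> G" using 2 by (auto intro!: aut_grp_mult aut_grp_einv)
  ultimately show ?thesis
    unfolding 2(1) 2(10) Jpairs_app conj using 2 \<open>A * A = B * B \<longleftrightarrow> _\<close> by simp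
qed

lemma explicit_aut_stable:
  assumes "p \<in> Jpairs cplx J br q"
  shows "fst (explicit_aut p) \<in> Aut"
    "loop_iso cplx J br (fst (explicit_aut p)) (fst (explicit_aut p)) (snd (explicit_aut p))"
  using assms
proof (atomize(full), cases rule: JpairsE)
  case (1 A B)
  then show "fst (explicit_aut p) \<in> Aut \<and>
    loop_iso cplx J br (fst (explicit_aut p)) (fst (explicit_aut p)) (snd (explicit_aut p))"
    using explicit_iso[OF 1(2-4)] app_aut[OF aut_grp_mult[OF aut_grp_einv[OF 1(3)] 1(2)]]
    by (simp add: explicit_aut_app)
qed

lemma gen_step_quasiconj:
  assumes "gen_step cplx J br p p'" "p \<in> Jpairs cplx J br q"
  shows "quasiconj cplx J br (explicit_aut p) (explicit_aut p')"
  using assms(1)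
proof (cases rule: gen_stepE)
  case (1 A B)
  then show ?thesis using assms(2) explicit_swap_quasiconj by (simp add: Jpairs_app)
next
  case (2 A B E F T)
  then show ?thesis using assms(2) explicit_conj_quasiconj[of A B E F T] by (simp add: Jpairs_app)
qed

lemma Jsim_quasiconj:
  assumes "Jsim cplx J br p p'" "p \<in> Jpairs cplx J br q"
  shows "p' \<in> Jpairs cplx J br q \<and> quasiconj cplx J br (explicit_aut p) (explicit_aut p')"
  using assms(1) unfolding Jsim_def
proof (induction rule: rtranclp_induct)
  case base
  then show ?case using assms(2) quasiconj_refl explicit_aut_stable(1) by blast
next
  case (step x y)
  from step.hyps(2) have "y \<in> Jpairs cplx J br q \<and> quasiconj cplx J br (explicit_aut x) (explicit_aut y)"
  proof
    assume xy: "gen_step cplx J br x y"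
    then show ?thesis using step.IH gen_step_Jpairs gen_step_quasiconj by blast
  next
    assume yx: "gen_step cplx J br y x"
    have y: "y \<in> Jpairs cplx J br q" using gen_step_Jpairs[OF yx] step.IH by blast
    have x: "x \<in> Jpairs cplx J br q" using step.IH by blast
    have "quasiconj cplx J br (explicit_aut x) (explicit_aut y)"
      by (rule quasiconj_sym[OF explicit_aut_stable(1)[OF y] explicit_aut_stable(1)[OF x]
        loop_iso_in[OF explicit_aut_stable(2)[OF y]] gen_step_quasiconj[OF yx y]])
    with y show ?thesis by blast
  qed
  with step.IH show ?case using quasiconj_trans by blast
qed

end

section \<open>Identities read off from loops, and orders of explicit automorphisms\<close>

context simple_lie_algebra
begin

text \<open>Loops attain every value at a given parameter, so pointwise identities become equations
  between endomorphisms.\<close>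

lemma loops_determine:
  assumes s: "s \<in> G" and eq: "\<And>u. u \<in> loop_alg (app s) \<Longrightarrow> app X (u r) = app Y (u r)"
  shows "X = Y"
proof (rule endo_eqI)
  fix x
  obtain u where "u \<in> loop_alg (app s)" "u r = x"
    using loop_through[OF aut_bij[OF app_aut[OF s]] linear_app] by blast
  with eq show "app X x = app Y x" by auto
qed

lemma loops_distinguish:
  assumes s: "s \<in> G" and X: "X \<in> G" and eq: "\<And>u. u \<in> loop_alg (app s) \<Longrightarrow> app X (u t) = app Y (u r)"
  shows "\<exists>k::int. t = r + 2 * pi * of_int k"
proof -
  obtain x :: 'a where "x \<noteq> 0" using nontrivial by blast
  have "u t = 0" if "u \<in> loop_alg (app s)" "u r = 0" for u
  proof -
    have "app X (u t) = 0" using eq[OF that(1)] that(2) by (simp add: app.zero_right)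
    then have "app (einv X) (app X (u t)) = 0" by (simp add: app.zero_right)
    then show ?thesis by (simp add: aut_grp_inverse[OF X])
  qed
  then show ?thesis
    using loops_separate[OF aut_bij[OF app_aut[OF s]] linear_app _ \<open>x \<noteq> 0\<close>, of r t] by blast
qed

lemma explicit_power:
  fixes A :: "'a endo" and u :: "real \<Rightarrow> 'a" and t :: real
  defines "\<Phi> \<equiv> \<lambda>u t. app A (u (- t))"
  shows "(\<Phi> ^^ (2 * j)) u t = app ((A * A) ^ j) (u t)"
    and "(\<Phi> ^^ Suc (2 * j)) u t = app ((A * A) ^ j * A) (u (- t))"
proof -
  show *: "(\<Phi> ^^ (2 * j)) u t = app ((A * A) ^ j) (u t)" for t
  proof (induction j arbitrary: t)
    case (Suc j)
    have "(\<Phi> ^^ (2 * Suc j)) u = \<Phi> (\<Phi> ((\<Phi> ^^ (2 * j)) u))" by simp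
    moreover have "\<Phi> (\<Phi> v) t = app (A * A) (v t)" for v t by (simp add: \<Phi>_def)
    ultimately show ?case by (simp only: Suc app_mult[symmetric] power_Suc)
  qed simp
  have "A * (A * A) ^ j = (A * A) ^ j * A" by (metis mult.assoc power_commuting_commutes)
  moreover have "(\<Phi> ^^ Suc (2 * j)) u t = app A ((\<Phi> ^^ (2 * j)) u (- t))" by (simp add: \<Phi>_def)
  ultimately show "(\<Phi> ^^ Suc (2 * j)) u t = app ((A * A) ^ j * A) (u (- t))"
    by (simp only: * app_mult[symmetric])
qed

text \<open>Even powers act by powers of \<open>A * A\<close> and leave the parameter alone, whence
  the order q/2 in the definition of the pairs. Odd powers reverse the parameter and cannot be
  trivial.\<close>

lemma explicit_order:
  assumes A: "A \<in> G" and s: "s \<in> G"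
  defines "\<Phi> \<equiv> \<lambda>u t. app A (u (- t))"
  shows "(\<forall>u\<in>loop_alg (app s). (\<Phi> ^^ n) u = u) \<longleftrightarrow> even n \<and> (A * A) ^ (n div 2) = 1"
proof (cases "even n")
  case True
  then obtain j where n: "n = 2 * j" by blast
  have "(\<forall>u\<in>loop_alg (app s). (\<Phi> ^^ n) u = u) \<longleftrightarrow> (A * A) ^ j = 1"
  proof
    assume *: "\<forall>u\<in>loop_alg (app s). (\<Phi> ^^ n) u = u"
    show "(A * A) ^ j = 1"
    proof (rule loops_determine[OF s, where r = 0])
      fix u assume "u \<in> loop_alg (app s)"
      then have "(\<Phi> ^^ n) u 0 = u 0" using * by simp
      then show "app ((A * A) ^ j) (u 0) = app 1 (u 0)" by (simp add: n \<Phi>_def explicit_power(1))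
    qed
  qed (simp add: n \<Phi>_def explicit_power(1) fun_eq_iff)
  with True show ?thesis by (simp add: n)
next
  case False
  then obtain j where n: "n = Suc (2 * j)" by (metis oddE Suc_eq_plus1)
  have "\<not> (\<forall>u\<in>loop_alg (app s). (\<Phi> ^^ n) u = u)"
  proof
    assume *: "\<forall>u\<in>loop_alg (app s). (\<Phi> ^^ n) u = u"
    \<comment> \<open>1 and -1 serve as test parameters because they are not congruent modulo 2
      pi.\<close>
    have "\<exists>k::int. (1::real) = - 1 + 2 * pi * of_int k"
    proof (rule loops_distinguish[OF s aut_grp_one])
      fix u assume "u \<in> loop_alg (app s)"
      then have "(\<Phi> ^^ n) u 1 = u 1" using * by simp
      then show "app 1 (u 1) = app ((A * A) ^ j * A) (u (- 1))"
        unfolding n \<Phi>_def explicit_power(2) by simp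
    qed
    then obtain k :: int where k: "pi * of_int k = 1" by auto
    have "k \<ge> 1"
    proof (rule ccontr)
      assume "\<not> k \<ge> 1"
      then have "pi * of_int k \<le> pi * 0" by (intro mult_left_mono) auto
      with k show False by simp
    qed
    then have "pi * 1 \<le> pi * of_int k" by (intro mult_left_mono) auto
    with k pi_gt3 show False by simp
  qed
  with False show ?thesis by simp
qed

lemma explicit_aut_in_aut2_ord:
  assumes p: "p \<in> Jpairs cplx J br q" and q: "even q"
  shows "explicit_aut p \<in> aut2_ord cplx J br q"
  using p
proof (cases rule: JpairsE)
  case (1 A B)
  define s where "s = einv B * A"
  note rel = pair_relations[OF 1(2-4), folded s_def]
  let ?\<Phi> = "\<lambda>(u::real \<Rightarrow> 'a) t. app A (u (- t))"
  have "second_kind cplx J br (app s) ?\<Phi>"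
    unfolding second_kind_def
  proof (intro exI conjI allI ballI)
    show "smooth (uminus :: real \<Rightarrow> real)" by (rule smooth_minus[OF smooth_ident])
    moreover have "inv (uminus :: real \<Rightarrow> real) = uminus" by (rule inv_equality) auto
    ultimately show "smooth (inv (uminus :: real \<Rightarrow> real))" by simp
    show "bij (uminus :: real \<Rightarrow> real)" by (rule bij_uminus)
    show "app A = app s \<circ> app A \<circ> app s" by (simp add: app_comp rel mult.assoc)
  qed (auto intro: app_aut 1)
  moreover have "has_order_on (loop_alg (app s)) ?\<Phi> q"
    unfolding has_order_on_def
  proof (intro conjI allI impI)
    have ord: "0 < q div 2" "(A * A) ^ (q div 2) = 1" "\<And>m. 0 < m \<Longrightarrow> m < q div 2 \<Longrightarrow> (A * A) ^ m \<noteq> 1"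
      using 1(5) by (simp_all add: has_order_on_app)
    show "0 < q" using ord(1) by (cases q) auto
    show "\<forall>u\<in>loop_alg (app s). (?\<Phi> ^^ q) u = u"
      using explicit_order[OF 1(2) rel(1)] q ord(2) by blast
    fix m assume m: "0 < m \<and> m < q"
    have "(A * A) ^ (m div 2) \<noteq> 1" if "even m"
      using m q that by (intro ord(3)) (auto elim!: evenE)
    then show "\<not> (\<forall>u\<in>loop_alg (app s). (?\<Phi> ^^ m) u = u)"
      using explicit_order[OF 1(2) rel(1)] by blast
  qed
  ultimately show ?thesis
    using explicit_iso[OF 1(2-4)] app_aut[OF rel(1)]
    by (simp add: 1(1) explicit_aut_app[OF 1(3)] s_def[symmetric] aut2_ord_def loop_aut_def)
qed

section \<open>Normal forms\<close>

lemma second_kind_power: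
  assumes \<Phi>: "\<And>u. u \<in> loop_alg \<sigma> \<Longrightarrow> \<Phi> u \<in> loop_alg \<sigma>" and \<phi>: "\<And>t. \<phi> t \<in> Aut"
    and form: "\<And>u t. u \<in> loop_alg \<sigma> \<Longrightarrow> \<Phi> u t = \<phi> t (u (lam t))"
  shows "\<exists>C. (\<forall>t. C t \<in> G) \<and> (\<forall>u\<in>loop_alg \<sigma>. (\<Phi> ^^ n) u \<in> loop_alg \<sigma> \<and>
    (\<forall>t. (\<Phi> ^^ n) u t = app (C t) (u ((lam ^^ n) t))))"
proof (induction n)
  case 0
  show ?case by (intro exI[of _ "\<lambda>_. 1"]) (simp add: aut_grp_one)
next
  case (Suc n)
  then obtain C where C: "\<And>t. C t \<in> G" "\<And>u. u \<in> loop_alg \<sigma> \<Longrightarrow> (\<Phi> ^^ n) u \<in> loop_alg \<sigma>"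
    "\<And>u t. u \<in> loop_alg \<sigma> \<Longrightarrow> (\<Phi> ^^ n) u t = app (C t) (u ((lam ^^ n) t))" by blast
  show ?case
  proof (intro exI[of _ "\<lambda>t. endo_of (\<phi> t) * C (lam t)"] conjI allI ballI)
    fix u t assume u: "u \<in> loop_alg \<sigma>"
    show "(\<Phi> ^^ Suc n) u \<in> loop_alg \<sigma>" using \<Phi>[OF C(2)[OF u]] by simp
    have "(\<Phi> ^^ Suc n) u t = \<phi> t ((\<Phi> ^^ n) u (lam t))" using form[OF C(2)[OF u]] by simp
    then show "(\<Phi> ^^ Suc n) u t = app (endo_of (\<phi> t) * C (lam t)) (u ((lam ^^ Suc n) t))"
      by (simp add: C(3)[OF u] endo_of_aut(2)[OF \<phi>] funpow_swap1)
  qed (intro aut_grp_mult endo_of_aut C \<phi>)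
qed

text \<open>The n-th power evaluates loops at \<open>(lam ^^ n) t\<close>. If it is trivial, no loop
  separates this point from \<open>t\<close>; by continuity the integer does not depend on
  \<open>t\<close>.\<close>

lemma second_kind_finite_order:
  assumes \<sigma>: "\<sigma> \<in> Aut" and \<Phi>: "\<And>u. u \<in> loop_alg \<sigma> \<Longrightarrow> \<Phi> u \<in> loop_alg \<sigma>" and \<phi>: "\<And>t. \<phi> t \<in> Aut"
    and form: "\<And>u t. u \<in> loop_alg \<sigma> \<Longrightarrow> \<Phi> u t = \<phi> t (u (lam t))" and lam: "continuous_on UNIV lam"
    and fin: "\<forall>u\<in>loop_alg \<sigma>. (\<Phi> ^^ n) u = u"
  shows "\<exists>k::int. \<forall>t. (lam ^^ n) t = t + 2 * pi * of_int k"
proof -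
  obtain C where C: "\<And>t. C t \<in> G" "\<And>u t. u \<in> loop_alg \<sigma> \<Longrightarrow> (\<Phi> ^^ n) u t = app (C t) (u ((lam ^^ n) t))"
    using second_kind_power[where \<sigma> = \<sigma> and \<Phi> = \<Phi> and \<phi> = \<phi> and lam = lam and n = n, OF \<Phi> \<phi> form] by blast
  have "\<exists>k::int. (lam ^^ n) t - t = 2 * pi * of_int k" for t
  proof -
    have "\<exists>k::int. (lam ^^ n) t = t + 2 * pi * of_int k"
      using loops_distinguish[OF endo_of_aut(1)[OF \<sigma>] C(1), of t "(lam ^^ n) t" 1 t] C(2) fin
      by (simp add: endo_of_aut(2)[OF \<sigma>])
    then show ?thesis by auto
  qed
  moreover have "continuous_on UNIV (lam ^^ n)"
  proof (induction n)
    case (Suc n)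
    have "continuous_on UNIV (lam \<circ> (lam ^^ n))"
      by (rule continuous_on_compose[OF Suc]) (rule continuous_on_subset[OF lam subset_UNIV])
    then show ?case by simp
  qed (simp add: id_def)
  then have "continuous_on UNIV (\<lambda>t. (lam ^^ n) t - t)" by (intro continuous_on_diff continuous_on_id)
  ultimately obtain k :: int where "\<forall>t. (lam ^^ n) t - t = 2 * pi * of_int k"
    using continuous_int_multiple_const[of "\<lambda>t. (lam ^^ n) t - t"] by blast
  then have "(lam ^^ n) t = t + 2 * pi * of_int k" for t
    by (simp add: diff_eq_eq add.commute)
  then show ?thesis by blast
qed

end

lemma shift_int:
  fixes f :: "real \<Rightarrow> real"
  assumes "\<And>t. f (t + p) = f t + c"
  shows "f (t + p * of_int k) = f t + c * of_int k"
proof (induction k rule: int_induct[of _ 0])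
  case (step1 i)
  then show ?case using assms[of "t + p * of_int i"] by (simp add: algebra_simps)
next
  case (step2 i)
  then show ?case using assms[of "t + p * of_int (i - 1)"] by (simp add: algebra_simps)
qed simp

lemma funpow_reflection_shift:
  fixes lam :: "real \<Rightarrow> real"
  assumes "\<And>t. lam (t + 2 * pi) = lam t - 2 * pi"
  shows "(lam ^^ n) (t + 2 * pi) = (lam ^^ n) t + (- 1) ^ n * (2 * pi)"
proof (induction n)
  case (Suc n)
  have "lam (x - 2 * pi) = lam x + 2 * pi" for x using assms[of "x - 2 * pi"] by simp
  with Suc assms show ?case by (cases "even n") simp_all
qed simp

context simple_lie_algebra
begin

text \<open>The n-th iterate of \<open>lam\<close> is a translation, which increases by 2 pi over a
  period, whereas an odd iterate of \<open>lam\<close> decreases by 2 pi.\<close>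

lemma second_kind_even_order:
  assumes \<sigma>: "\<sigma> \<in> Aut" and aut: "loop_aut cplx J br \<sigma> \<Phi>" and "second_kind cplx J br \<sigma> \<Phi>"
    and ord: "has_order_on (loop_alg \<sigma>) \<Phi> n"
  shows "even n"
proof -
  obtain lam \<phi> where lam: "smooth lam" "\<And>t. lam (t + 2 * pi) = lam t - 2 * pi"
    and \<phi>: "\<And>t. \<phi> t \<in> Aut" and form: "\<And>u. u \<in> loop_alg \<sigma> \<Longrightarrow> \<Phi> u = (\<lambda>t. \<phi> t (u (lam t)))"
    using assms(3) unfolding second_kind_def by blast
  have "\<exists>k::int. \<forall>t. (lam ^^ n) t = t + 2 * pi * of_int k"
  proof (rule second_kind_finite_order[where \<sigma> = \<sigma> and \<Phi> = \<Phi> and \<phi> = \<phi>])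
    show "\<forall>u\<in>loop_alg \<sigma>. (\<Phi> ^^ n) u = u" using ord by (simp add: has_order_on_def)
    show "\<Phi> u t = \<phi> t (u (lam t))" if "u \<in> loop_alg \<sigma>" for u t by (simp only: form[OF that])
    show "\<Phi> u \<in> loop_alg \<sigma>" if "u \<in> loop_alg \<sigma>" for u
      by (rule loop_iso_in[OF aut[unfolded loop_aut_def] that])
  qed (intro \<sigma> \<phi> smooth_continuous lam)+
  then obtain k :: int where "\<And>t. (lam ^^ n) t = t + 2 * pi * of_int k" by blast
  with funpow_reflection_shift[where lam = lam and n = n and t = 0, OF lam(2)] show "even n" by (cases "even n") simp_all
qed

end

text \<open>\<open>lam'\<close> has no zero because \<open>inv lam\<close> is differentiable. Over
  one period the mean value theorem finds a point where \<open>lam'\<close> is -1, and connectedness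
  fixes the sign.\<close>

lemma reflection_derivative_negative:
  fixes lam :: "real \<Rightarrow> real"
  assumes sm: "smooth lam" and bij: "bij lam" and smi: "smooth (inv lam)"
    and shift: "\<And>t. lam (t + 2 * pi) = lam t - 2 * pi"
    and lam': "\<And>t. (lam has_vector_derivative lam' t) (at t)" "smooth lam'"
  shows "lam' t < 0"
proof -
  obtain g' where g': "\<And>t. (inv lam has_vector_derivative g' t) (at t)" using smoothE[OF smi] by blast
  have nz: "lam' t \<noteq> 0" for t
  proof -
    have "((lam \<circ> inv lam) has_vector_derivative g' (lam t) *\<^sub>R lam' (inv lam (lam t))) (at (lam t))"
      by (rule vector_diff_chain_at[OF g' lam'(1)])
    moreover have "lam \<circ> inv lam = (\<lambda>t. t)" using bij by (simp add: fun_eq_iff bij_is_surj surj_f_inv_f)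
    ultimately have "g' (lam t) *\<^sub>R lam' (inv lam (lam t)) = 1"
      using vector_derivative_unique_at[OF _ has_vector_derivative_id, of _ "lam t"] by simp
    then show ?thesis using bij by (auto simp: bij_is_inj)
  qed
  have "\<exists>z>0. z < 2 * pi \<and> lam (2 * pi) - lam 0 = (2 * pi - 0) * lam' z"
    by (rule MVT2) (use lam' in \<open>auto simp: has_real_derivative_iff_has_vector_derivative\<close>)
  then obtain z where "2 * pi * lam' z = 2 * pi * (- 1)" using shift[of 0] by auto
  then have z: "lam' z = - 1" unfolding mult_cancel_left by simp
  have "connected (lam' ` UNIV)"
    by (rule connected_continuous_image[OF smooth_continuous[OF lam'(2)] connected_UNIV])
  then have "0 \<in> lam' ` UNIV" if "0 \<le> lam' t"
    using that z unfolding connected_iff_interval by (metis UNIV_I image_eqI zero_le_one neg_le_0_iff_le)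
  with nz show ?thesis by (metis imageE not_less)
qed

lemma strict_mono_finite_order:
  fixes f :: "real \<Rightarrow> real"
  assumes f: "strict_mono f" and fin: "(f ^^ m) t = t" and "0 < m"
  shows "f t = t"
proof (rule ccontr)
  assume "f t \<noteq> t"
  then consider "t < f t" | "f t < t" by linarith
  then show False
  proof cases
    case 1
    have "t < (f ^^ Suc j) t" for j
    proof (induction j)
      case (Suc j)
      then show ?case using 1 strict_monoD[OF f Suc] by simp
    qed (simp add: 1)
    with fin \<open>0 < m\<close> show False by (metis Suc_pred less_irrefl)
  next
    case 2
    have "(f ^^ Suc j) t < t" for j
    proof (induction j)
      case (Suc j)
      then show ?case using 2 strict_monoD[OF f Suc] by simp
    qed (simp add: 2)
    with fin \<open>0 < m\<close> show False by (metis Suc_pred less_irrefl)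
  qed
qed

text \<open>The iterate commutes with \<open>lam\<close>, but \<open>lam\<close> turns the
  translation by 2 pi k into the one by - 2 pi k; so \<open>k = 0\<close>. Then
  \<open>\<lambda>t. lam (lam t)\<close> is increasing of finite order, hence the identity.\<close>

lemma reflection_involution:
  fixes lam :: "real \<Rightarrow> real"
  assumes dec: "\<And>s t. s < t \<Longrightarrow> lam t < lam s" and shift: "\<And>t. lam (t + 2 * pi) = lam t - 2 * pi"
    and fin: "\<And>t. (lam ^^ (2 * m)) t = t + 2 * pi * of_int k" and m: "0 < m"
  shows "lam (lam t) = t"
proof -
  have "lam t + 2 * pi * of_int k = (lam ^^ (2 * m)) (lam t)" by (simp only: fin)
  also have "\<dots> = lam ((lam ^^ (2 * m)) t)" by (rule funpow_swap1[symmetric])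
  also have "\<dots> = lam (t + 2 * pi * of_int k)" by (simp only: fin)
  also have "\<dots> = lam t + - (2 * pi) * of_int k" by (rule shift_int) (simp add: shift)
  finally have "k = 0" by simp
  have "strict_mono (\<lambda>t. lam (lam t))" by (auto simp: strict_mono_def intro: dec)
  moreover have "((\<lambda>t. lam (lam t)) ^^ m) t = t"
  proof -
    have "(\<lambda>t. lam (lam t)) = lam ^^ 2" by (simp add: fun_eq_iff numeral_2_eq_2)
    then show ?thesis using fin[of t] \<open>k = 0\<close> by (simp add: funpow_mult mult.commute)
  qed
  ultimately show ?thesis by (rule strict_mono_finite_order[OF _ _ m])
qed

text \<open>The mean \<open>\<mu> t\<close> of \<open>t\<close> and \<open>- lam t\<close> satisfies
  \<open>\<mu> (lam t) = - \<mu> t\<close>, as \<open>lam\<close> is an involution; it is the new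
  parameter and \<open>\<kappa>\<close> its inverse.\<close>

lemma reflection_normal_form:
  fixes lam :: "real \<Rightarrow> real"
  assumes sm: "smooth lam" and shift: "\<And>t. lam (t + 2 * pi) = lam t - 2 * pi"
    and lam': "\<And>t. (lam has_vector_derivative lam' t) (at t)" and neg: "\<And>t. lam' t < 0"
    and invol: "\<And>t. lam (lam t) = t"
  obtains \<mu> \<kappa> where "smooth \<mu>" "smooth \<kappa>" "\<And>t. \<mu> (\<kappa> t) = t" "\<And>t. \<kappa> (\<mu> t) = t"
    "\<And>t. \<kappa> (t + 2 * pi) = \<kappa> t + 2 * pi" "\<And>t. lam (\<kappa> t) = \<kappa> (- t)"
proof -
  define \<mu> where "\<mu> t = (t - lam t) / 2" for t
  have sm\<mu>: "smooth \<mu>"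
    unfolding \<mu>_def divide_inverse by (intro smooth_mult smooth_diff smooth_const smooth_ident sm)
  have \<mu>': "(\<mu> has_vector_derivative (1 - lam' t) / 2) (at t)" for t
    using lam'[of t] unfolding \<mu>_def has_real_derivative_iff_has_vector_derivative[symmetric]
    by (auto intro!: derivative_eq_intros)
  have pos: "0 < (1 - lam' t) / 2" for t using neg[of t] by simp
  have mono: "\<mu> s < \<mu> t" if "s < t" for s t
  proof (rule DERIV_pos_imp_increasing[OF that])
    fix x show "\<exists>y. DERIV \<mu> x :> y \<and> 0 < y"
      using \<mu>'[of x] pos[of x] unfolding has_real_derivative_iff_has_vector_derivative by blast
  qed
  have \<mu>s: "\<mu> (t + 2 * pi) = \<mu> t + 2 * pi" for t unfolding \<mu>_def shift by (simp add: field_simps)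
  have \<mu>k: "\<mu> (0 + 2 * pi * of_int k) = \<mu> 0 + 2 * pi * of_int k" for k by (rule shift_int) (rule \<mu>s)
  have "\<exists>t. \<mu> t = y" for y
  proof -
    obtain r k where r: "y = r + 2 * pi * of_int k" "\<bar>r - \<mu> 0\<bar> \<le> pi" by (rule real_mod_2pi)
    have "\<mu> (0 + 2 * pi * of_int (k - 1)) \<le> y" "y \<le> \<mu> (0 + 2 * pi * of_int (k + 1))"
      unfolding \<mu>k using r pi_ge_zero by (auto simp: algebra_simps abs_le_iff)
    then show ?thesis
      using IVT'[of \<mu> "0 + 2 * pi * of_int (k - 1)" y "0 + 2 * pi * of_int (k + 1)"]
        smooth_continuous[OF sm\<mu>] by (auto simp: algebra_simps)
  qed
  then obtain \<kappa> where \<mu>\<kappa>: "\<And>t. \<mu> (\<kappa> t) = t" by metis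
  have inj: "s = t" if "\<mu> s = \<mu> t" for s t using that mono[of s t] mono[of t s] by force
  have \<kappa>\<mu>: "\<kappa> (\<mu> t) = t" for t by (rule inj) (rule \<mu>\<kappa>)
  show ?thesis
  proof (rule that[OF sm\<mu> _ \<mu>\<kappa> \<kappa>\<mu>])
    show "smooth \<kappa>" by (rule smooth_inverse_function[OF sm\<mu> \<mu>' pos \<mu>\<kappa> \<kappa>\<mu>])
    show "\<kappa> (t + 2 * pi) = \<kappa> t + 2 * pi" for t by (rule inj) (simp only: \<mu>\<kappa> \<mu>s)
    have "\<mu> (lam t) = - \<mu> t" for t by (simp only: \<mu>_def invol minus_divide_left minus_diff_eq)
    then have "\<mu> (lam (\<kappa> t)) = \<mu> (\<kappa> (- t))" for t by (simp only: \<mu>\<kappa>)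
    then show "lam (\<kappa> t) = \<kappa> (- t)" for t by (rule inj)
  qed
qed

context simple_lie_algebra
begin

lemma second_kind_normal_form:
  assumes x: "x \<in> aut2_ord cplx J br q" and q: "even q"
  shows "\<exists>p\<in>Jpairs cplx J br q. quasiconj cplx J br x (explicit_aut p)"
proof -
  obtain \<sigma> \<Phi> where x_eq: "x = (\<sigma>, \<Phi>)" and \<sigma>: "\<sigma> \<in> Aut" and aut: "loop_aut cplx J br \<sigma> \<Phi>"
    and sk: "second_kind cplx J br \<sigma> \<Phi>" and ord: "has_order_on (loop_alg \<sigma>) \<Phi> q"
    using x by (auto simp: aut2_ord_def)
  obtain lam \<phi> where lam: "smooth lam" "bij lam" "smooth (inv lam)" "\<And>t. lam (t + 2 * pi) = lam t - 2 * pi"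
    and \<phi>: "\<And>t. \<phi> t \<in> Aut" "smooth (\<lambda>t. Blinfun (\<phi> t))" "\<And>t. \<phi> (t + 2 * pi) = \<sigma> \<circ> \<phi> t \<circ> \<sigma>"
    and form: "\<And>u. u \<in> loop_alg \<sigma> \<Longrightarrow> \<Phi> u = (\<lambda>t. \<phi> t (u (lam t)))"
    using sk unfolding second_kind_def by blast
  define m where "m = q div 2"
  have m: "0 < m" "q = 2 * m" using q ord by (auto simp: m_def has_order_on_def elim!: evenE)
  have stable: "\<Phi> u \<in> loop_alg \<sigma>" if "u \<in> loop_alg \<sigma>" for u
    using loop_iso_in[OF aut[unfolded loop_aut_def] that] .
  have fin: "\<forall>u\<in>loop_alg \<sigma>. (\<Phi> ^^ (2 * m)) u = u" using ord by (simp add: has_order_on_def m)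
  have formt: "\<Phi> u t = \<phi> t (u (lam t))" if "u \<in> loop_alg \<sigma>" for u t by (simp only: form[OF that])
  obtain k :: int where k: "\<And>t. (lam ^^ (2 * m)) t = t + 2 * pi * of_int k"
    using second_kind_finite_order[where \<sigma> = \<sigma> and \<Phi> = \<Phi> and \<phi> = \<phi> and lam = lam,
      OF \<sigma> stable \<phi>(1) formt smooth_continuous[OF lam(1)] fin] by auto
  obtain lam' where lam': "\<And>t. (lam has_vector_derivative lam' t) (at t)" "smooth lam'"
    using smoothE[OF lam(1)] by blast
  note neg = reflection_derivative_negative[OF lam lam']
  have dec: "lam t < lam s" if "s < t" for s t
    using that by (rule DERIV_neg_imp_decreasing)
      (use lam' neg in \<open>auto simp: has_real_derivative_iff_has_vector_derivative\<close>)
  have invol: "lam (lam t) = t" for t by (rule reflection_involution[OF dec lam(4) k m(1)])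
  obtain \<mu> \<kappa> where \<mu>: "smooth \<mu>" and \<kappa>: "smooth \<kappa>" "\<And>t. \<mu> (\<kappa> t) = t" "\<And>t. \<kappa> (\<mu> t) = t"
    "\<And>t. \<kappa> (t + 2 * pi) = \<kappa> t + 2 * pi" "\<And>t. lam (\<kappa> t) = \<kappa> (- t)"
    using reflection_normal_form[OF lam(1,4) lam'(1) neg invol] by blast
  define s where "s = endo_of \<sigma>"
  have s: "s \<in> G" "app s = \<sigma>" using endo_of_aut[OF \<sigma>] by (simp_all add: s_def)
  note is0 = aut_grp_inverse[OF s(1)]
  define P0 where "P0 t = endo_of (\<phi> t)" for t
  have P0: "P0 t \<in> G" "app (P0 t) = \<phi> t" for t using endo_of_aut[OF \<phi>(1)] by (simp_all add: P0_def)
  have smP0: "smooth P0"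
    unfolding P0_def endo_of_def by (rule smooth_linear[OF bounded_linear_Endo \<phi>(2)])
  have P0s: "P0 (t + 2 * pi) = s * P0 t * s" for t
    by (rule endo_eqI) (simp add: P0 s \<phi>)
  have pow: "(\<Phi> ^^ (2 * j)) u \<in> loop_alg \<sigma> \<and>
      (\<forall>t. (\<Phi> ^^ (2 * j)) u t = app ((P0 t * P0 (lam t)) ^ j) (u t))" if u: "u \<in> loop_alg \<sigma>" for u j
  proof (induction j)
    case (Suc j)
    let ?v = "(\<Phi> ^^ (2 * j)) u"
    have v: "?v \<in> loop_alg \<sigma>" using Suc by simp
    have eq: "(\<Phi> ^^ (2 * Suc j)) u = \<Phi> (\<Phi> ?v)" by simp
    have val: "\<Phi> (\<Phi> ?v) t = app (P0 t * P0 (lam t)) (?v t)" for t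
      by (simp only: formt[OF stable[OF v]] formt[OF v] P0 invol app_mult)
    have vt: "?v t = app ((P0 t * P0 (lam t)) ^ j) (u t)" for t using Suc by blast
    show ?case
    proof (intro conjI allI)
      show "(\<Phi> ^^ (2 * Suc j)) u \<in> loop_alg \<sigma>" unfolding eq by (rule stable[OF stable[OF v]])
      show "(\<Phi> ^^ (2 * Suc j)) u t = app ((P0 t * P0 (lam t)) ^ Suc j) (u t)" for t
        unfolding eq val vt power_Suc by (simp only: app_mult)
    qed
  qed (simp add: u)
  define P where "P t = P0 (\<kappa> t)" for t
  have P: "P t \<in> G" for t by (simp add: P_def P0)
  have smP: "smooth P" unfolding P_def by (rule smooth_compose[OF smP0 \<kappa>(1)])
  have Ps: "P (t + 2 * pi) = s * P t * s" for t by (simp add: P_def \<kappa> P0s)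
  have fixed: "(P t * P (- t)) ^ j = 1" if "\<forall>u\<in>loop_alg \<sigma>. (\<Phi> ^^ (2 * j)) u = u" for j t
  proof (rule loops_determine[OF s(1), where r = "\<kappa> t"])
    fix u assume u: "u \<in> loop_alg (app s)"
    then show "app ((P t * P (- t)) ^ j) (u (\<kappa> t)) = app 1 (u (\<kappa> t))"
      using pow[of u j] that by (simp add: s P_def \<kappa>(5)[symmetric])
  qed
  obtain P' where P': "\<And>t. (P has_vector_derivative P' t) (at t)" "smooth P'" using smoothE[OF smP] by blast
  obtain h where h: "smooth h" "\<And>t. h t \<in> G" "h 0 = 1"
    "\<And>t. P t * h (- t) = h t * P 0" "\<And>t. h (t + 2 * pi) = s * h t * (einv s * h (2 * pi))"
    by (rule gauge_normal_form[OF bilin P smP P' s(1) Ps m(1) fixed[OF fin]]) blast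
  note ih = aut_grp_inverse[OF h(2)]
  define A where "A = P 0"
  \<comment> \<open>The twist left after the gauge transformation is \<open>einv c\<close>; this
    forces \<open>A * c\<close> as the second entry, since
    \<open>einv (A * c) * A = einv c\<close>.\<close>
  define c where "c = einv s * h (2 * pi)"
  have A: "A \<in> G" and c: "c \<in> G" unfolding A_def c_def by (intro P aut_grp_mult aut_grp_einv s h)+
  note iA = aut_grp_inverse[OF A] and ic = aut_grp_inverse[OF c]
  note h4 = h(4)[folded A_def] and h5 = h(5)[folded c_def]
  \<comment> \<open>Compares the relation \<open>P t * h (- t) = h t * A\<close> at pi and at
    \<open>- pi\<close> through the twists of \<open>P\<close> and \<open>h\<close>. It gives
    \<open>A * c\<close> the same square as \<open>A\<close>.\<close>
  have cA: "c * A = A * einv c"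
  proof -
    have hp: "h pi = s * h (- pi) * c" using h5[of "- pi"] by simp
    have Pp: "P pi = s * P (- pi) * s" using Ps[of "- pi"] by simp
    have "h pi * A = s * P (- pi) * (s * h (- pi))" using h4[of pi] by (simp add: Pp mult.assoc)
    also have "s * h (- pi) = h pi * einv c" by (simp add: hp mult.assoc ic)
    also have "s * P (- pi) * (h pi * einv c) = s * (P (- pi) * h (- (- pi))) * einv c" by (simp add: mult.assoc)
    also have "\<dots> = s * h (- pi) * A * einv c" by (simp only: h4 mult.assoc)
    also have "s * h (- pi) = h pi * einv c" by (simp add: hp mult.assoc ic)
    finally have "c * (einv (h pi) * (h pi * A)) = c * (einv (h pi) * (h pi * einv c * A * einv c))"
      by (simp only:)
    then show ?thesis by (simp add: mult.assoc ih ic)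
  qed
  have Ac: "A * c \<in> G" by (intro aut_grp_mult A c)
  have sq: "A * A = A * c * (A * c)"
  proof -
    have "A * c * (A * c) = A * (c * A) * c" by (simp only: mult.assoc)
    then show ?thesis by (simp add: cA mult.assoc ic)
  qed
  \<comment> \<open>The square of the automorphism is pointwise conjugate to \<open>A * A\<close>,
    so the two have the same order.\<close>
  have R: "P t * P (- t) = h t * (A * A) * einv (h t)" for t
  proof -
    have "P t = h t * A * einv (h (- t))" for t
      using h4[of t] aut_grp_inverse[OF h(2)] by (metis mult.assoc mult.right_neutral)
    from this[of t] this[of "- t"] show ?thesis by (simp add: mult.assoc ih)
  qed
  have Rpow: "(P t * P (- t)) ^ j = h t * (A * A) ^ j * einv (h t)" for t j
    unfolding R by (induction j) (simp_all add: mult.assoc ih)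
  have "(app A, app (A * c)) \<in> Jpairs cplx J br q"
    unfolding Jpairs_app has_order_on_app m_def[symmetric]
  proof (intro conjI allI impI A Ac sq m(1))
    show "(A * A) ^ m = 1" using fixed[OF fin, of 0] by (simp add: A_def)
    fix j assume j: "0 < j \<and> j < m"
    show "(A * A) ^ j \<noteq> 1"
    proof
      assume "(A * A) ^ j = 1"
      then have one: "(P t * P (- t)) ^ j = 1" for t by (simp add: Rpow ih)
      have "(P0 t * P0 (lam t)) ^ j = 1" for t
        using one[of "\<mu> t"] by (simp add: P_def \<kappa>(3) \<kappa>(5)[symmetric])
      then have "\<forall>u\<in>loop_alg \<sigma>. (\<Phi> ^^ (2 * j)) u = u" using pow by (simp add: fun_eq_iff)
      moreover have "0 < 2 * j \<and> 2 * j < q" using j m by simp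
      moreover have "\<forall>m. 0 < m \<and> m < q \<longrightarrow> \<not> (\<forall>u\<in>loop_alg \<sigma>. (\<Phi> ^^ m) u = u)"
        using ord unfolding has_order_on_def by blast
      ultimately show False by blast
    qed
  qed
  moreover have "quasiconj cplx J br x (explicit_aut (app A, app (A * c)))"
  proof -
    have c': "einv (A * c) * A = einv c" by (simp add: einv_mult[OF A c] mult.assoc iA)
    have "loop_iso cplx J br (app s) (app (einv c)) (\<lambda>u t. app (einv (h t)) (u (\<kappa> t)))"
    proof (rule loop_iso_orientation_preserving[where \<kappa> = \<mu>])
      fix t
      have "einv (h (t + 2 * pi)) = einv c * (einv (h t) * einv s)"
        unfolding h5 using einv_mult[OF aut_grp_mult[OF s(1) h(2)] c] einv_mult[OF s(1) h(2)] by simp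
      then show "einv (h (t + 2 * pi)) * s = einv c * einv (h t)" by (simp add: mult.assoc is0)
    qed (auto intro: smooth_einv h aut_grp_einv s c \<mu> \<kappa> simp: \<kappa>)
    moreover have "app A (app (einv (h (- t))) (u (\<kappa> (- t)))) = app (einv (h t)) (\<Phi> u (\<kappa> t))"
      if "u \<in> loop_alg \<sigma>" for u t
    proof -
      have "einv (h t) * (P t * h (- t)) * einv (h (- t)) = einv (h t) * (h t * A) * einv (h (- t))"
        by (simp only: h4)
      then have "A * einv (h (- t)) = einv (h t) * P t" by (simp add: mult.assoc ih)
      then have "app A (app (einv (h (- t))) y) = app (einv (h t)) (app (P t) y)" for y
        by (metis app_mult)
      then show ?thesis by (simp add: form[OF that] P_def P0 \<kappa>)
    qed
    ultimately show ?thesis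
      unfolding quasiconj_def x_eq explicit_aut_app[OF Ac] c'
      by (intro exI[of _ "\<lambda>u t. app (einv (h t)) (u (\<kappa> t))"]) (simp add: s fun_eq_iff)
  qed
  ultimately show ?thesis by blast
qed

end

section \<open>Quasiconjugate automorphisms come from equivalent pairs\<close>

context simple_lie_algebra
begin

lemma loop_iso_degree:
  assumes s: "s \<in> G" and s': "s' \<in> G" and iso: "loop_iso cplx J br (app s) (app s') \<psi>"
    and \<mu>: "continuous_on UNIV \<mu>" and h: "\<And>t. h t \<in> Aut"
    and form: "\<And>u t. u \<in> loop_alg (app s) \<Longrightarrow> \<psi> u t = h t (u (\<mu> t))"
  shows "\<exists>d::int. \<forall>t. \<mu> (t + 2 * pi) = \<mu> t + 2 * pi * of_int d"
proof -
  have "\<exists>k::int. \<mu> (t + 2 * pi) - \<mu> t = 2 * pi * of_int k" for t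
  proof -
    have "\<exists>k::int. \<mu> (t + 2 * pi) = \<mu> t + 2 * pi * of_int k"
    proof (rule loops_distinguish[OF s endo_of_aut(1)[OF h]])
      fix u assume u: "u \<in> loop_alg (app s)"
      have "\<psi> u (t + 2 * pi) = app s' (\<psi> u t)"
        by (rule loop_alg_shift[OF loop_iso_in[OF iso u]])
      then show "app (endo_of (h (t + 2 * pi))) (u (\<mu> (t + 2 * pi))) = app (s' * endo_of (h t)) (u (\<mu> t))"
        by (simp add: form[OF u] endo_of_aut(2)[OF h])
    qed
    then show ?thesis by auto
  qed
  moreover have "continuous_on UNIV (\<lambda>t. \<mu> (t + 2 * pi) - \<mu> t)"
    by (intro continuous_on_diff \<mu> continuous_on_compose2[OF \<mu>] continuous_intros) auto
  ultimately obtain d :: int where "\<forall>t. \<mu> (t + 2 * pi) - \<mu> t = 2 * pi * of_int d"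
    using continuous_int_multiple_const[of "\<lambda>t. \<mu> (t + 2 * pi) - \<mu> t"] by blast
  then have "\<mu> (t + 2 * pi) = \<mu> t + 2 * pi * of_int d" for t
    by (simp add: diff_eq_eq add.commute)
  then show ?thesis by blast
qed

text \<open>\<open>\<mu>\<close> is only known to be continuous, so its orientation is its degree.
  The inverse isomorphism has a degree too, and the product of the two integers is 1.\<close>

lemma loop_iso_degree_unit:
  assumes s: "s \<in> G" and s': "s' \<in> G" and iso: "loop_iso cplx J br (app s) (app s') \<psi>"
    and \<mu>: "continuous_on UNIV \<mu>" and h: "\<And>t. h t \<in> Aut"
    and form: "\<And>u t. u \<in> loop_alg (app s) \<Longrightarrow> \<psi> u t = h t (u (\<mu> t))"
  shows "(\<forall>t. \<mu> (t + 2 * pi) = \<mu> t + 2 * pi) \<or> (\<forall>t. \<mu> (t + 2 * pi) = \<mu> t - 2 * pi)"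
proof -
  let ?\<xi> = "inv_into (loop_alg (app s)) \<psi>"
  have inv: "loop_iso cplx J br (app s') (app s) ?\<xi>"
    by (rule loop_iso_inverse[OF app_aut[OF s] app_aut[OF s'] iso])
  obtain \<nu> k where \<nu>: "continuous_on UNIV \<nu>" and k: "\<And>t. k t \<in> Aut"
    and form': "\<And>u t. u \<in> loop_alg (app s') \<Longrightarrow> ?\<xi> u t = k t (u (\<nu> t))"
    using loop_iso_form[OF app_aut[OF s'] app_aut[OF s] inv] by metis
  obtain d :: int where d: "\<And>t. \<mu> (t + 2 * pi) = \<mu> t + 2 * pi * of_int d"
    using loop_iso_degree[OF s s' iso \<mu> h form] by blast
  obtain e :: int where e: "\<And>t. \<nu> (t + 2 * pi) = \<nu> t + 2 * pi * of_int e"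
    using loop_iso_degree[OF s' s inv \<nu> k form'] by blast
  have inj: "inj_on \<psi> (loop_alg (app s))" using iso by (simp add: loop_iso_def bij_betw_def)
  have "\<exists>c::int. \<mu> (\<nu> t) - t = 2 * pi * of_int c" for t
  proof -
    have "\<exists>c::int. \<mu> (\<nu> t) = t + 2 * pi * of_int c"
    proof (rule loops_distinguish[OF s aut_grp_mult[OF endo_of_aut(1)[OF k] endo_of_aut(1)[OF h]]])
      fix u assume u: "u \<in> loop_alg (app s)"
      have "u t = k t (h (\<nu> t) (u (\<mu> (\<nu> t))))"
        using form'[OF loop_iso_in[OF iso u], of t] form[OF u] inv_into_f_f[OF inj u] by simp
      then show "app (endo_of (k t) * endo_of (h (\<nu> t))) (u (\<mu> (\<nu> t))) = app 1 (u t)"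
        by (simp add: endo_of_aut(2)[OF k] endo_of_aut(2)[OF h])
    qed
    then show ?thesis by auto
  qed
  moreover have "continuous_on UNIV (\<lambda>t. \<mu> (\<nu> t) - t)"
    by (intro continuous_on_diff continuous_on_compose2[OF \<mu> \<nu>] continuous_on_id) auto
  ultimately obtain c :: int where c: "\<And>t. \<mu> (\<nu> t) - t = 2 * pi * of_int c"
    using continuous_int_multiple_const[of "\<lambda>t. \<mu> (\<nu> t) - t"] by blast
  have "\<mu> (\<nu> (0 + 2 * pi)) = \<mu> (\<nu> 0) + (2 * pi * of_int d) * of_int e"
    unfolding e by (rule shift_int) (rule d)
  then have "2 * pi * of_int (d * e) = 2 * pi * 1"
    using c[of 0] c[of "0 + 2 * pi"] by simp
  then have "real_of_int (d * e) = 1" unfolding mult_cancel_left by simp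
  then have "d * e = 1" by linarith
  then have "d = 1 \<or> d = - 1" by (rule zmult_eq_1_iff[THEN iffD1, THEN disj_forward]) auto
  then show ?thesis using d by auto
qed

lemma Jsim_step: "gen_step cplx J br p p' \<Longrightarrow> Jsim cplx J br p p'"
  by (auto simp: Jsim_def)

lemma Jsim_trans: "Jsim cplx J br p p' \<Longrightarrow> Jsim cplx J br p' p'' \<Longrightarrow> Jsim cplx J br p p''"
  by (simp add: Jsim_def)

lemma Jsim_conj:
  assumes A: "A \<in> G" and B: "B \<in> G" and E: "E \<in> G"
  shows "Jsim cplx J br (app A, app B) (app (E * A * einv E), app (E * B * einv E))"
proof -
  have "einv E * E \<in> {1}" using aut_grp_inverse[OF E] by simp
  then show ?thesis
    by (intro Jsim_step gen_step_conj[OF A B E E, of "{1}"]) (auto intro: aut_grp_one)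
qed

lemma Jsim_swap: "A \<in> G \<Longrightarrow> B \<in> G \<Longrightarrow> Jsim cplx J br (app A, app B) (app B, app A)"
  by (rule Jsim_step) (simp add: gen_step_def app_aut)

text \<open>An isomorphism intertwining the two automorphisms covers a self-map \<open>\<mu>\<close> of the circle commuting
  with \<open>t \<mapsto> - t\<close>, so it permutes the fixed points 0 and \<open>pi\<close>; the four cases are whether \<open>\<mu>\<close> fixes or
  swaps them and whether it preserves the orientation.\<close>
lemma quasiconj_Jsim:
  assumes p: "p \<in> Jpairs cplx J br q" and p': "p' \<in> Jpairs cplx J br q"
    and qc: "quasiconj cplx J br (explicit_aut p) (explicit_aut p')"
  shows "Jsim cplx J br p p'"
proof -
  obtain A B where p_eq: "p = (app A, app B)" and A: "A \<in> G" and B: "B \<in> G" and AB: "A * A = B * B"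
    using p by (rule JpairsE)
  obtain A' B' where p'_eq: "p' = (app A', app B')" and A': "A' \<in> G" and B': "B' \<in> G" and AB': "A' * A' = B' * B'"
    using p' by (rule JpairsE)
  define s where "s = einv B * A"
  define s' where "s' = einv B' * A'"
  note rel = pair_relations[OF A B AB, folded s_def]
  note rel' = pair_relations[OF A' B' AB', folded s'_def]
  note s = rel(1) and s' = rel'(1)
  note iA = aut_grp_inverse[OF A] and iB = aut_grp_inverse[OF B] and is0 = aut_grp_inverse[OF s]
    and is1 = aut_grp_inverse[OF s'] and iA' = aut_grp_inverse[OF A'] and iB' = aut_grp_inverse[OF B']
  obtain \<psi> where iso: "loop_iso cplx J br (app s) (app s') \<psi>"
    and tw: "\<And>u. u \<in> loop_alg (app s) \<Longrightarrow> (\<lambda>t. app A' (\<psi> u (- t))) = \<psi> (\<lambda>t. app A (u (- t)))"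
    using qc unfolding quasiconj_def p_eq p'_eq explicit_aut_app[OF B] explicit_aut_app[OF B']
    by (auto simp: s_def s'_def)
  obtain \<mu> h where \<mu>: "continuous_on UNIV \<mu>" "0 \<le> \<mu> 0" "\<mu> 0 < 2 * pi" and h: "\<And>t. h t \<in> Aut"
    "continuous_on UNIV (\<lambda>t. endo_of (h t))" and form: "\<And>u t. u \<in> loop_alg (app s) \<Longrightarrow> \<psi> u t = h t (u (\<mu> t))"
    using loop_iso_form[OF app_aut[OF s] app_aut[OF s'] iso] by metis
  define H where "H t = endo_of (h t)" for t
  have H: "H t \<in> G" "app (H t) = h t" for t using endo_of_aut[OF h(1)] by (simp_all add: H_def)
  note iH = aut_grp_inverse[OF H(1)]
  have stable: "(\<lambda>t. app A (u (- t))) \<in> loop_alg (app s)" if "u \<in> loop_alg (app s)" for u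
    using loop_iso_in[OF explicit_iso[OF A B AB] that[unfolded s_def]] by (simp add: s_def)
  have E1: "app (H t * A) (u (- \<mu> t)) = app (A' * H (- t)) (u (\<mu> (- t)))" if u: "u \<in> loop_alg (app s)" for u t
    using fun_cong[OF tw[OF u], of t] by (simp add: form[OF u] form[OF stable[OF u]] H)
  have E2: "app (H (t + 2 * pi)) (u (\<mu> (t + 2 * pi))) = app (s' * H t) (u (\<mu> t))" if u: "u \<in> loop_alg (app s)" for u t
    using loop_alg_shift[OF loop_iso_in[OF iso u], of t] by (simp add: form[OF u] H)
  have "\<exists>k::int. \<mu> t + \<mu> (- t) = 2 * pi * of_int k" for t
  proof -
    have "\<exists>k::int. - \<mu> t = \<mu> (- t) + 2 * pi * of_int k"
      by (rule loops_distinguish[OF s aut_grp_mult[OF H(1) A] E1])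
    then obtain k :: int where "- \<mu> t = \<mu> (- t) + 2 * pi * of_int k" by blast
    then have "\<mu> t + \<mu> (- t) = 2 * pi * of_int (- k)" by simp
    then show ?thesis by blast
  qed
  moreover have "continuous_on UNIV (\<lambda>t. \<mu> t + \<mu> (- t))"
    by (intro continuous_on_add \<mu> continuous_on_compose2[OF \<mu>(1)] continuous_intros) auto
  ultimately obtain K :: int where K: "\<And>t. \<mu> t + \<mu> (- t) = 2 * pi * of_int K"
    using continuous_int_multiple_const[of "\<lambda>t. \<mu> t + \<mu> (- t)"] by blast
  \<comment> \<open>At \<open>t = 0\<close> this reads \<open>\<mu> 0 = pi * K\<close>, and
    \<open>\<mu> 0\<close> lies in [0, 2 pi): the fixed point 0 goes to 0 or to pi.\<close>
  have K01: "K = 0 \<or> K = 1"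
  proof -
    have "\<mu> 0 = pi * of_int K" using K[of 0] by simp
    then have "0 \<le> real_of_int K" "real_of_int K < 2"
      using \<mu>(2,3) pi_gt_zero by (auto simp: zero_le_mult_iff)
    then show ?thesis by linarith
  qed
  have \<mu>K: "\<mu> (- t) = - \<mu> t + 2 * pi * of_int K" for t using K[of t] by simp
  have R0: "H t * A = A' * H (- t)" if "K = 0" for t
    by (rule loops_determine[OF s, where r = "- \<mu> t"]) (use E1 \<mu>K that in simp)
  have R1: "H t * A = A' * H (- t) * s" if "K = 1" for t
  proof (rule loops_determine[OF s, where r = "- \<mu> t"])
    fix u assume u: "u \<in> loop_alg (app s)"
    show "app (H t * A) (u (- \<mu> t)) = app (A' * H (- t) * s) (u (- \<mu> t))"
      using E1[OF u, of t] \<mu>K[of t] that loop_alg_shift[OF u, of "- \<mu> t"] by simp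
  qed
  \<comment> \<open>\<open>H t\<close> intertwines the squares of the two automorphisms; hence
    \<open>einv (H 0) * H t\<close> moves inside the centralizer of \<open>A * A\<close>.\<close>
  have comm: "H t * (A * A) = A' * A' * H t" for t
    using K01
  proof
    assume "K = 0"
    then show ?thesis using R0[of t] R0[of "- t"] by (metis mult.assoc minus_minus)
  next
    assume "K = 1"
    have "H t * (A * A) = A' * (H (- t) * (s * A))" using R1[OF \<open>K = 1\<close>, of t] by (metis mult.assoc)
    also have "s * A = A * einv s" by (simp only: rel)
    also have "A' * (H (- t) * (A * einv s)) = A' * (H (- t) * A) * einv s" by (simp only: mult.assoc)
    also have "\<dots> = A' * (A' * H t * s) * einv s" using R1[OF \<open>K = 1\<close>, of "- t"] by simp
    finally show ?thesis by (simp add: mult.assoc is0)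
  qed
  let ?T = "(\<lambda>t. einv (H 0) * H t) ` {0..pi}"
  have T: "connected ?T" "1 \<in> ?T" "einv (H 0) * H pi \<in> ?T"
  proof -
    have "continuous_on {0..pi} (\<lambda>t. einv (H 0) * H t)"
      unfolding H_def by (intro continuous_on_mult continuous_on_const continuous_on_subset[OF h(2)]) auto
    then show "connected ?T" by (rule connected_continuous_image) simp
    show "1 \<in> ?T" by (rule image_eqI[of _ _ 0]) (simp_all add: iH)
  qed auto
  have TG: "?T \<subseteq> aut_grp br (insert (A * A) commutant)"
  proof clarify
    fix t
    have "einv (H 0) * H t * (A * A) = einv (H 0) * (A' * A' * H 0) * einv (H 0) * H t"
      by (simp add: mult.assoc comm[unfolded mult.assoc] iH)
    also have "\<dots> = einv (H 0) * (H 0 * (A * A)) * einv (H 0) * H t" by (simp only: comm)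
    also have "\<dots> = A * A * (einv (H 0) * H t)" by (simp add: mult.assoc iH)
    finally show "einv (H 0) * H t \<in> aut_grp br (insert (A * A) commutant)"
      by (simp add: aut_grp_insert aut_grp_mult aut_grp_einv H)
  qed
  have B's: "A' * einv s' = B'" by (rule rel'(3))
  \<comment> \<open>Around the fixed point pi j of the reflection the first automorphism acts by
    \<open>A\<close> times the j-th power of \<open>einv s\<close>. \<open>X\<close> and
    \<open>Y\<close> are these operators at \<open>\<mu> 0\<close> and \<open>\<mu> pi\<close>;
    \<open>H 0\<close> and \<open>H pi\<close> conjugate them to \<open>A'\<close> and
    \<open>B'\<close>.\<close>
  have final: "Jsim cplx J br p p'"
    if X: "X \<in> G" and Y: "Y \<in> G" and sim: "Jsim cplx J br p (app X, app Y)" and XX: "X * X = A * A"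
      and X': "H 0 * X = A' * H 0" and Y': "H pi * Y = B' * H pi" for X Y
  proof -
    have "H 0 * X * einv (H 0) = A'" "H pi * Y * einv (H pi) = B'"
      unfolding X' Y' by (simp_all add: mult.assoc iH)
    then have "gen_step cplx J br (app X, app Y) p'"
      using gen_step_conj[OF X Y H(1) H(1), of ?T 0 pi] T TG by (simp add: p'_eq XX)
    with sim show ?thesis using Jsim_step Jsim_trans by blast
  qed
  have shift_pi: "- pi + 2 * pi = pi" by simp
  from loop_iso_degree_unit[OF s s' iso \<mu>(1) h(1) form] show ?thesis
  proof
    assume d: "\<forall>t. \<mu> (t + 2 * pi) = \<mu> t + 2 * pi"
    have R2: "H (t + 2 * pi) * s = s' * H t" for t
    proof (rule loops_determine[OF s, where r = "\<mu> t"])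
      fix u assume u: "u \<in> loop_alg (app s)"
      show "app (H (t + 2 * pi) * s) (u (\<mu> t)) = app (s' * H t) (u (\<mu> t))"
        using E2[OF u, of t] loop_alg_shift[OF u, of "\<mu> t"] d by simp
    qed
    have "H pi * s = s' * H (- pi)" using R2[of "- pi"] by simp
    then have Hm: "H (- pi) = einv s' * H pi * s" by (simp add: mult.assoc is1)
    from K01 show ?thesis
    proof
      assume K0: "K = 0"
      have "H pi * (A * einv s) = A' * H (- pi) * einv s" using R0[OF K0, of pi] by (metis mult.assoc)
      also have "\<dots> = A' * einv s' * H pi" by (simp add: Hm mult.assoc is0)
      finally have "H pi * B = B' * H pi" by (simp only: rel(3) B's)
      moreover have "Jsim cplx J br p (app A, app B)" by (simp add: p_eq Jsim_def)
      ultimately show ?thesis using final[OF A B _ refl] R0[OF K0, of 0] by simp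
    next
      \<comment> \<open>\<open>\<mu> 0 = pi\<close> and \<open>\<mu> pi = 2 * pi\<close>: the
        operators are \<open>B\<close> and \<open>B * A * einv B\<close>, that is, the swapped pair
        conjugated by \<open>B\<close>.\<close>
      assume K1: "K = 1"
      have "H 0 * (A * einv s) = A' * H 0 * s * einv s" using R1[OF K1, of 0] by (metis mult.assoc minus_zero)
      then have X': "H 0 * B = A' * H 0" by (simp add: rel(3) mult.assoc is0)
      have "H pi * A * einv s * einv s = A' * H (- pi) * s * einv s * einv s" using R1[OF K1, of pi] by simp
      also have "\<dots> = A' * einv s' * H pi" by (simp add: Hm mult.assoc is0)
      finally have "H pi * (A * einv s * einv s) = B' * H pi" by (simp add: B's mult.assoc)
      moreover have "A * einv s * einv s = B * A * einv B"
      proof -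
        have "einv s = einv A * B" unfolding s_def by (rule einv_unique) (simp add: mult.assoc iA iB)
        moreover have "einv A * B = A * einv B"
        proof -
          have "einv A * B = einv A * (B * B) * einv B" by (simp add: mult.assoc iB)
          then show ?thesis by (simp add: AB[symmetric] iA)
        qed
        ultimately show ?thesis by (metis rel(3) mult.assoc)
      qed
      ultimately have Y': "H pi * (B * A * einv B) = B' * H pi" by simp
      have "Jsim cplx J br (app B, app A) (app (B * B * einv B), app (B * A * einv B))"
        by (rule Jsim_conj[OF B A B])
      then have "Jsim cplx J br p (app B, app (B * A * einv B))"
        using Jsim_trans[OF Jsim_swap[OF A B]] by (simp add: p_eq mult.assoc iB)
      then show ?thesis
        using final[OF B aut_grp_mult[OF aut_grp_mult[OF B A] aut_grp_einv[OF B]] _ AB[symmetric] X' Y'] by blast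
    qed
  next
    assume d: "\<forall>t. \<mu> (t + 2 * pi) = \<mu> t - 2 * pi"
    have R2: "H (t + 2 * pi) = s' * H t * s" for t
    proof (rule loops_determine[OF s, where r = "\<mu> t - 2 * pi"])
      fix u assume u: "u \<in> loop_alg (app s)"
      show "app (H (t + 2 * pi)) (u (\<mu> t - 2 * pi)) = app (s' * H t * s) (u (\<mu> t - 2 * pi))"
        using E2[OF u, of t] loop_alg_shift[OF u, of "\<mu> t - 2 * pi"] d by simp
    qed
    have "H pi = s' * H (- pi) * s" using R2[of "- pi"] by simp
    then have Hm: "H (- pi) = einv s' * H pi * einv s" by (simp add: mult.assoc is0 is1)
    from K01 show ?thesis
    proof
      \<comment> \<open>\<open>\<mu> 0 = 0\<close> and \<open>\<mu> pi = - pi\<close>: the operators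
        are \<open>A\<close> and \<open>A * s = A * B * einv A\<close>, the pair conjugated by
        \<open>A\<close>.\<close>
      assume K0: "K = 0"
      have "H pi * (A * s) = A' * H (- pi) * s" using R0[OF K0, of pi] by (metis mult.assoc)
      also have "\<dots> = A' * einv s' * H pi" by (simp add: Hm mult.assoc is0)
      finally have "H pi * (A * s) = B' * H pi" by (simp only: B's)
      moreover have "A * B * einv A = A * s"
        using rel(2) by (metis mult.assoc iA(1) mult.right_neutral)
      ultimately have Y': "H pi * (A * B * einv A) = B' * H pi" by simp
      have "Jsim cplx J br p (app A, app (A * B * einv A))"
        using Jsim_conj[OF A B A] by (simp add: p_eq mult.assoc iA)
      then show ?thesis
        using final[OF A aut_grp_mult[OF aut_grp_mult[OF A B] aut_grp_einv[OF A]] _ refl _ Y'] R0[OF K0, of 0] by simp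
    next
      \<comment> \<open>\<open>\<mu> 0 = pi\<close> and \<open>\<mu> pi = 0\<close>: the operators
        are those of the swapped pair.\<close>
      assume K1: "K = 1"
      have "H 0 * (A * einv s) = A' * H 0 * s * einv s" using R1[OF K1, of 0] by (metis mult.assoc minus_zero)
      then have X': "H 0 * B = A' * H 0" by (simp add: rel(3) mult.assoc is0)
      have "H pi * A = A' * einv s' * H pi" using R1[OF K1, of pi] by (simp add: Hm mult.assoc is0)
      then have Y': "H pi * A = B' * H pi" by (simp only: B's)
      show ?thesis using final[OF B A _ AB[symmetric] X' Y'] Jsim_swap[OF A B] by (simp add: p_eq)
    qed
  qed
qed

end

theorem theorem4p3:
  fixes br :: "'a::euclidean_space \<Rightarrow> 'a \<Rightarrow> 'a" and J :: "'a \<Rightarrow> 'a"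
    and cplx :: bool and q :: nat
  assumes simple: "simple_lie cplx J br"
    and compact: "\<not> cplx \<longrightarrow> compact_lie br"
    and qpos: "0 < q"
  shows "(\<forall>\<sigma> \<Phi> n. \<sigma> \<in> lie_aut cplx J br \<and> loop_aut cplx J br \<sigma> \<Phi>
            \<and> second_kind cplx J br \<sigma> \<Phi> \<and> has_order_on (loop_alg \<sigma>) \<Phi> n \<longrightarrow> even n)
       \<and> (even q \<longrightarrow>
            (\<forall>p\<in>Jpairs cplx J br q. explicit_aut p \<in> aut2_ord cplx J br q)
          \<and> (\<forall>p\<in>Jpairs cplx J br q. \<forall>p'\<in>Jpairs cplx J br q.
               Jsim cplx J br p p' \<longleftrightarrow> quasiconj cplx J br (explicit_aut p) (explicit_aut p'))
          \<and> (\<forall>x\<in>aut2_ord cplx J br q. \<exists>p\<in>Jpairs cplx J br q.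
               quasiconj cplx J br x (explicit_aut p)))"
proof -
  interpret simple_lie_algebra cplx J br by unfold_locales (rule simple)
  show ?thesis
    using second_kind_even_order explicit_aut_in_aut2_ord Jsim_quasiconj quasiconj_Jsim
      second_kind_normal_form by blast
qed

end
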